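(* Let $V=\mathbb C^2$. Then \[ M_2(SL(V),S^7V)=\mathcal Q(T^2c_7) \] is irreducible of dimension $4$. In particular, \[ T^2c_7\subsetneq M_2(SL(V),S^7V). \]
   Context: The base field is $\mathbb C$. For a projective variety $Y\subset\mathbb P(W)$, $I(Y)_2\subset S^2(W^* )$ is the space of quadratic forms vanishing on $Y$, and the quadratic hull of $Y$ is $\mathcal Q(Y)=Z(I(Y)_2)\subset\mathbb P(W)$, taken set-theoretically (reduced structure). For $V=\mathbb C^2$ and $r\ge1$, $c_r=\{[\ell^r]:0\ne\ell\in V\}\subset\mathbb P(S^rV)$ is the rational normal curve, the closed $SL(V)$-orbit of the highest weight line $[u^r]$, where $u\in V$ is a highest weight vector. With $U_{\le p}(\mathfrak{sl}_2)$ the span in $U(\mathfrak{sl}_2)$ of products of at most $p$ elements of $\mathfrak{sl}_2$, put $E_p(r)=U_{\le p}(\mathfrak{sl}_2)u^r\subset S^rV$. The $p$-osculating variety of $c_r$ is $T^pc_r=\overline{SL(V)\cdot\mathbb P(E_p(r))}\subset\mathbb P(S^rV)$. By definition, $M_p(SL(V),S^rV):=\mathcal Q(T^pc_r)$. *)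

theory Defs
  imports "HOL-Analysis.Analysis" "HOL-Library.Extended_Nat" "HOL-Library.Function_Algebras"
begin

section \<open>Symmetric powers as spaces of functions\<close>

interpretation cfun: vector_space "\<lambda>(c::complex) (f::'a \<Rightarrow> complex) x. c * f x"
  by unfold_locales (auto simp: fun_eq_iff algebra_simps)

text \<open>If \<open>L\<close> is a vector space of linear functions on a complex vector space \<open>U\<close>, its symmetric
  power \<open>S\<^sup>d L\<close> is the space of functions on \<open>U\<close> spanned by the \<open>d\<close>-fold products of elements of
  \<open>L\<close>; since the base field is infinite, nothing is lost by regarding homogeneous polynomials as
  functions. This is used twice: for \<open>S\<^sup>r V\<close>, where \<open>V\<close> acts on \<open>V\<^sup>*\<close> by evaluation, and for
  \<open>S\<^sup>d (W\<^sup>*)\<close>, where \<open>W\<^sup>*\<close> acts on \<open>W = S\<^sup>r V\<close>.\<close>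

definition sym_pow :: "nat \<Rightarrow> ('a \<Rightarrow> complex) set \<Rightarrow> ('a \<Rightarrow> complex) set" where
  "sym_pow d L = cfun.span {\<lambda>x. \<Prod>i<d. \<phi> i x | \<phi> :: nat \<Rightarrow> 'a \<Rightarrow> complex. \<forall>i<d. \<phi> i \<in> L}"

section \<open>Projective space and its Zariski topology\<close>

text \<open>The points of \<open>\<P>(W)\<close> are the lines of \<open>W\<close>, as sets of vectors.\<close>

definition proj :: "('a \<Rightarrow> complex) set \<Rightarrow> ('a \<Rightarrow> complex) set set" where
  "proj W = {cfun.span {w} | w. w \<in> W \<and> w \<noteq> 0}"

text \<open>Linear forms on \<open>W\<close> are extended by zero outside \<open>W\<close>, so that each element of \<open>W\<^sup>*\<close> is
  represented exactly once.\<close>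

definition dual :: "('a \<Rightarrow> complex) set \<Rightarrow> (('a \<Rightarrow> complex) \<Rightarrow> complex) set" where
  "dual W = {\<phi>. (\<forall>v\<in>W. \<forall>w\<in>W. \<phi> (v + w) = \<phi> v + \<phi> w) \<and>
                (\<forall>c. \<forall>w\<in>W. \<phi> (\<lambda>x. c * w x) = c * \<phi> w) \<and> (\<forall>w. w \<notin> W \<longrightarrow> \<phi> w = 0)}"

definition forms :: "('a \<Rightarrow> complex) set \<Rightarrow> nat \<Rightarrow> (('a \<Rightarrow> complex) \<Rightarrow> complex) set" where
  "forms W d = sym_pow d (dual W)"

definition zero_locus ::
    "('a \<Rightarrow> complex) set \<Rightarrow> (('a \<Rightarrow> complex) \<Rightarrow> complex) set \<Rightarrow> ('a \<Rightarrow> complex) set set" where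
  "zero_locus W \<F> = {P \<in> proj W. \<forall>F\<in>\<F>. \<forall>w\<in>P. F w = 0}"

definition vanishing_forms ::
    "('a \<Rightarrow> complex) set \<Rightarrow> nat \<Rightarrow> ('a \<Rightarrow> complex) set set \<Rightarrow> (('a \<Rightarrow> complex) \<Rightarrow> complex) set" where
  "vanishing_forms W d Y = {F \<in> forms W d. \<forall>P\<in>Y. \<forall>w\<in>P. F w = 0}"

definition quadratic_hull ::
    "('a \<Rightarrow> complex) set \<Rightarrow> ('a \<Rightarrow> complex) set set \<Rightarrow> ('a \<Rightarrow> complex) set set" where
  "quadratic_hull W Y = zero_locus W (vanishing_forms W 2 Y)"

definition zariski :: "('a \<Rightarrow> complex) set \<Rightarrow> ('a \<Rightarrow> complex) set topology" where
  "zariski W = topology (\<lambda>U. \<exists>\<F> \<subseteq> (\<Union>d. forms W d). U = proj W - zero_locus W \<F>)"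

definition irreducible_space :: "'b topology \<Rightarrow> bool" where
  "irreducible_space X \<longleftrightarrow> topspace X \<noteq> {} \<and>
     (\<forall>A B. closedin X A \<longrightarrow> closedin X B \<longrightarrow> A \<union> B = topspace X \<longrightarrow>
        A = topspace X \<or> B = topspace X)"

text \<open>For the empty space the supremum below is \<open>0\<close> instead of the conventional \<open>-\<infinity>\<close>.\<close>

definition krull_dim :: "'b topology \<Rightarrow> enat" where
  "krull_dim X = Sup {enat n | n. \<exists>C :: nat \<Rightarrow> 'b set.
     (\<forall>i\<le>n. closedin X (C i) \<and> irreducible_space (subtopology X (C i))) \<and>
     (\<forall>i<n. C i \<subset> C (Suc i))}"

section \<open>The \<open>SL(V)\<close>-modules \<open>S\<^sup>r V\<close> for \<open>V = \<complex>\<^sup>2\<close>\<close>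

text \<open>A vector \<open>l \<in> V\<close> as a linear function on \<open>V\<^sup>*\<close>, the latter being the space of row vectors.\<close>

definition lin :: "complex^2 \<Rightarrow> complex^2 \<Rightarrow> complex" where
  "lin l = (\<lambda>\<xi>. \<Sum>i\<in>UNIV. \<xi> $ i * l $ i)"

definition SymV :: "nat \<Rightarrow> (complex^2 \<Rightarrow> complex) set" where
  "SymV r = sym_pow r (range lin)"

definition SL2 :: "(complex^2^2) set" where
  "SL2 = {g. det g = 1}"

definition sl2 :: "(complex^2^2) set" where
  "sl2 = {X. trace X = 0}"

definition act :: "complex^2^2 \<Rightarrow> (complex^2 \<Rightarrow> complex) \<Rightarrow> complex^2 \<Rightarrow> complex" where
  "act g f = (\<lambda>\<xi>. f (\<xi> v* g))"

text \<open>The derivative of \<open>act (1 + t X) f\<close> at \<open>t = 0\<close>, that is, the action of \<open>X\<close> on polynomial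
  functions as the derivation extending \<open>l \<mapsto> X l\<close> on \<open>V\<close>; see \<open>lie_act_prod\<close>.\<close>

definition lie_act :: "complex^2^2 \<Rightarrow> (complex^2 \<Rightarrow> complex) \<Rightarrow> complex^2 \<Rightarrow> complex" where
  "lie_act X f = (\<lambda>\<xi>. deriv (\<lambda>t. f (\<xi> + t *s (\<xi> v* X))) 0)"

text \<open>The subspace \<open>U\<^bsub>\<le>p\<^esub>(sl\<^sub>2) u\<^sup>r\<close>: a product \<open>X\<^sub>1 \<cdots> X\<^sub>k\<close> in the enveloping algebra
  acts as the composition of the actions of its factors. Every nonzero \<open>u \<in> V\<close> is a highest
  weight vector with respect to some Borel subalgebra, so \<open>u\<close> is left as a parameter.\<close>

definition osc :: "nat \<Rightarrow> nat \<Rightarrow> complex^2 \<Rightarrow> (complex^2 \<Rightarrow> complex) set" where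
  "osc p r u = cfun.span
     {foldr lie_act Xs (\<lambda>\<xi>. lin u \<xi> ^ r) | Xs. set Xs \<subseteq> sl2 \<and> length Xs \<le> p}"

definition osculating_variety :: "nat \<Rightarrow> nat \<Rightarrow> complex^2 \<Rightarrow> (complex^2 \<Rightarrow> complex) set set" where
  "osculating_variety p r u =
     zariski (SymV r) closure_of {act g ` P | g P. g \<in> SL2 \<and> P \<in> proj (osc p r u)}"

definition M_variety :: "nat \<Rightarrow> nat \<Rightarrow> complex^2 \<Rightarrow> (complex^2 \<Rightarrow> complex) set set" where
  "M_variety p r u = quadratic_hull (SymV r) (osculating_variety p r u)"

section \<open>Basic facts\<close>

lemma act_prod: "act g (\<lambda>\<xi>. \<Prod>i<r. lin (l i) \<xi>) = (\<lambda>\<xi>. \<Prod>i<r. lin (g *v l i) \<xi>)"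
proof -
  have "lin m (\<xi> v* g) = lin (g *v m) \<xi>" for m \<xi>
    by (simp add: lin_def vector_matrix_mult_def matrix_vector_mult_def UNIV_2 algebra_simps)
  thus ?thesis by (simp add: act_def)
qed

lemma lie_act_prod:
  "lie_act X (\<lambda>\<xi>. \<Prod>i<r. lin (l i) \<xi>) =
     (\<lambda>\<xi>. \<Sum>k<r. lin (X *v l k) \<xi> * (\<Prod>i\<in>{..<r} - {k}. lin (l i) \<xi>))"
proof
  fix \<xi>
  have eq: "lin m (\<xi> + t *s (\<xi> v* X)) = lin m \<xi> + t * lin (X *v m) \<xi>" for m t
    by (simp add: lin_def vector_matrix_mult_def matrix_vector_mult_def UNIV_2 algebra_simps)
  have "((\<lambda>t. \<Prod>i<r. lin (l i) \<xi> + t * lin (X *v l i) \<xi>) has_field_derivative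
      (\<Sum>k<r. lin (X *v l k) \<xi> *
        (\<Prod>i\<in>{..<r} - {k}. lin (l i) \<xi> + 0 * lin (X *v l i) \<xi>))) (at 0)"
    by (rule has_field_derivative_prod) (auto intro!: derivative_eq_intros)
  thus "lie_act X (\<lambda>\<xi>. \<Prod>i<r. lin (l i) \<xi>) \<xi> =
      (\<Sum>k<r. lin (X *v l k) \<xi> * (\<Prod>i\<in>{..<r} - {k}. lin (l i) \<xi>))"
    by (simp add: lie_act_def eq DERIV_imp_deriv)
qed

lemma forms_mult:
  assumes "F \<in> forms W d" "G \<in> forms W e"
  shows "(\<lambda>w. F w * G w) \<in> forms W (d + e)"
proof -
  define B :: "nat \<Rightarrow> (('a \<Rightarrow> complex) \<Rightarrow> complex) set" where
    "B d = {\<lambda>x. \<Prod>i<d. \<phi> i x | \<phi>. \<forall>i<d. \<phi> i \<in> dual W}" for d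
  have forms_B: "forms W d = cfun.span (B d)" for d
    by (simp add: forms_def sym_pow_def B_def)
  have base: "(\<lambda>w. b w * c w) \<in> forms W (d + e)" if b: "b \<in> B d" and c: "c \<in> B e" for b c
  proof -
    from b obtain \<phi> where \<phi>: "b = (\<lambda>x. \<Prod>i<d. \<phi> i x)" "\<forall>i<d. \<phi> i \<in> dual W" by (auto simp: B_def)
    from c obtain \<psi> where \<psi>: "c = (\<lambda>x. \<Prod>i<e. \<psi> i x)" "\<forall>i<e. \<psi> i \<in> dual W" by (auto simp: B_def)
    have "(\<Prod>i<d+n. (if i < d then \<phi> i else \<psi> (i - d)) x) = (\<Prod>i<d. \<phi> i x) * (\<Prod>i<n. \<psi> i x)"
      for x n
      by (induction n) (simp_all add: algebra_simps)
    hence "(\<lambda>w. b w * c w) = (\<lambda>x. \<Prod>i<d+e. (if i < d then \<phi> i else \<psi> (i - d)) x)"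
      by (simp add: \<phi>(1) \<psi>(1))
    moreover have "\<dots> \<in> B (d + e)"
      unfolding B_def using \<phi>(2) \<psi>(2) by (intro CollectI exI conjI refl) auto
    ultimately show ?thesis
      by (simp add: forms_B cfun.span_base)
  qed
  have left: "(\<lambda>w. F w * c w) \<in> forms W (d + e)" if c: "c \<in> B e" for c
    using assms(1)[unfolded forms_B]
  proof (induction rule: cfun.span_induct_alt)
    case base
    show ?case using cfun.span_zero by (simp add: forms_B zero_fun_def)
  next
    case (step k b f)
    have "(\<lambda>w. k * (b w * c w)) + (\<lambda>w. f w * c w) \<in> forms W (d + e)"
      using base[OF step(1) c] step(2) unfolding forms_B
      by (intro cfun.span_add cfun.span_scale)
    thus ?case by (simp add: plus_fun_def algebra_simps)
  qed
  show ?thesis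
    using assms(2)[unfolded forms_B]
  proof (induction rule: cfun.span_induct_alt)
    case base
    show ?case using cfun.span_zero by (simp add: forms_B zero_fun_def)
  next
    case (step k b g)
    have "(\<lambda>w. k * (F w * b w)) + (\<lambda>w. F w * g w) \<in> forms W (d + e)"
      using left[OF step(1)] step(2) unfolding forms_B
      by (intro cfun.span_add cfun.span_scale)
    thus ?case by (simp add: plus_fun_def algebra_simps)
  qed
qed

lemma forms_homogeneous:
  assumes "F \<in> forms W d" "w \<in> W"
  shows "F (\<lambda>x. c * w x) = c ^ d * F w"
  using assms(1)[unfolded forms_def sym_pow_def]
proof (induction rule: cfun.span_induct_alt)
  case base
  show ?case by (simp add: zero_fun_def)
next
  case (step k b f)
  then obtain \<phi> where \<phi>: "b = (\<lambda>x. \<Prod>i<d. \<phi> i x)" "\<forall>i<d. \<phi> i \<in> dual W" by auto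
  have "(\<Prod>i<d. \<phi> i (\<lambda>x. c * w x)) = (\<Prod>i<d. c * \<phi> i w)"
    using \<phi>(2) assms(2) by (intro prod.cong refl) (auto simp: dual_def)
  thus ?case using step(2) by (simp add: \<phi>(1) plus_fun_def prod.distrib algebra_simps)
qed

lemma zero_locus_Un:
  assumes "\<F> \<subseteq> (\<Union>d. forms W d)" "\<G> \<subseteq> (\<Union>d. forms W d)"
  shows "zero_locus W {\<lambda>w. F w * G w | F G. F \<in> \<F> \<and> G \<in> \<G>} =
    zero_locus W \<F> \<union> zero_locus W \<G>" (is "?L = ?R")
proof
  have nonzero: "F w \<noteq> 0"
    if F: "F \<in> (\<Union>d. forms W d)" and w: "w \<in> W" and v: "v \<in> cfun.span {w}" "F v \<noteq> 0" for F v w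
  proof -
    obtain c where "v = (\<lambda>x. c * w x)" using v(1) by (auto simp: cfun.span_singleton)
    thus ?thesis using forms_homogeneous[of F W _ w c] F w v(2) by auto
  qed
  show "?L \<subseteq> ?R"
  proof
    fix P assume P: "P \<in> ?L"
    then obtain w where w: "w \<in> W" "P = cfun.span {w}" and "P \<in> proj W"
      by (auto simp: zero_locus_def proj_def)
    show "P \<in> ?R"
    proof (rule ccontr)
      assume "P \<notin> ?R"
      then obtain F v G v' where "F \<in> \<F>" "v \<in> P" "F v \<noteq> 0" "G \<in> \<G>" "v' \<in> P" "G v' \<noteq> 0"
        using \<open>P \<in> proj W\<close> by (auto simp: zero_locus_def)
      have "F w \<noteq> 0"
        by (rule nonzero[OF _ w(1)]) (use \<open>F \<in> \<F>\<close> \<open>v \<in> P\<close> \<open>F v \<noteq> 0\<close> assms(1) w(2) in auto)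
      moreover have "G w \<noteq> 0"
        by (rule nonzero[OF _ w(1)]) (use \<open>G \<in> \<G>\<close> \<open>v' \<in> P\<close> \<open>G v' \<noteq> 0\<close> assms(2) w(2) in auto)
      moreover have "w \<in> P" using w(2) cfun.span_base[of w "{w}"] by simp
      moreover have mem: "(\<lambda>w. F w * G w) \<in> {\<lambda>w. F w * G w | F G. F \<in> \<F> \<and> G \<in> \<G>}"
        using \<open>F \<in> \<F>\<close> \<open>G \<in> \<G>\<close> by blast
      have "\<forall>w\<in>P. F w * G w = 0"
      proof -
        have "\<forall>H \<in> {\<lambda>w. F w * G w | F G. F \<in> \<F> \<and> G \<in> \<G>}. \<forall>w\<in>P. H w = 0"
          using P unfolding zero_locus_def mem_Collect_eq by (rule conjunct2)
        from bspec[OF this mem] show ?thesis .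
      qed
      ultimately show False by auto
    qed
  qed
  show "?R \<subseteq> ?L" by (auto simp: zero_locus_def)
qed

lemma istopology_zariski:
  "istopology (\<lambda>U. \<exists>\<F> \<subseteq> (\<Union>d. forms W d). U = proj W - zero_locus W \<F>)"
  unfolding istopology_def
proof (intro conjI allI impI)
  fix S T assume "\<exists>\<F> \<subseteq> (\<Union>d. forms W d). S = proj W - zero_locus W \<F>"
    and "\<exists>\<F> \<subseteq> (\<Union>d. forms W d). T = proj W - zero_locus W \<F>"
  then obtain \<F> \<G> where FG: "\<F> \<subseteq> (\<Union>d. forms W d)" "\<G> \<subseteq> (\<Union>d. forms W d)"
    and ST: "S = proj W - zero_locus W \<F>" "T = proj W - zero_locus W \<G>" by auto
  let ?H = "{\<lambda>w. F w * G w | F G. F \<in> \<F> \<and> G \<in> \<G>}"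
  have "?H \<subseteq> (\<Union>d. forms W d)"
  proof
    fix h assume "h \<in> ?H"
    then obtain F G where "h = (\<lambda>w. F w * G w)" "F \<in> \<F>" "G \<in> \<G>" by blast
    moreover from this FG obtain d e where "F \<in> forms W d" "G \<in> forms W e" by blast
    ultimately show "h \<in> (\<Union>d. forms W d)" using forms_mult by blast
  qed
  moreover have "S \<inter> T = proj W - zero_locus W ?H"
    unfolding zero_locus_Un[OF FG] ST by blast
  ultimately show "\<exists>\<F> \<subseteq> (\<Union>d. forms W d). S \<inter> T = proj W - zero_locus W \<F>" by blast
next
  fix \<K> assume "\<forall>U\<in>\<K>. \<exists>\<F> \<subseteq> (\<Union>d. forms W d). U = proj W - zero_locus W \<F>"
  then obtain f where f: "\<And>U. U \<in> \<K> \<Longrightarrow> f U \<subseteq> (\<Union>d. forms W d)"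
    "\<And>U. U \<in> \<K> \<Longrightarrow> U = proj W - zero_locus W (f U)" by metis
  have "\<Union>\<K> = (\<Union>U\<in>\<K>. proj W - zero_locus W (f U))"
    using f(2) by auto
  also have "\<dots> = proj W - zero_locus W (\<Union>U\<in>\<K>. f U)"
    by (auto simp: zero_locus_def)
  finally show "\<exists>\<F> \<subseteq> (\<Union>d. forms W d). \<Union>\<K> = proj W - zero_locus W \<F>"
    using f(1) by (intro exI[of _ "\<Union>U\<in>\<K>. f U"]) blast
qed

lemma openin_zariski:
  "openin (zariski W) U \<longleftrightarrow> (\<exists>\<F> \<subseteq> (\<Union>d. forms W d). U = proj W - zero_locus W \<F>)"
  unfolding zariski_def by (simp add: istopology_zariski topology_inverse')

lemma topspace_zariski: "topspace (zariski W) = proj W"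
proof -
  have "(\<lambda>_. 1) \<in> forms W 0"
    by (auto simp: forms_def sym_pow_def intro!: cfun.span_base)
  moreover have "zero_locus W {\<lambda>_. 1} = {}"
    using cfun.span_zero by (fastforce simp: zero_locus_def proj_def)
  ultimately have "openin (zariski W) (proj W)"
    unfolding openin_zariski by (intro exI[of _ "{\<lambda>_. 1}"]) auto
  thus ?thesis by (auto simp: topspace_def openin_zariski)
qed

lemma closedin_zariski:
  "closedin (zariski W) Z \<longleftrightarrow> (\<exists>\<F> \<subseteq> (\<Union>d. forms W d). Z = zero_locus W \<F>)"
proof -
  have "zero_locus W \<F> \<subseteq> proj W" for \<F> by (auto simp: zero_locus_def)
  thus ?thesis
    unfolding closedin_def topspace_zariski openin_zariski by (metis double_diff order_refl)
qed

end

theory Submission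
  imports Defs
begin

text \<open>Write a binary septic as \<open>f = \<Sum>i\<le>7. (7 choose i) a\<^sub>i x\<^bsup>7-i\<^esup> y\<^sup>i\<close>. The osculating variety \<open>T\<close> is the
  closure of the set of lines spanned by forms \<open>l\<^sup>5 Q\<close> with \<open>l\<close> linear and \<open>Q\<close> quadratic
  (\<open>osculating_orbit\<close>), and everything rests on the quadrics through it: they are spanned by the
  three coefficients of the transvectant \<open>(f, f)\<^sub>6\<close>,

  \<^item> \<open>a\<^sub>0 a\<^sub>6 - 6 a\<^sub>1 a\<^sub>5 + 15 a\<^sub>2 a\<^sub>4 - 10 a\<^sub>3\<^sup>2\<close>,
  \<^item> \<open>a\<^sub>0 a\<^sub>7 - 5 a\<^sub>1 a\<^sub>6 + 9 a\<^sub>2 a\<^sub>5 - 5 a\<^sub>3 a\<^sub>4\<close>,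
  \<^item> \<open>a\<^sub>1 a\<^sub>7 - 6 a\<^sub>2 a\<^sub>6 + 15 a\<^sub>3 a\<^sub>5 - 10 a\<^sub>4\<^sup>2\<close>.

  To see this it is enough to look at the points of \<open>T\<close> with \<open>a\<^sub>i = t\<^sup>i P(i)\<close> for a polynomial \<open>P\<close> of
  degree at most two: the powers of \<open>t\<close> split a quadric into its parts of constant \<open>i + j\<close>, and
  choosing the zeros of \<open>P\<close> isolates the coefficients of each part
  (\<open>quadric_vanishing_on_osc_coords\<close>). Hence \<open>M\<close> is the common zero locus of three explicit quadrics
  (\<open>M_variety_eq\<close>).

  Irreducibility. A substitution \<open>x \<mapsto> x + s y\<close> makes \<open>a\<^sub>7\<close> nonzero, and then \<open>y \<mapsto> y + t x\<close> kills \<open>a\<^sub>6\<close>.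
  With \<open>a\<^sub>6 = 0\<close> and \<open>a\<^sub>7 = 1\<close> the last two quadrics determine \<open>a\<^sub>0\<close> and \<open>a\<^sub>1\<close>, and the first one becomes
  \<open>15 a\<^sub>2 a\<^sub>4 = 10 a\<^sub>3\<^sup>2 - 90 a\<^sub>3 a\<^sub>5\<^sup>2 + 60 a\<^sub>4\<^sup>2 a\<^sub>5\<close>, which is linear in \<open>a\<^sub>2\<close>. Where \<open>a\<^sub>4 \<noteq> 0\<close> it can be solved
  for \<open>a\<^sub>2\<close>, and a point with \<open>a\<^sub>4 = 0\<close> is the limit of a polynomial curve of such points. So \<open>M\<close> is the
  closure of the image of an affine space under a polynomial map (\<open>irreducible_apolar_locus\<close>).

  Upper bound for the dimension. Along a chain \<open>C\<^sub>0 \<subset> \<dots> \<subset> C\<^sub>n\<close> of irreducible closed sets, forms \<open>F\<^sub>j\<close>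
  that vanish on \<open>C\<^bsub>j-1\<^esub>\<close> but not on \<open>C\<^sub>j\<close> have independent monomials on \<open>C\<^sub>n\<close>, so the number of
  independent forms of degree \<open>d\<close> on \<open>C\<^sub>n\<close> grows at least like \<open>d\<^sup>n\<close> (\<open>chain_independent_forms\<close>,
  \<open>krull_dim_le\<close>). On \<open>M\<close> the three quadrics rewrite \<open>a\<^sub>3\<^sup>2\<close>, \<open>a\<^sub>0 a\<^sub>7\<close> and \<open>a\<^sub>4\<^sup>2\<close> in terms of monomials of
  smaller weight, and at most \<open>8 (d + 1)\<^sup>4\<close> monomials of degree \<open>d\<close> avoid these three
  (\<open>apolar_locus_growth\<close>).

  Lower bound and strictness. The sets of lines in \<open>\<langle>x\<^sup>7\<rangle>\<close>, in \<open>\<langle>x\<^sup>7, x\<^sup>6 y\<rangle>\<close> and in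
  \<open>\<langle>x\<^sup>7, x\<^sup>6 y, x\<^sup>5 y\<^sup>2\<rangle>\<close>, then \<open>T\<close> and \<open>M\<close>, form a strict chain. The last inclusion is strict because
  the coordinates of \<open>l\<^sup>5 Q\<close> satisfy a linear recurrence of order three, so that a \<open>4 \<times> 4\<close> minor of the
  Hankel matrix \<open>(a\<^bsub>i+j\<^esub>)\<close> vanishes on \<open>T\<close>, but not at the point \<open>x\<^sup>7 + 21 x\<^sup>2 y\<^sup>5\<close> of \<open>M\<close>
  (\<open>closure_osc_locus_neq\<close>).\<close>

section \<open>Forms and their vanishing\<close>

lemma forms_span:
  "forms W d = cfun.span {\<lambda>x. \<Prod>i<d. \<phi> i x | \<phi>. \<forall>i<d. \<phi> i \<in> dual W}"
  by (simp add: forms_def sym_pow_def)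

lemma forms_zero: "(\<lambda>_. 0) \<in> forms W d"
  using cfun.span_zero unfolding forms_span zero_fun_def by blast

lemma forms_add: "F \<in> forms W d \<Longrightarrow> G \<in> forms W d \<Longrightarrow> (\<lambda>w. F w + G w) \<in> forms W d"
  using cfun.span_add unfolding forms_span plus_fun_def by blast

lemma forms_scale: "F \<in> forms W d \<Longrightarrow> (\<lambda>w. c * F w) \<in> forms W d"
  using cfun.span_scale unfolding forms_span by blast

lemma forms_diff: "F \<in> forms W d \<Longrightarrow> G \<in> forms W d \<Longrightarrow> (\<lambda>w. F w - G w) \<in> forms W d"
  using cfun.span_diff unfolding forms_span fun_diff_def by blast

lemma forms_sum: "(\<And>i. i \<in> I \<Longrightarrow> F i \<in> forms W d) \<Longrightarrow> (\<lambda>w. \<Sum>i\<in>I. F i w) \<in> forms W d"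
  by (induction I rule: infinite_finite_induct) (auto intro: forms_zero forms_add)

lemma forms_dual: "\<phi> \<in> dual W \<Longrightarrow> \<phi> \<in> forms W 1"
  unfolding forms_span by (rule cfun.span_base) (auto intro!: exI[of _ "\<lambda>_. \<phi>"])

lemma forms_one: "(\<lambda>_. 1) \<in> forms W 0"
  unfolding forms_span by (rule cfun.span_base) auto

lemma forms_power: "F \<in> forms W d \<Longrightarrow> (\<lambda>w. F w ^ k) \<in> forms W (k * d)"
  by (induction k) (auto intro: forms_one forms_mult)

lemma line_cases:
  assumes "P \<in> proj W" "v \<in> P" "w \<in> P" "w \<noteq> 0"
  obtains c where "v = (\<lambda>x. c * w x)"
proof -
  obtain z where P: "P = cfun.span {z}" using assms(1) by (auto simp: proj_def)
  obtain a b where v: "v = (\<lambda>x. a * z x)" and w: "w = (\<lambda>x. b * z x)"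
    using assms(2,3) by (auto simp: P cfun.span_singleton)
  have "b \<noteq> 0" using assms(4) w by (auto simp: fun_eq_iff)
  hence "v = (\<lambda>x. (a / b) * w x)" by (simp add: v w)
  thus ?thesis by (rule that)
qed

lemma span_in_proj: "w \<in> W \<Longrightarrow> w \<noteq> 0 \<Longrightarrow> cfun.span {w} \<in> proj W"
  by (auto simp: proj_def)

lemma proj_subset:
  assumes "cfun.subspace W" "P \<in> proj W" shows "P \<subseteq> W"
  using assms by (auto simp: proj_def intro: cfun.span_minimal[THEN subsetD, of "{_}" W])

text \<open>A subset \<open>Z\<close> of \<open>\<P>(W)\<close> is a set of lines, so \<open>\<Union>Z\<close> is the cone over \<open>Z\<close>, on which forms can be
  evaluated.\<close>

definition vanishes_on where
  "vanishes_on Z F \<longleftrightarrow> (\<forall>w\<in>\<Union>Z. F w = (0::complex))"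

lemma vanishes_onD: "vanishes_on Z F \<Longrightarrow> P \<in> Z \<Longrightarrow> w \<in> P \<Longrightarrow> F w = 0"
  by (auto simp: vanishes_on_def)

lemma vanishes_on_mono: "vanishes_on Z F \<Longrightarrow> Z' \<subseteq> Z \<Longrightarrow> vanishes_on Z' F"
  by (auto simp: vanishes_on_def)

lemma form_vanishes_on_line:
  assumes "F \<in> forms W d" "P \<in> proj W" "cfun.subspace W" "w \<in> P" "w \<noteq> 0" "F w = 0" "v \<in> P"
  shows "F v = 0"
proof -
  obtain c where "v = (\<lambda>x. c * w x)" using line_cases assms by metis
  moreover have "w \<in> W" using assms proj_subset by blast
  ultimately show ?thesis using forms_homogeneous[OF assms(1), of w c] assms(6) by simp
qed

lemma proj_nonzero: "P \<in> proj W \<Longrightarrow> \<exists>w\<in>P. w \<noteq> 0"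
  using cfun.span_base by (fastforce simp: proj_def)

lemma in_zero_locus: "P \<in> zero_locus W \<F> \<longleftrightarrow> P \<in> proj W \<and> (\<forall>F\<in>\<F>. vanishes_on {P} F)"
  by (auto simp: zero_locus_def vanishes_on_def)

lemma closedin_form:
  assumes "F \<in> forms W d" shows "closedin (zariski W) (zero_locus W {F})"
  unfolding closedin_zariski using assms by (intro exI[of _ "{F}"]) auto

lemma sum_fun_apply: "(\<Sum>i\<in>I. f i) x = (\<Sum>i\<in>I. f i x :: complex)"
  by (induction I rule: infinite_finite_induct) auto

text \<open>The homogeneous ideal of an irreducible set is prime: \<open>Z\<close> is covered by the zero loci of the two
  factors.\<close>

lemma irreducible_prime:
  assumes irr: "irreducible_space (subtopology (zariski W) Z)"
    and W: "cfun.subspace W" and Z: "Z \<subseteq> proj W"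
    and F: "F \<in> forms W d" and G: "G \<in> forms W e"
    and FG: "vanishes_on Z (\<lambda>w. F w * G w)"
  shows "vanishes_on Z F \<or> vanishes_on Z G"
proof -
  let ?A = "zero_locus W {F}" and ?B = "zero_locus W {G}"
  have cl: "closedin (zariski W) ?A" "closedin (zariski W) ?B"
    by (fact closedin_form[OF F], fact closedin_form[OF G])
  have "P \<in> ?A \<union> ?B" if P: "P \<in> Z" for P
  proof -
    have PW: "P \<in> proj W" using P Z by blast
    obtain w where w: "w \<in> P" "w \<noteq> 0" using proj_nonzero[OF PW] by blast
    hence "F w = 0 \<or> G w = 0" using vanishes_onD[OF FG P] by auto
    moreover have "P \<in> ?A" if "F w = 0"
      using form_vanishes_on_line[where F = F and w = w, OF F PW W w that] PW
      by (simp add: zero_locus_def)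
    moreover have "P \<in> ?B" if "G w = 0"
      using form_vanishes_on_line[where F = G and w = w, OF G PW W w that] PW
      by (simp add: zero_locus_def)
    ultimately show ?thesis by blast
  qed
  moreover have top: "topspace (subtopology (zariski W) Z) = Z"
    using Z by (auto simp: topspace_zariski)
  ultimately have "(Z \<inter> ?A) \<union> (Z \<inter> ?B) = topspace (subtopology (zariski W) Z)" by blast
  moreover have "closedin (subtopology (zariski W) Z) (Z \<inter> ?A)"
    "closedin (subtopology (zariski W) Z) (Z \<inter> ?B)"
    using cl by (auto simp: closedin_subtopology)
  ultimately have "Z \<inter> ?A = Z \<or> Z \<inter> ?B = Z"
    using irr unfolding irreducible_space_def top by blast
  thus ?thesis by (auto simp: vanishes_on_def zero_locus_def)
qed

section \<open>Irreducibility by connecting curves\<close>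

definition polyfun :: "(complex \<Rightarrow> complex) \<Rightarrow> bool" where
  "polyfun f \<longleftrightarrow> (\<exists>p. f = poly p)"

lemma polyfun_const [intro!]: "polyfun (\<lambda>_. c)"
  by (auto simp: polyfun_def fun_eq_iff intro!: exI[of _ "[:c:]"])

lemma polyfun_ident [intro!]: "polyfun (\<lambda>t. t)"
  by (auto simp: polyfun_def fun_eq_iff intro!: exI[of _ "[:0, 1:]"])

lemma polyfun_add [intro!]: "polyfun f \<Longrightarrow> polyfun g \<Longrightarrow> polyfun (\<lambda>t. f t + g t)"
  by (auto simp: polyfun_def fun_eq_iff intro: exI[of _ "_ + _"] poly_add[symmetric])

lemma polyfun_mult [intro!]: "polyfun f \<Longrightarrow> polyfun g \<Longrightarrow> polyfun (\<lambda>t. f t * g t)"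
  by (auto simp: polyfun_def fun_eq_iff intro: exI[of _ "_ * _"] poly_mult[symmetric])

lemma polyfun_diff [intro!]: "polyfun f \<Longrightarrow> polyfun g \<Longrightarrow> polyfun (\<lambda>t. f t - g t)"
  by (auto simp: polyfun_def fun_eq_iff intro: exI[of _ "_ - _"] poly_diff[symmetric])

lemma polyfun_divide [intro!]: "polyfun f \<Longrightarrow> polyfun (\<lambda>t. f t / c)"
  using polyfun_mult[OF _ polyfun_const[of "1 / c"], of f] by simp

lemma polyfun_power [intro!]: "polyfun f \<Longrightarrow> polyfun (\<lambda>t. f t ^ k)"
  by (induction k) auto

lemma polyfun_sum: "(\<And>i. i \<in> I \<Longrightarrow> polyfun (f i)) \<Longrightarrow> polyfun (\<lambda>t. \<Sum>i\<in>I. f i t)"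
  by (induction I rule: infinite_finite_induct) auto

lemma polyfun_prod: "(\<And>i. i \<in> I \<Longrightarrow> polyfun (f i)) \<Longrightarrow> polyfun (\<lambda>t. \<Prod>i\<in>I. f i t)"
  by (induction I rule: infinite_finite_induct) auto

lemma polyfun_finite_zeros:
  assumes "polyfun f" "f s \<noteq> 0" shows "finite {t. f t = 0}"
proof -
  obtain p where p: "f = poly p" using assms by (auto simp: polyfun_def)
  hence "p \<noteq> 0" using assms(2) by auto
  thus ?thesis using poly_roots_finite p by blast
qed

lemma finite_cofinite_ex: "finite A \<Longrightarrow> \<exists>t::complex. t \<notin> A"
  using ex_new_if_finite infinite_UNIV_char_0 by blast

lemma polyfun_zero_at:
  assumes "polyfun f" "\<And>t. t \<noteq> 0 \<Longrightarrow> f t = 0" shows "f s = 0"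
proof (rule ccontr)
  assume "f s \<noteq> 0"
  hence "finite {t. f t = 0}" by (rule polyfun_finite_zeros[OF assms(1)])
  hence "finite (insert 0 {t. f t = 0})" by simp
  thus False using finite_cofinite_ex assms(2) by blast
qed

text \<open>Such a curve may be given by any expression in its parameter; all that matters is that it pulls
  forms back to polynomials in one variable, which have finitely many zeros.\<close>

definition polynomial_curve where
  "polynomial_curve W \<gamma> \<longleftrightarrow> (\<forall>d. \<forall>F\<in>forms W d. polyfun (\<lambda>t. F (\<gamma> t)))"

lemma evaluation_dual:
  assumes "cfun.subspace W"
  shows "(\<lambda>w. if w \<in> W then w x else 0) \<in> dual W"
  using cfun.subspace_add[OF assms] cfun.subspace_scale[OF assms]
  by (auto simp: dual_def)

text \<open>Two forms that do not vanish on \<open>Z\<close> are nonzero at points \<open>v\<close> and \<open>w\<close> of the dense set \<open>S\<close>. On a curve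
  in \<open>S\<close> through \<open>v\<close> and \<open>w\<close> both restrict to nonzero polynomials, so at all but finitely many
  parameters neither of them vanishes. Hence no two proper closed subsets cover \<open>Z\<close>. In this way an
  image of an affine space is handled without polynomials in several variables.\<close>

lemma irreducible_by_curves:
  fixes W :: "('a \<Rightarrow> complex) set"
  assumes W: "cfun.subspace W" and Z: "Z \<subseteq> proj W" "Z \<noteq> {}"
    and S: "S \<subseteq> W" "\<And>w. w \<in> S \<Longrightarrow> w \<noteq> 0 \<Longrightarrow> cfun.span {w} \<in> Z"
    and dense: "\<And>d F. F \<in> forms W d \<Longrightarrow> (\<And>w. w \<in> S \<Longrightarrow> w \<noteq> 0 \<Longrightarrow> F w = 0) \<Longrightarrow> vanishes_on Z F"
    and curve: "\<And>v w. v \<in> S \<Longrightarrow> w \<in> S \<Longrightarrow>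
      \<exists>\<gamma>. polynomial_curve W \<gamma> \<and> range \<gamma> \<subseteq> S \<and> v \<in> range \<gamma> \<and> w \<in> range \<gamma>"
  shows "irreducible_space (subtopology (zariski W) Z)"
  unfolding irreducible_space_def
proof (intro conjI allI impI)
  have top: "topspace (subtopology (zariski W) Z) = Z"
    using Z by (auto simp: topspace_zariski)
  show "topspace (subtopology (zariski W) Z) \<noteq> {}" using top Z by simp
  fix A B
  assume A: "closedin (subtopology (zariski W) Z) A" and B: "closedin (subtopology (zariski W) Z) B"
    and AB: "A \<union> B = topspace (subtopology (zariski W) Z)"
  have sep: "\<exists>d F. F \<in> forms W d \<and> vanishes_on A F \<and> \<not> vanishes_on Z F"
    if A: "closedin (subtopology (zariski W) Z) A" and ne: "A \<noteq> Z" for A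
  proof -
    obtain \<F> where FF: "\<F> \<subseteq> (\<Union>d. forms W d)" "A = Z \<inter> zero_locus W \<F>"
      using A by (auto simp: closedin_subtopology closedin_zariski)
    obtain P where "P \<in> Z" "P \<notin> zero_locus W \<F>" using FF ne by blast
    then obtain F where "F \<in> \<F>" "\<not> vanishes_on {P} F" using Z by (auto simp: in_zero_locus)
    moreover have "vanishes_on A F" using \<open>F \<in> \<F>\<close> FF(2) by (auto simp: vanishes_on_def zero_locus_def)
    moreover have "\<not> vanishes_on Z F"
      using \<open>P \<in> Z\<close> \<open>\<not> vanishes_on {P} F\<close> by (auto simp: vanishes_on_def)
    ultimately show ?thesis using FF(1) by blast
  qed
  show "A = topspace (subtopology (zariski W) Z) \<or> B = topspace (subtopology (zariski W) Z)"
  proof (rule ccontr)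
    assume "\<not> ?thesis"
    hence "A \<noteq> Z" "B \<noteq> Z" using top by auto
    then obtain d F e G where F: "F \<in> forms W d" "vanishes_on A F" "\<not> vanishes_on Z F"
      and G: "G \<in> forms W e" "vanishes_on B G" "\<not> vanishes_on Z G"
      using sep[OF A] sep[OF B] by metis
    obtain v where v: "v \<in> S" "v \<noteq> 0" "F v \<noteq> 0" using dense[OF F(1)] F(3) by blast
    obtain w where w: "w \<in> S" "w \<noteq> 0" "G w \<noteq> 0" using dense[OF G(1)] G(3) by blast
    obtain \<gamma> r s where \<gamma>: "polynomial_curve W \<gamma>" "range \<gamma> \<subseteq> S" "v = \<gamma> r" "w = \<gamma> s"
      using curve[OF v(1) w(1)] by blast
    obtain x where x: "v x \<noteq> 0" using v(2) by (auto simp: fun_eq_iff)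
    \<comment> \<open>The curve may pass through the zero vector, which spans no point; a linear form excludes this.\<close>
    define ev where "ev = (\<lambda>w. if w \<in> W then w x else 0)"
    have "ev \<in> forms W 1" unfolding ev_def by (intro forms_dual evaluation_dual W)
    hence poly: "polyfun (\<lambda>t. F (\<gamma> t))" "polyfun (\<lambda>t. G (\<gamma> t))" "polyfun (\<lambda>t. ev (\<gamma> t))"
      using \<gamma>(1) F(1) G(1) by (auto simp: polynomial_curve_def)
    have "finite {t. F (\<gamma> t) = 0}" using polyfun_finite_zeros[OF poly(1), of r] v(3) \<gamma>(3) by simp
    moreover have "finite {t. G (\<gamma> t) = 0}" using polyfun_finite_zeros[OF poly(2), of s] w(3) \<gamma>(4) by simp
    moreover have "finite {t. ev (\<gamma> t) = 0}"
    proof (rule polyfun_finite_zeros[OF poly(3)])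
      show "ev (\<gamma> r) \<noteq> 0" using x \<gamma>(3) v(1) S(1) by (auto simp: ev_def)
    qed
    ultimately obtain t where "F (\<gamma> t) \<noteq> 0" "G (\<gamma> t) \<noteq> 0" "ev (\<gamma> t) \<noteq> 0"
      using finite_cofinite_ex[of "{t. F (\<gamma> t) = 0} \<union> {t. G (\<gamma> t) = 0} \<union> {t. ev (\<gamma> t) = 0}"]
      by auto
    moreover from this have "\<gamma> t \<noteq> 0" by (auto simp: ev_def split: if_splits)
    hence "cfun.span {\<gamma> t} \<in> A \<union> B" using S(2)[of "\<gamma> t"] \<gamma>(2) AB top by blast
    moreover have "\<gamma> t \<in> cfun.span {\<gamma> t}" by (rule cfun.span_base) simp
    ultimately show False using F(2) G(2) unfolding vanishes_on_def by blast
  qed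
qed

section \<open>Dimension and the growth of the space of forms\<close>

definition independent_on where
  "independent_on Z I g \<longleftrightarrow>
     (\<forall>c. vanishes_on Z (\<lambda>w. \<Sum>i\<in>I. c i * g i w) \<longrightarrow> (\<forall>i\<in>I. c i = 0))"

lemma independent_on_mono: "independent_on Z I g \<Longrightarrow> Z \<subseteq> Z' \<Longrightarrow> independent_on Z' I g"
  unfolding independent_on_def using vanishes_on_mono by blast

text \<open>Linear independence is only tested on \<open>Z\<close>, so the forms may first be replaced by elements of the
  span of \<open>T\<close> that agree with them there.\<close>

lemma card_independent_on:
  assumes I: "independent_on Z I g" "finite I" and T: "finite T"
    and span: "\<And>i. i \<in> I \<Longrightarrow> \<exists>h\<in>cfun.span T. \<forall>w\<in>\<Union>Z. g i w = h w"
  shows "card I \<le> card T"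
proof -
  obtain h where h: "\<And>i. i \<in> I \<Longrightarrow> h i \<in> cfun.span T" "\<And>i w. i \<in> I \<Longrightarrow> w \<in> \<Union>Z \<Longrightarrow> g i w = h i w"
    using span by metis
  have indep: "\<forall>i\<in>I. c i = 0" if hc: "\<And>w. w \<in> \<Union>Z \<Longrightarrow> (\<Sum>i\<in>I. c i * h i w) = 0" for c
  proof -
    have "(\<Sum>i\<in>I. c i * g i w) = 0" if w: "w \<in> \<Union>Z" for w
      using hc[OF w] h(2)[OF _ w] by simp
    hence "vanishes_on Z (\<lambda>w. \<Sum>i\<in>I. c i * g i w)" by (simp add: vanishes_on_def)
    thus ?thesis using I(1) unfolding independent_on_def by blast
  qed
  have inj: "inj_on h I"
  proof (rule inj_onI, rule ccontr)
    fix i j assume ij: "i \<in> I" "j \<in> I" "h i = h j" "i \<noteq> j"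
    define c where "c k = (if k = i then 1 else if k = j then -1 else 0 :: complex)" for k
    have "(\<Sum>k\<in>I. c k * h k w) = (\<Sum>k\<in>{i,j}. c k * h k w)" for w
      using ij I(2) by (intro sum.mono_neutral_right) (auto simp: c_def)
    hence "(\<Sum>k\<in>I. c k * h k w) = 0" for w using ij by (simp add: c_def)
    hence "c i = 0" using indep[of c] ij(1) by blast
    thus False by (simp add: c_def)
  qed
  have "cfun.independent (h ` I)"
  proof (rule cfun.independent_if_scalars_zero)
    fix c x assume z: "(\<Sum>x\<in>h ` I. (\<lambda>y. c x * x y)) = 0" and x: "x \<in> h ` I"
    have "(\<Sum>i\<in>I. c (h i) * h i w) = 0" for w
      using fun_cong[OF z, of w] inj by (simp add: sum.reindex sum_fun_apply)
    thus "c x = 0" using indep[of "\<lambda>i. c (h i)"] x by auto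
  qed (use I(2) in auto)
  hence "card (h ` I) \<le> card T"
    using cfun.independent_span_bound[OF T] h(1) by blast
  thus ?thesis by (simp add: card_image[OF inj])
qed

text \<open>On \<open>Z'\<close> only the constant term of the expansion in powers of \<open>F\<close> survives, so this term is zero. The
  rest is divisible by \<open>F\<close>, which can be cancelled on \<open>Z\<close> because the ideal of \<open>Z\<close> is prime.\<close>

lemma power_expansion_unique:
  assumes irr: "irreducible_space (subtopology (zariski W) Z)"
    and W: "cfun.subspace W" and Z: "Z \<subseteq> proj W" "Z' \<subseteq> Z"
    and F: "F \<in> forms W e" "vanishes_on Z' F" "\<not> vanishes_on Z F"
    and D: "k * e \<le> D" and G: "\<And>r. r < k \<Longrightarrow> G r \<in> forms W (D - r * e)"
    and G0: "\<And>r. r < k \<Longrightarrow> vanishes_on Z' (G r) \<Longrightarrow> G r = (\<lambda>_. 0)"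
    and "vanishes_on Z (\<lambda>w. \<Sum>r<k. F w ^ r * G r w)"
  shows "\<forall>r<k. G r = (\<lambda>_. 0)"
  using D G G0 assms(11)
proof (induction k arbitrary: D G)
  case (Suc k)
  have split: "(\<Sum>r<Suc k. F w ^ r * G r w) = G 0 w + F w * (\<Sum>r<k. F w ^ r * G (Suc r) w)" for w
    by (simp only: sum.lessThan_Suc_shift) (simp add: sum_distrib_left mult.assoc)
  have "vanishes_on Z' (G 0)"
    using Suc.prems(4) F(2) Z(2) unfolding split vanishes_on_def by fastforce
  hence G0: "G 0 = (\<lambda>_. 0)" using Suc.prems(3) by blast
  have H: "G (Suc r) \<in> forms W (D - e - r * e)" if "r < k" for r
    using Suc.prems(2)[of "Suc r"] that by (simp add: algebra_simps)
  have "(\<lambda>w. F w ^ r * G (Suc r) w) \<in> forms W (D - e)" if "r < k" for r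
  proof -
    have "Suc r * e \<le> Suc k * e" using that by (intro mult_le_mono1) simp
    hence "e + r * e \<le> D" using Suc.prems(1) unfolding mult_Suc by linarith
    hence "r * e + (D - e - r * e) = D - e" by simp
    thus ?thesis using forms_mult[OF forms_power[OF F(1), of r] H[OF that]] by simp
  qed
  hence sumf: "(\<lambda>w. \<Sum>r<k. F w ^ r * G (Suc r) w) \<in> forms W (D - e)"
    by (intro forms_sum) auto
  have "vanishes_on Z (\<lambda>w. F w * (\<Sum>r<k. F w ^ r * G (Suc r) w))"
    using Suc.prems(4) unfolding split G0 by simp
  hence "vanishes_on Z (\<lambda>w. \<Sum>r<k. F w ^ r * G (Suc r) w)"
    using irreducible_prime[OF irr W Z(1) F(1) sumf] F(3) by blast
  hence "\<forall>r<k. G (Suc r) = (\<lambda>_. 0)"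
    using Suc.prems H by (intro Suc.IH[of "D - e"]) auto
  thus ?case using G0 by (auto simp: less_Suc_eq_0_disj)
qed simp

text \<open>For each \<open>j\<close> let \<open>F\<^sub>j\<close> vanish on \<open>C (j - 1)\<close> but not on \<open>C j\<close>. The independent forms are the products
  \<open>F\<^sub>n ^ r\<^sub>n \<cdots> F\<^sub>1 ^ r\<^sub>1\<close> with all \<open>r\<^sub>j < k\<close>, indexed by their lists of exponents and brought to the common
  degree \<open>D\<close> by a power of a linear form that is nonzero at a point of \<open>C 0\<close>. The number \<open>E\<close> is the sum
  of the degrees of the \<open>F\<^sub>j\<close>.\<close>

lemma chain_independent_forms:
  fixes W :: "('a \<Rightarrow> complex) set" and C :: "nat \<Rightarrow> ('a \<Rightarrow> complex) set set"
  assumes W: "cfun.subspace W"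
    and C: "\<And>i. i \<le> n \<Longrightarrow> closedin (zariski W) (C i)"
      "\<And>i. i \<le> n \<Longrightarrow> irreducible_space (subtopology (zariski W) (C i))"
      "\<And>i. i < n \<Longrightarrow> C i \<subset> C (Suc i)"
  shows "\<exists>E. \<forall>k D. k * E \<le> D \<longrightarrow> (\<exists>(I::nat list set) g. finite I \<and> card I = k ^ n \<and>
    (\<forall>i\<in>I. g i \<in> forms W D) \<and> independent_on (C n) I g)"
  using C
proof (induction n)
  case 0
  have C0: "closedin (zariski W) (C 0)" using 0 by simp
  hence sub: "C 0 \<subseteq> proj W" using closedin_subset by (fastforce simp: topspace_zariski)
  have "C 0 \<noteq> {}" using 0(2)[of 0] by (auto simp: irreducible_space_def)
  then obtain P where P: "P \<in> C 0" by blast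
  then obtain w where w: "w \<in> P" "w \<noteq> 0" using proj_nonzero sub by blast
  have wW: "w \<in> W" using P w sub proj_subset[OF W] by blast
  obtain x where x: "w x \<noteq> 0" using w(2) by (auto simp: fun_eq_iff)
  define ev where "ev = (\<lambda>w. if w \<in> W then w x else 0)"
  have "ev \<in> forms W 1" unfolding ev_def by (intro forms_dual evaluation_dual W)
  hence f: "(\<lambda>w. ev w ^ D) \<in> forms W D" for D using forms_power[of ev W 1 D] by simp
  have "independent_on (C 0) {[]::nat list} (\<lambda>_ w. ev w ^ D)" for D
    unfolding independent_on_def
  proof (intro allI impI)
    fix c :: "nat list \<Rightarrow> complex" assume "vanishes_on (C 0) (\<lambda>w. \<Sum>i\<in>{[]}. c i * ev w ^ D)"
    from vanishes_onD[OF this P w(1)] show "\<forall>i\<in>{[]}. c i = 0" using x wW by (simp add: ev_def)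
  qed
  thus ?case using f
    by (intro exI[of _ 0] allI impI exI[of _ "{[]}"] exI[of _ "\<lambda>_ w. ev w ^ _"]) auto
next
  case (Suc n)
  have "\<exists>E. \<forall>k D. k * E \<le> D \<longrightarrow> (\<exists>(I::nat list set) g. finite I \<and> card I = k ^ n \<and>
    (\<forall>i\<in>I. g i \<in> forms W D) \<and> independent_on (C n) I g)"
    using Suc.prems by (intro Suc.IH) auto
  then obtain E where E: "\<And>k D. k * E \<le> D \<Longrightarrow> (\<exists>(I::nat list set) g. finite I \<and> card I = k ^ n \<and>
    (\<forall>i\<in>I. g i \<in> forms W D) \<and> independent_on (C n) I g)" by blast
  have irr: "irreducible_space (subtopology (zariski W) (C (Suc n)))" using Suc.prems(2) by simp
  have sub: "C (Suc n) \<subseteq> proj W" using closedin_subset[OF Suc.prems(1)[of "Suc n"]] by (simp add: topspace_zariski)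
  have CC: "C n \<subset> C (Suc n)" using Suc.prems(3) by simp
  obtain \<F> where FF: "\<F> \<subseteq> (\<Union>d. forms W d)" "C n = zero_locus W \<F>"
    using Suc.prems(1)[of n] by (auto simp: closedin_zariski)
  obtain P where P: "P \<in> C (Suc n)" "P \<notin> zero_locus W \<F>" using CC FF by blast
  then obtain F where F: "F \<in> \<F>" "\<not> vanishes_on {P} F" using sub by (auto simp: in_zero_locus)
  obtain e where e: "F \<in> forms W e" using F FF by blast
  have F0: "vanishes_on (C n) F" using F(1) FF(2) by (auto simp: vanishes_on_def zero_locus_def)
  have F1: "\<not> vanishes_on (C (Suc n)) F" using F(2) P(1) by (auto simp: vanishes_on_def)
  show ?case
  proof (intro exI[of _ "E + e"] allI impI)
    fix k D assume D: "k * (E + e) \<le> D"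
    have "\<exists>(I::nat list set) g. finite I \<and> card I = k ^ n \<and>
      (\<forall>i\<in>I. g i \<in> forms W (D - r * e)) \<and> independent_on (C n) I g" if "r < k" for r
    proof (rule E)
      have "r * e \<le> k * e" using that by simp
      hence "k * E + r * e \<le> D" using D unfolding distrib_left by linarith
      thus "k * E \<le> D - r * e" by simp
    qed
    \<comment> \<open>A separate family is needed for each power of \<open>F\<close>, since the complementary degree depends on it.\<close>
    hence "\<forall>r\<in>{..<k}. \<exists>Ig :: nat list set \<times> _. finite (fst Ig) \<and> card (fst Ig) = k ^ n \<and>
      (\<forall>i\<in>fst Ig. snd Ig i \<in> forms W (D - r * e)) \<and> independent_on (C n) (fst Ig) (snd Ig)"
      by simp
    from bchoice[OF this] obtain Ig :: "nat \<Rightarrow> nat list set \<times> _" where Ig: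
      "\<forall>r\<in>{..<k}. finite (fst (Ig r)) \<and> card (fst (Ig r)) = k ^ n \<and>
        (\<forall>i\<in>fst (Ig r). snd (Ig r) i \<in> forms W (D - r * e)) \<and>
        independent_on (C n) (fst (Ig r)) (snd (Ig r))" ..
    define I where "I r = fst (Ig r)" for r
    define g where "g r = snd (Ig r)" for r
    have I: "finite (I r)" "card (I r) = k ^ n" "independent_on (C n) (I r) (g r)"
      and gI: "\<And>i. i \<in> I r \<Longrightarrow> g r i \<in> forms W (D - r * e)" if "r < k" for r
      using Ig that by (auto simp: I_def g_def)
    define J where "J = (\<lambda>(r, i). r # i) ` Sigma {..<k} I"
    define h where "h l = (\<lambda>w. F w ^ hd l * g (hd l) (tl l) w)" for l
    have inj: "inj_on (\<lambda>(r, i). r # i) (Sigma {..<k} I)" by (auto simp: inj_on_def)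
    have "finite J" unfolding J_def using I(1) by auto
    moreover have "card J = k ^ Suc n"
      unfolding J_def card_image[OF inj] using I(1,2) by (subst card_SigmaI) auto
    moreover have "\<forall>l\<in>J. h l \<in> forms W D"
    proof
      fix l assume "l \<in> J"
      then obtain r i where l: "l = r # i" "r < k" "i \<in> I r" by (auto simp: J_def)
      have "r * e \<le> k * e" using l by simp
      hence "r * e \<le> D" using D unfolding distrib_left by linarith
      hence "r * e + (D - r * e) = D" by simp
      thus "h l \<in> forms W D"
        using forms_mult[OF forms_power[OF e, of r] gI[OF l(2,3)]] by (simp add: h_def l(1))
    qed
    moreover have "independent_on (C (Suc n)) J h"
      unfolding independent_on_def
    proof (intro allI impI)
      fix c assume c: "vanishes_on (C (Suc n)) (\<lambda>w. \<Sum>l\<in>J. c l * h l w)"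
      define G where "G r = (\<lambda>w. \<Sum>i\<in>I r. c (r # i) * g r i w)" for r
      have "(\<Sum>l\<in>J. c l * h l w) = (\<Sum>r<k. F w ^ r * G r w)" for w
      proof -
        have "(\<Sum>l\<in>J. c l * h l w) = (\<Sum>(r, i)\<in>Sigma {..<k} I. F w ^ r * (c (r # i) * g r i w))"
          unfolding J_def sum.reindex[OF inj] by (intro sum.cong) (auto simp: h_def)
        also have "\<dots> = (\<Sum>r<k. F w ^ r * G r w)"
          using I(1) by (subst sum.Sigma[symmetric]) (auto simp: G_def sum_distrib_left)
        finally show ?thesis .
      qed
      hence van: "vanishes_on (C (Suc n)) (\<lambda>w. \<Sum>r<k. F w ^ r * G r w)" using c by simp
      have z: "c (r # i) = 0" if "r < k" "vanishes_on (C n) (G r)" "i \<in> I r" for r i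
        using I(3)[OF that(1)] that(2,3) by (auto simp: independent_on_def G_def)
      have "\<forall>r<k. G r = (\<lambda>_. 0)"
      proof (rule power_expansion_unique[OF irr W sub _ e F0 F1 _ _ _ van])
        show "C n \<subseteq> C (Suc n)" using CC by blast
        show "k * e \<le> D" using D by (simp add: algebra_simps)
        show "G r \<in> forms W (D - r * e)" if "r < k" for r
          unfolding G_def using gI[OF that] by (intro forms_sum forms_scale)
        show "G r = (\<lambda>_. 0)" if "r < k" "vanishes_on (C n) (G r)" for r
          unfolding G_def using z[OF that] by simp
      qed
      hence "c (r # i) = 0" if "r < k" "i \<in> I r" for r i
        using that z by (auto simp: vanishes_on_def)
      thus "\<forall>l\<in>J. c l = 0" by (auto simp: J_def)
    qed
    ultimately show "\<exists>(I::nat list set) g. finite I \<and> card I = k ^ Suc n \<and>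
      (\<forall>i\<in>I. g i \<in> forms W D) \<and> independent_on (C (Suc n)) I g"
      by (intro exI[of _ J] exI[of _ h] conjI)
  qed
qed

text \<open>A chain of length \<open>m + 1\<close> would yield \<open>k ^ (m + 1)\<close> independent forms of degree \<open>k * E\<close>, but there are
  at most \<open>K * (k * E + 1) ^ m \<le> K * (E + 1) ^ m * k ^ m\<close> of them.\<close>

lemma krull_dim_le:
  fixes W :: "('a \<Rightarrow> complex) set"
  assumes W: "cfun.subspace W" and Z: "closedin (zariski W) Z"
    and growth: "\<And>d. \<exists>T. finite T \<and> card T \<le> K * (d + 1) ^ m \<and>
      (\<forall>F\<in>forms W d. \<exists>h\<in>cfun.span T. \<forall>w\<in>\<Union>Z. F w = h w)"
  shows "krull_dim (subtopology (zariski W) Z) \<le> enat m"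
  unfolding krull_dim_def
proof (rule Sup_least)
  let ?X = "subtopology (zariski W) Z"
  fix x assume "x \<in> {enat n | n. \<exists>C :: nat \<Rightarrow> ('a \<Rightarrow> complex) set set.
     (\<forall>i\<le>n. closedin ?X (C i) \<and> irreducible_space (subtopology ?X (C i))) \<and>
     (\<forall>i<n. C i \<subset> C (Suc i))}"
  then obtain n C where x: "x = enat n" and C: "\<And>i. i \<le> n \<Longrightarrow> closedin ?X (C i)"
    "\<And>i. i \<le> n \<Longrightarrow> irreducible_space (subtopology ?X (C i))" "\<And>i. i < n \<Longrightarrow> C i \<subset> C (Suc i)"
    by blast
  have CZ: "closedin (zariski W) (C i)" "C i \<subseteq> Z" if "i \<le> n" for i
    using closedin_trans_full[OF C(1)[OF that] Z] closedin_subset[OF C(1)[OF that]] by auto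
  have Ci: "irreducible_space (subtopology (zariski W) (C i))" if "i \<le> n" for i
    using C(2)[OF that] CZ(2)[OF that] by (simp add: subtopology_subtopology Int_absorb1)
  have "n \<le> m"
  proof (rule ccontr)
    assume "\<not> n \<le> m"
    hence nm: "Suc m \<le> n" by simp
    have "\<exists>E. \<forall>k D. k * E \<le> D \<longrightarrow> (\<exists>(I::nat list set) g. finite I \<and> card I = k ^ Suc m \<and>
        (\<forall>i\<in>I. g i \<in> forms W D) \<and> independent_on (C (Suc m)) I g)"
      using CZ(1) Ci C(3) nm by (intro chain_independent_forms[OF W]) auto
    then obtain E where E: "\<forall>k D. k * E \<le> D \<longrightarrow> (\<exists>(I::nat list set) g. finite I \<and>
        card I = k ^ Suc m \<and> (\<forall>i\<in>I. g i \<in> forms W D) \<and> independent_on (C (Suc m)) I g)" ..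
    define k where "k = K * (E + 1) ^ m + 1"
    from E have "\<exists>(I::nat list set) g. finite I \<and> card I = k ^ Suc m \<and>
      (\<forall>i\<in>I. g i \<in> forms W (k * E)) \<and> independent_on (C (Suc m)) I g"
      by (elim allE[of _ k] allE[of _ "k * E"] impE) (rule order_refl)
    then obtain I :: "nat list set" and g where I: "finite I" "card I = k ^ Suc m"
      "\<forall>i\<in>I. g i \<in> forms W (k * E)" "independent_on (C (Suc m)) I g"
      by (elim exE conjE) (rule that)
    obtain T where T: "finite T" "card T \<le> K * (k * E + 1) ^ m"
      "\<forall>F\<in>forms W (k * E). \<exists>h\<in>cfun.span T. \<forall>w\<in>\<Union>Z. F w = h w" using growth[of "k * E"]
      by (elim exE conjE) (rule that)
    have "independent_on Z I g" using independent_on_mono[OF I(4) CZ(2)[OF nm]] by blast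
    hence "card I \<le> card T" using I T(1,3) by (intro card_independent_on[of Z I g]) auto
    hence "k * k ^ m \<le> K * (k * E + 1) ^ m" using T(2) I by simp
    also have "\<dots> \<le> K * (k * (E + 1)) ^ m"
      by (intro mult_left_mono power_mono) (auto simp: k_def)
    also have "\<dots> = K * (E + 1) ^ m * k ^ m" by (simp only: power_mult_distrib) simp
    finally have "k \<le> K * (E + 1) ^ m" by (simp add: k_def)
    thus False by (simp add: k_def)
  qed
  thus "x \<le> enat m" by (simp add: x)
qed

section \<open>Binary forms in coordinates\<close>

definition plain_form :: "nat \<Rightarrow> (nat \<Rightarrow> complex) \<Rightarrow> complex^2 \<Rightarrow> complex" where
  "plain_form r b = (\<lambda>\<xi>. \<Sum>i\<le>r. b i * (\<xi> $ 1 ^ (r - i) * \<xi> $ 2 ^ i))"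

text \<open>The binomial coefficients make \<open>\<alpha>\<^bsup>r-i\<^esup> \<beta>\<^sup>i\<close> the coordinates of \<open>(\<alpha> x + \<beta> y)\<^sup>r\<close>. With this
  normalisation shears act on coordinates by Taylor expansion and the transvectant has integral
  coefficients.\<close>

definition binary_form :: "nat \<Rightarrow> (nat \<Rightarrow> complex) \<Rightarrow> complex^2 \<Rightarrow> complex" where
  "binary_form r a = plain_form r (\<lambda>i. of_nat (r choose i) * a i)"

lemma lin_eq: "lin l \<xi> = \<xi> $ 1 * l $ 1 + \<xi> $ 2 * l $ 2"
  by (simp add: lin_def UNIV_2)

lemma plain_form_mult_lin:
  "plain_form r b \<xi> * lin m \<xi> =
    plain_form (Suc r) (\<lambda>i. (if i \<le> r then b i * m $ 1 else 0) + (if i = 0 then 0 else b (i - 1) * m $ 2)) \<xi>"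
    (is "?L = ?R")
proof -
  have "?R = (\<Sum>i\<le>Suc r. (if i \<le> r then b i * m $ 1 else 0) * (\<xi> $ 1 ^ (Suc r - i) * \<xi> $ 2 ^ i)) +
      (\<Sum>i\<le>Suc r. (if i = 0 then 0 else b (i - 1) * m $ 2) * (\<xi> $ 1 ^ (Suc r - i) * \<xi> $ 2 ^ i))"
    by (simp only: plain_form_def distrib_right sum.distrib)
  also have "(\<Sum>i\<le>Suc r. (if i \<le> r then b i * m $ 1 else 0) * (\<xi> $ 1 ^ (Suc r - i) * \<xi> $ 2 ^ i)) =
      (\<Sum>i\<le>r. b i * (\<xi> $ 1 ^ (r - i) * \<xi> $ 2 ^ i)) * (\<xi> $ 1 * m $ 1)"
    by (simp add: sum_distrib_left sum_distrib_right Suc_diff_le mult_ac)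
  also have "(\<Sum>i\<le>Suc r. (if i = 0 then 0 else b (i - 1) * m $ 2) * (\<xi> $ 1 ^ (Suc r - i) * \<xi> $ 2 ^ i)) =
      (\<Sum>i\<le>r. b i * (\<xi> $ 1 ^ (r - i) * \<xi> $ 2 ^ i)) * (\<xi> $ 2 * m $ 2)"
    by (subst sum.atMost_Suc_shift) (simp add: sum_distrib_left sum_distrib_right mult_ac)
  finally show ?thesis by (simp add: plain_form_def lin_eq algebra_simps)
qed

lemma prod_lin_plain_form: "\<exists>b. (\<lambda>\<xi>. \<Prod>i<r. lin (l i) \<xi>) = plain_form r b"
proof (induction r)
  case 0
  have "(\<lambda>\<xi>. \<Prod>i<0. lin (l i) \<xi>) = plain_form 0 (\<lambda>_. 1)" by (simp add: plain_form_def fun_eq_iff)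
  thus ?case by blast
next
  case (Suc r)
  then obtain b where "(\<lambda>\<xi>. \<Prod>i<r. lin (l i) \<xi>) = plain_form r b" by blast
  hence "(\<lambda>\<xi>. \<Prod>i<Suc r. lin (l i) \<xi>) = (\<lambda>\<xi>. plain_form r b \<xi> * lin (l r) \<xi>)"
    by (simp add: fun_eq_iff)
  thus ?case unfolding plain_form_mult_lin by blast
qed

lemma plain_form_eq_binary_form: "plain_form r b = binary_form r (\<lambda>i. b i / of_nat (r choose i))"
  by (auto simp: plain_form_def binary_form_def fun_eq_iff intro!: sum.cong)

lemma binary_form_eq:
  "binary_form r a = (\<lambda>\<xi>. \<Sum>i\<le>r. of_nat (r choose i) * a i * (\<xi> $ 1 ^ (r - i) * \<xi> $ 2 ^ i))"
  by (simp add: binary_form_def plain_form_def)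

lemma binary_form_add: "binary_form r a + binary_form r b = binary_form r (\<lambda>i. a i + b i)"
  by (simp add: binary_form_eq fun_eq_iff sum.distrib algebra_simps)

lemma binary_form_scale: "(\<lambda>\<xi>. c * binary_form r a \<xi>) = binary_form r (\<lambda>i. c * a i)"
  by (simp add: binary_form_eq fun_eq_iff sum_distrib_left algebra_simps)

lemma binary_form_zero: "binary_form r (\<lambda>_. 0) = 0"
  by (simp add: binary_form_eq fun_eq_iff)

lemma binary_form_cong: "(\<And>i. i \<le> r \<Longrightarrow> a i = b i) \<Longrightarrow> binary_form r a = binary_form r b"
  by (auto simp: binary_form_eq fun_eq_iff intro!: sum.cong)

lemma binary_form_coeff_unique:
  assumes "binary_form r a = binary_form r b" "i \<le> r" shows "a i = b i"
proof -
  have "\<forall>t. (\<Sum>i\<le>r. (of_nat (r choose i) * a i) * t ^ i) = (\<Sum>i\<le>r. (of_nat (r choose i) * b i) * t ^ i)"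
  proof
    fix t
    show "(\<Sum>i\<le>r. (of_nat (r choose i) * a i) * t ^ i) = (\<Sum>i\<le>r. (of_nat (r choose i) * b i) * t ^ i)"
      using fun_cong[OF assms(1), of "vector [1, t]"] by (simp add: binary_form_eq)
  qed
  hence "of_nat (r choose i) * a i = of_nat (r choose i) * b i"
    using assms(2) unfolding polyfun_eq_coeffs by blast
  thus ?thesis using assms(2) by simp
qed

lemma subspace_range_binary_form: "cfun.subspace (range (binary_form r))"
proof (rule cfun.subspaceI)
  show "0 \<in> range (binary_form r)" using binary_form_zero by (metis rangeI)
  show "x + y \<in> range (binary_form r)" if "x \<in> range (binary_form r)" "y \<in> range (binary_form r)" for x y
    using that binary_form_add by fastforce
  show "(\<lambda>\<xi>. c * x \<xi>) \<in> range (binary_form r)" if "x \<in> range (binary_form r)" for c x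
    using that binary_form_scale by fastforce
qed

lemma monomial_in_SymV:
  assumes "i \<le> r" shows "(\<lambda>\<xi>. \<xi> $ 1 ^ (r - i) * \<xi> $ 2 ^ i) \<in> SymV r"
proof -
  define \<phi> where "\<phi> j = lin (if j < r - i then axis 1 1 else axis 2 1)" for j
  have "(\<Prod>j<r. \<phi> j \<xi>) = \<xi> $ 1 ^ (r - i) * \<xi> $ 2 ^ i" for \<xi>
  proof -
    have "(\<Prod>j<r. \<phi> j \<xi>) = (\<Prod>j\<in>{..<r - i}. \<phi> j \<xi>) * (\<Prod>j\<in>{r - i..<r}. \<phi> j \<xi>)"
      by (subst prod.union_disjoint[symmetric]) (auto intro!: prod.cong)
    thus ?thesis using assms by (simp add: \<phi>_def lin_eq axis_def)
  qed
  hence "(\<lambda>\<xi>. \<xi> $ 1 ^ (r - i) * \<xi> $ 2 ^ i) = (\<lambda>\<xi>. \<Prod>j<r. \<phi> j \<xi>)" by simp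
  also have "\<dots> \<in> SymV r"
    unfolding SymV_def sym_pow_def by (rule cfun.span_base) (auto simp: \<phi>_def)
  finally show ?thesis .
qed

lemma subspace_SymV: "cfun.subspace (SymV r)"
  by (simp add: SymV_def sym_pow_def)

text \<open>A product of linear forms is expanded one factor at a time; conversely each monomial is a product of
  the two coordinate functions.\<close>

lemma SymV_eq: "SymV r = range (binary_form r)"
proof
  show "SymV r \<subseteq> range (binary_form r)"
    unfolding SymV_def sym_pow_def
  proof (rule cfun.span_minimal[OF _ subspace_range_binary_form], rule subsetI)
    fix f assume "f \<in> {\<lambda>x. \<Prod>i<r. \<phi> i x |\<phi>. \<forall>i<r. \<phi> i \<in> range lin}"
    then obtain \<phi> where \<phi>: "f = (\<lambda>x. \<Prod>i<r. \<phi> i x)" "\<forall>i<r. \<phi> i \<in> range lin" by blast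
    then obtain l where "\<forall>i<r. \<phi> i = lin (l i)" by (metis rangeE)
    hence "f = (\<lambda>x. \<Prod>i<r. lin (l i) x)" using \<phi>(1) by (auto intro!: prod.cong)
    thus "f \<in> range (binary_form r)" using prod_lin_plain_form[of l r] plain_form_eq_binary_form by auto
  qed
next
  have "binary_form r a \<in> SymV r" for a
  proof -
    have "binary_form r a = (\<Sum>i\<le>r. (\<lambda>\<xi>. (of_nat (r choose i) * a i) * (\<xi> $ 1 ^ (r - i) * \<xi> $ 2 ^ i)))"
      by (simp add: binary_form_eq fun_eq_iff sum_fun_apply)
    also have "\<dots> \<in> SymV r"
      by (intro cfun.subspace_sum[OF subspace_SymV] cfun.subspace_scale[OF subspace_SymV] monomial_in_SymV) auto
    finally show ?thesis .
  qed
  thus "range (binary_form r) \<subseteq> SymV r" by blast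
qed

lemma binary_form_in_SymV: "binary_form r a \<in> SymV r" by (simp add: SymV_eq)

text \<open>The coefficient function of a form of degree \<open>r\<close> is only determined up to \<open>r\<close>, so this is meaningful
  for \<open>i \<le> r\<close>. The value outside \<open>SymV r\<close> is the one that membership in \<open>dual\<close> demands.\<close>

definition coord :: "nat \<Rightarrow> nat \<Rightarrow> (complex^2 \<Rightarrow> complex) \<Rightarrow> complex" where
  "coord r i w = (if w \<in> SymV r then (SOME a. w = binary_form r a) i else 0)"

lemma coord_binary_form: "i \<le> r \<Longrightarrow> coord r i (binary_form r a) = a i"
proof -
  assume i: "i \<le> r"
  have "binary_form r a = binary_form r (SOME b. binary_form r a = binary_form r b)"
    by (rule someI[of "\<lambda>b. binary_form r a = binary_form r b" a]) simp
  from binary_form_coeff_unique[OF this i] show ?thesis by (simp add: coord_def binary_form_in_SymV)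
qed

lemma binary_form_coord: "w \<in> SymV r \<Longrightarrow> binary_form r (\<lambda>i. coord r i w) = w"
  by (auto simp: SymV_eq coord_binary_form intro!: binary_form_cong)

lemma coord_dual: "i \<le> r \<Longrightarrow> coord r i \<in> dual (SymV r)"
  unfolding dual_def SymV_eq
  by (auto simp: binary_form_add binary_form_scale coord_binary_form) (auto simp: coord_def SymV_eq)

text \<open>The coordinates form the dual basis of the basis of forms with a single nonzero coefficient. Since
  both sides vanish outside \<open>SymV r\<close>, this is an identity of functions.\<close>

lemma dual_expand:
  assumes "\<phi> \<in> dual (SymV r)"
  shows "\<phi> w = (\<Sum>i\<le>r. \<phi> (binary_form r (\<lambda>j. of_bool (j = i))) * coord r i w)"
proof (cases "w \<in> SymV r")
  case True
  have add: "\<phi> (v + w) = \<phi> v + \<phi> w" if "v \<in> SymV r" "w \<in> SymV r" for v w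
    using assms that by (auto simp: dual_def)
  have scale: "\<phi> (\<lambda>x. c * w x) = c * \<phi> w" if "w \<in> SymV r" for c w
    using assms that by (auto simp: dual_def)
  have zero: "\<phi> 0 = 0" using scale[of 0 0] cfun.subspace_0[OF subspace_SymV]
    by (simp add: zero_fun_def)
  have lincomb: "\<phi> (\<Sum>i\<in>I. (\<lambda>x. c i * binary_form r (\<lambda>j. of_bool (j = i)) x)) = (\<Sum>i\<in>I. c i * \<phi> (binary_form r (\<lambda>j. of_bool (j = i))))"
    if "finite I" for c and I :: "nat set"
    using that
  proof (induction I)
    case (insert i I)
    have "(\<Sum>i\<in>I. (\<lambda>x. c i * binary_form r (\<lambda>j. of_bool (j = i)) x)) \<in> SymV r"
      by (intro cfun.subspace_sum[OF subspace_SymV] cfun.subspace_scale[OF subspace_SymV] binary_form_in_SymV)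
    thus ?case unfolding sum.insert[OF insert(1,2)]
      by (subst add) (simp_all add: scale binary_form_in_SymV cfun.subspace_scale[OF subspace_SymV] insert(3))
  qed (simp add: zero[unfolded zero_fun_def] zero_fun_def)
  have "w = (\<Sum>i\<le>r. (\<lambda>x. coord r i w * binary_form r (\<lambda>j. of_bool (j = i)) x))"
  proof -
    have "(\<Sum>i\<le>r. (\<lambda>x. coord r i w * binary_form r (\<lambda>j. of_bool (j = i)) x)) \<xi> = binary_form r (\<lambda>i. coord r i w) \<xi>" for \<xi>
    proof -
      have "binary_form r (\<lambda>j. of_bool (j = i)) \<xi> = of_nat (r choose i) * (\<xi> $ 1 ^ (r - i) * \<xi> $ 2 ^ i)" if "i \<le> r" for i
      proof -
        have "binary_form r (\<lambda>j. of_bool (j = i)) \<xi> = (\<Sum>j\<le>r. if j = i then of_nat (r choose i) * (\<xi> $ 1 ^ (r - i) * \<xi> $ 2 ^ i) else 0)"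
          unfolding binary_form_eq by (intro sum.cong) auto
        thus ?thesis using that by simp
      qed
      thus ?thesis unfolding sum_fun_apply
        by (subst binary_form_eq) (auto intro!: sum.cong)
    qed
    hence "(\<Sum>i\<le>r. (\<lambda>x. coord r i w * binary_form r (\<lambda>j. of_bool (j = i)) x)) = binary_form r (\<lambda>i. coord r i w)"
      by (rule ext)
    thus ?thesis using binary_form_coord[OF True] by simp
  qed
  from arg_cong[OF this, of \<phi>]
  have "\<phi> w = (\<Sum>i\<le>r. coord r i w * \<phi> (binary_form r (\<lambda>j. of_bool (j = i))))"
    using lincomb[of "{..r}" "\<lambda>i. coord r i w"] by simp
  thus ?thesis by (simp only: mult.commute)
next
  case False
  thus ?thesis using assms by (simp add: dual_def coord_def)
qed

lemma dual_binary_form: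
  assumes "\<phi> \<in> dual (SymV r)"
  shows "\<phi> (binary_form r a) = (\<Sum>i\<le>r. \<phi> (binary_form r (\<lambda>j. of_bool (j = i))) * a i)"
  by (subst dual_expand[OF assms]) (simp add: coord_binary_form)

text \<open>By \<open>dual_binary_form\<close> a form is a polynomial in the coordinates of its argument.\<close>

lemma polynomial_curve_binary_form:
  assumes "\<And>i. i \<le> r \<Longrightarrow> polyfun (\<lambda>t. a t i)"
  shows "polynomial_curve (SymV r) (\<lambda>t. binary_form r (a t))"
  unfolding polynomial_curve_def
proof (intro allI ballI)
  fix d F assume "F \<in> forms (SymV r) d"
  thus "polyfun (\<lambda>t. F (binary_form r (a t)))"
    unfolding forms_span
  proof (induction rule: cfun.span_induct_alt)
    case base
    show ?case by (simp add: zero_fun_def polyfun_const)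
  next
    case (step c x y)
    then obtain \<phi> where \<phi>: "x = (\<lambda>w. \<Prod>i<d. \<phi> i w)" "\<forall>i<d. \<phi> i \<in> dual (SymV r)" by blast
    have "polyfun (\<lambda>t. \<phi> i (binary_form r (a t)))" if "i < d" for i
      by (subst dual_binary_form[OF \<phi>(2)[rule_format, OF that]])
        (intro polyfun_sum polyfun_mult polyfun_const assms, simp)
    hence "polyfun (\<lambda>t. x (binary_form r (a t)))" unfolding \<phi>(1) by (intro polyfun_prod) simp
    hence "polyfun (\<lambda>t. c * x (binary_form r (a t)) + y (binary_form r (a t)))"
      by (intro polyfun_add polyfun_mult polyfun_const step(2))
    thus ?case by simp
  qed
qed

lemma quadratic_form_coords:
  assumes "F \<in> forms (SymV r) 2"
  shows "\<exists>c. \<forall>a. F (binary_form r a) = (\<Sum>i\<le>r. \<Sum>j\<le>r. c i j * a i * a j)"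
  using assms unfolding forms_span
proof (induction rule: cfun.span_induct_alt)
  case base
  show ?case by (intro exI[of _ "\<lambda>_ _. 0"]) simp
next
  case (step k x y)
  then obtain \<phi> where \<phi>: "x = (\<lambda>w. \<Prod>i<2::nat. \<phi> i w)" "\<forall>i<2. \<phi> i \<in> dual (SymV r)" by blast
  obtain c where c: "\<forall>a. y (binary_form r a) = (\<Sum>i\<le>r. \<Sum>j\<le>r. c i j * a i * a j)" using step(2) by blast
  define e where "e m i = \<phi> m (binary_form r (\<lambda>j. of_bool (j = i)))" for m i
  have "\<phi> m (binary_form r a) = (\<Sum>i\<le>r. e m i * a i)" if "m < 2" for m a
    unfolding e_def by (rule dual_binary_form[OF \<phi>(2)[rule_format, OF that]])
  hence "x (binary_form r a) = (\<Sum>i\<le>r. \<Sum>j\<le>r. e 0 i * a i * (e 1 j * a j))" for a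
    by (simp add: \<phi>(1) numeral_2_eq_2 sum_product)
  hence "\<forall>a. ((\<lambda>w. k * x w) + y) (binary_form r a) =
      (\<Sum>i\<le>r. \<Sum>j\<le>r. (k * e 0 i * e 1 j + c i j) * a i * a j)"
    by (simp add: c sum_distrib_left sum.distrib[symmetric] algebra_simps)
  thus ?case by (rule exI[of _ "\<lambda>i j. k * e 0 i * e 1 j + c i j"])
qed

text \<open>Multisets of indices serve as exponent vectors, so that divisibility of monomials is inclusion.\<close>

definition monomial :: "nat \<Rightarrow> nat multiset \<Rightarrow> (complex^2 \<Rightarrow> complex) \<Rightarrow> complex" where
  "monomial r N w = (\<Prod>i\<in>#N. coord r i w)"

lemma forms_span_monomials:
  "forms (SymV r) d \<subseteq> cfun.span (monomial r ` {N. size N = d \<and> set_mset N \<subseteq> {..r}})"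
proof -
  let ?M = "\<lambda>d. cfun.span (monomial r ` {N. size N = d \<and> set_mset N \<subseteq> {..r}})"
  have coord: "(\<lambda>w. f w * coord r i w) \<in> ?M (Suc d)" if "f \<in> ?M d" "i \<le> r" for f i d
    using that(1)
  proof (induction rule: cfun.span_induct_alt)
    case base
    show ?case using cfun.span_zero by (simp add: zero_fun_def)
  next
    case (step c x y)
    then obtain N where N: "x = monomial r N" "size N = d" "set_mset N \<subseteq> {..r}" by auto
    have "(\<lambda>w. x w * coord r i w) = monomial r (add_mset i N)"
      by (auto simp: N(1) monomial_def)
    also have "\<dots> \<in> ?M (Suc d)" using N that(2) by (intro cfun.span_base imageI) auto
    finally have "(\<lambda>w. c * (x w * coord r i w)) + (\<lambda>w. y w * coord r i w) \<in> ?M (Suc d)"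
      using step(2) by (intro cfun.span_add cfun.span_scale)
    thus ?case by (simp add: plus_fun_def algebra_simps)
  qed
  have prod: "(\<lambda>w. \<Prod>i<d. \<phi> i w) \<in> ?M d" if "\<forall>i<d. \<phi> i \<in> dual (SymV r)" for \<phi> d
    using that
  proof (induction d)
    case 0
    have "(\<lambda>w. \<Prod>i<0. \<phi> i w) = monomial r {#}" by (simp add: monomial_def fun_eq_iff)
    also have "\<dots> \<in> ?M 0" by (intro cfun.span_base) auto
    finally show ?case .
  next
    case (Suc d)
    have "(\<lambda>w. \<Prod>i<Suc d. \<phi> i w) = (\<Sum>i\<le>r. (\<lambda>w. \<phi> d (binary_form r (\<lambda>j. of_bool (j = i))) *
        ((\<Prod>i<d. \<phi> i w) * coord r i w)))"
    proof
      fix w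
      have "\<phi> d \<in> dual (SymV r)" using Suc.prems by simp
      from dual_expand[OF this, of w]
      have "(\<Prod>i<Suc d. \<phi> i w) = (\<Prod>i<d. \<phi> i w) *
          (\<Sum>i\<le>r. \<phi> d (binary_form r (\<lambda>j. of_bool (j = i))) * coord r i w)" by (simp only: prod.lessThan_Suc)
      thus "(\<Prod>i<Suc d. \<phi> i w) = (\<Sum>i\<le>r. (\<lambda>w. \<phi> d (binary_form r (\<lambda>j. of_bool (j = i))) *
        ((\<Prod>i<d. \<phi> i w) * coord r i w))) w"
        by (simp only: sum_fun_apply sum_distrib_left mult_ac)
    qed
    also have "\<dots> \<in> ?M (Suc d)"
      using Suc by (intro cfun.span_sum cfun.span_scale coord) auto
    finally show ?case .
  qed
  show ?thesis unfolding forms_span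
    by (rule cfun.span_minimal) (use prod in auto)
qed

section \<open>Quadrics through the osculating variety\<close>

lemma sum_atMost_7: "(\<Sum>i\<le>7. f i) = f 0 + f 1 + f 2 + f 3 + f 4 + f 5 + f 6 + f (7::nat)"
  for f :: "nat \<Rightarrow> complex"
  by (simp add: numeral_eq_Suc)

lemma choose_7:
  "7 choose 2 = (21::nat)" "7 choose 3 = (35::nat)" "7 choose 4 = (35::nat)"
  "7 choose 5 = (21::nat)" "7 choose 6 = (7::nat)"
  by (simp_all add: numeral_eq_Suc)

lemma binary_form_7:
  "binary_form 7 a \<xi> = a 0 * \<xi> $ 1 ^ 7 + 7 * a 1 * \<xi> $ 1 ^ 6 * \<xi> $ 2 + 21 * a 2 * \<xi> $ 1 ^ 5 * \<xi> $ 2 ^ 2 +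
    35 * a 3 * \<xi> $ 1 ^ 4 * \<xi> $ 2 ^ 3 + 35 * a 4 * \<xi> $ 1 ^ 3 * \<xi> $ 2 ^ 4 +
    21 * a 5 * \<xi> $ 1 ^ 2 * \<xi> $ 2 ^ 5 + 7 * a 6 * \<xi> $ 1 * \<xi> $ 2 ^ 6 + a 7 * \<xi> $ 2 ^ 7"
  by (simp add: binary_form_eq sum_atMost_7 choose_7)

text \<open>The coordinates of \<open>(l x + m y)\<^sup>5 (p x\<^sup>2 + q x y + r y\<^sup>2)\<close>.\<close>

definition osc_coords :: "complex \<Rightarrow> complex \<Rightarrow> complex \<Rightarrow> complex \<Rightarrow> complex \<Rightarrow> nat \<Rightarrow> complex" where
  "osc_coords l m p q r = (\<lambda>i. [l^5 * p, (5 * l^4 * m * p + l^5 * q) / 7,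
     (10 * l^3 * m^2 * p + 5 * l^4 * m * q + l^5 * r) / 21,
     (10 * l^2 * m^3 * p + 10 * l^3 * m^2 * q + 5 * l^4 * m * r) / 35,
     (5 * l * m^4 * p + 10 * l^2 * m^3 * q + 10 * l^3 * m^2 * r) / 35,
     (m^5 * p + 5 * l * m^4 * q + 10 * l^2 * m^3 * r) / 21,
     (m^5 * q + 5 * l * m^4 * r) / 7, m^5 * r] ! i)"

lemma binary_form_osc_coords:
  "binary_form 7 (osc_coords l m p q r) \<xi> =
    (\<xi> $ 1 * l + \<xi> $ 2 * m) ^ 5 * (p * \<xi> $ 1 ^ 2 + q * \<xi> $ 1 * \<xi> $ 2 + r * \<xi> $ 2 ^ 2)"
  unfolding binary_form_7 osc_coords_def by simp algebra

text \<open>The vanishing of the sixth transvectant of a septic with itself, that is, of the projection of its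
  square to the summand \<open>S\<^sup>2 V\<close> of \<open>S\<^sup>2(S\<^sup>7 V)\<close>.\<close>

definition apolar :: "(nat \<Rightarrow> complex) \<Rightarrow> bool" where
  "apolar a \<longleftrightarrow> a 0 * a 6 - 6 * a 1 * a 5 + 15 * a 2 * a 4 - 10 * a 3 ^ 2 = 0 \<and>
     a 0 * a 7 - 5 * a 1 * a 6 + 9 * a 2 * a 5 - 5 * a 3 * a 4 = 0 \<and>
     a 1 * a 7 - 6 * a 2 * a 6 + 15 * a 3 * a 5 - 10 * a 4 ^ 2 = 0"

text \<open>If \<open>l = x\<close>, only \<open>a\<^sub>0\<close>, \<open>a\<^sub>1\<close> and \<open>a\<^sub>2\<close> can be nonzero, while every term of the three quadrics contains a
  factor \<open>a\<^sub>i\<close> with \<open>i \<ge> 3\<close>. The general case follows by covariance; written out, it is a polynomial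
  identity.\<close>

lemma apolar_osc_coords: "apolar (osc_coords l m p q r)"
  unfolding apolar_def osc_coords_def by (simp add: field_simps) (intro conjI; algebra)

text \<open>The operator \<open>x \<partial>/\<partial>x\<close> applied to \<open>(x + t y)\<^sup>7\<close> multiplies the coordinate \<open>t\<^sup>i\<close> by \<open>7 - i\<close>, so the
  points of the osculating plane at \<open>(x + t y)\<^sup>7\<close>, \<open>t \<noteq> 0\<close>, are those with \<open>a\<^sub>i = t\<^sup>i P(i)\<close> for a polynomial \<open>P\<close> of
  degree at most two. The three coefficients of the quadratic factor are read off from \<open>i = 0, 1, 7\<close>.\<close>

lemma osc_coords_polynomial:
  assumes "i \<le> 7"
  shows "osc_coords 1 t A (t * (7 * (A + B + C) - 5 * A)) (t^2 * (A + 7 * B + 49 * C)) i =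
    t ^ i * (A + B * of_nat i + C * of_nat i ^ 2)"
proof -
  have "i \<in> {0,1,2,3,4,5,6,7}" using assms by auto
  thus ?thesis
    by (elim insertE emptyE) (simp_all add: osc_coords_def field_simps eval_nat_numeral)
qed

lemma polynomial_coeffs_zero:
  assumes "\<And>t::complex. (\<Sum>k\<le>n. p k * t ^ k) = 0" "k \<le> n" shows "p k = 0"
  using polyfun_eq_0[of p n] assms by auto

text \<open>On the points with \<open>a\<^sub>i = t\<^sup>i P(i)\<close>, the coefficient of \<open>t\<^sup>w\<close> is the part \<open>e w\<close> of the quadric with
  \<open>i + j = w\<close>, so each part vanishes on the values of every quadratic polynomial \<open>P\<close>. A part has at
  most four coefficients \<open>s i j\<close>. Prescribing up to two zeros of \<open>P\<close> removes the terms that contain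
  them; this shows that all coefficients are zero except for \<open>w = 6, 7, 8\<close>, where the conditions
  leave exactly the multiples of the three coefficients of the transvectant.\<close>

lemma quadric_vanishing_on_osc_coords:
  assumes F: "\<And>a. F a = (\<Sum>i\<le>7. \<Sum>j\<le>7. c i j * a i * a j)"
    and van: "\<And>l m p q r. F (osc_coords l m p q r) = 0" and "apolar a"
  shows "F a = (0::complex)"
proof -
  define s where "s i j = (if i = j then c i j else c i j + c j i)" for i j
  define e where "e w x = (\<Sum>i\<le>7. \<Sum>j\<le>7. if i + j = w then c i j * x i * x j else 0)" for w and x :: "nat \<Rightarrow> complex"
  have F_e: "F x = (\<Sum>w\<le>14. e w x)" for x
  proof -
    have "(\<Sum>w\<le>14. e w x) = (\<Sum>i\<le>7. \<Sum>j\<le>7. \<Sum>w\<le>14. if i + j = w then c i j * x i * x j else 0)"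
      unfolding e_def by (rule trans[OF sum.swap]) (rule sum.cong[OF refl sum.swap])
    also have "\<dots> = F x"
      unfolding F by (intro sum.cong refl) auto
    finally show ?thesis ..
  qed
  have e_zero: "e w (\<lambda>i. A + B * of_nat i + C * of_nat i ^ 2) = 0" if "w \<le> 14" for w A B C
  proof (rule polynomial_coeffs_zero[OF _ that])
    fix t
    let ?P = "\<lambda>i::nat. A + B * of_nat i + C * of_nat i ^ 2"
    define y where "y = osc_coords 1 t A (t * (7 * (A + B + C) - 5 * A)) (t^2 * (A + 7 * B + 49 * C))"
    have y: "y i = t ^ i * ?P i" if "i \<le> 7" for i
      unfolding y_def using osc_coords_polynomial[OF that] .
    have "e k y = e k ?P * t ^ k" for k
      unfolding e_def sum_distrib_right
      by (intro sum.cong refl) (auto simp: y power_add)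
    hence "(\<Sum>k\<le>14. e k ?P * t ^ k) = F y" by (simp add: F_e)
    thus "(\<Sum>k\<le>14. e k ?P * t ^ k) = 0" by (simp add: y_def van)
  qed
  have e_expand:
    "e 0 x = s 0 0 * x 0 * x 0"
    "e 1 x = s 0 1 * x 0 * x 1"
    "e 2 x = s 0 2 * x 0 * x 2 + s 1 1 * x 1 * x 1"
    "e 3 x = s 0 3 * x 0 * x 3 + s 1 2 * x 1 * x 2"
    "e 4 x = s 0 4 * x 0 * x 4 + s 1 3 * x 1 * x 3 + s 2 2 * x 2 * x 2"
    "e 5 x = s 0 5 * x 0 * x 5 + s 1 4 * x 1 * x 4 + s 2 3 * x 2 * x 3"
    "e 6 x = s 0 6 * x 0 * x 6 + s 1 5 * x 1 * x 5 + s 2 4 * x 2 * x 4 + s 3 3 * x 3 * x 3"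
    "e 7 x = s 0 7 * x 0 * x 7 + s 1 6 * x 1 * x 6 + s 2 5 * x 2 * x 5 + s 3 4 * x 3 * x 4"
    "e 8 x = s 1 7 * x 1 * x 7 + s 2 6 * x 2 * x 6 + s 3 5 * x 3 * x 5 + s 4 4 * x 4 * x 4"
    "e 9 x = s 2 7 * x 2 * x 7 + s 3 6 * x 3 * x 6 + s 4 5 * x 4 * x 5"
    "e 10 x = s 3 7 * x 3 * x 7 + s 4 6 * x 4 * x 6 + s 5 5 * x 5 * x 5"
    "e 11 x = s 4 7 * x 4 * x 7 + s 5 6 * x 5 * x 6"
    "e 12 x = s 5 7 * x 5 * x 7 + s 6 6 * x 6 * x 6"
    "e 13 x = s 6 7 * x 6 * x 7"
    "e 14 x = s 7 7 * x 7 * x 7" for x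
    unfolding e_def s_def sum_atMost_7 by (simp_all add: algebra_simps)
  \<comment> \<open>The polynomial \<open>P\<close> is given by its coefficients; for example \<open>(2, -3, 1)\<close> has the zeros 1 and 2.\<close>
  have r00: "s 0 0 = 0"
    using e_zero[of 0 "1" "0" "0"] unfolding e_expand by (simp del: One_nat_def)
  have r01: "s 0 1 = 0"
    using e_zero[of 1 "1" "0" "0"] unfolding e_expand by (simp del: One_nat_def)
  have r02: "s 0 2 = 0"
    using e_zero[of 2 "-1" "1" "0"] unfolding e_expand by (simp del: One_nat_def)
  have r11: "s 1 1 = 0"
    using e_zero[of 2 "1" "0" "0"] unfolding e_expand by (simp add: r02 del: One_nat_def)
  have r03: "s 0 3 = 0"
    using e_zero[of 3 "-1" "1" "0"] unfolding e_expand by (simp del: One_nat_def)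
  have r12: "s 1 2 = 0"
    using e_zero[of 3 "1" "0" "0"] unfolding e_expand by (simp add: r03 del: One_nat_def)
  have r04: "s 0 4 = 0"
    using e_zero[of 4 "2" "-3" "1"] unfolding e_expand by (simp del: One_nat_def)
  have r13: "s 1 3 = 0"
    using e_zero[of 4 "-2" "1" "0"] unfolding e_expand by (simp add: r04 del: One_nat_def)
  have r22: "s 2 2 = 0"
    using e_zero[of 4 "1" "0" "0"] unfolding e_expand by (simp add: r04 r13 del: One_nat_def)
  have r05: "s 0 5 = 0"
    using e_zero[of 5 "2" "-3" "1"] unfolding e_expand by (simp del: One_nat_def)
  have r14: "s 1 4 = 0"
    using e_zero[of 5 "-2" "1" "0"] unfolding e_expand by (simp add: r05 del: One_nat_def)
  have r23: "s 2 3 = 0"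
    using e_zero[of 5 "1" "0" "0"] unfolding e_expand by (simp add: r05 r14 del: One_nat_def)
  have r06: "10 * s 0 6 + 1 * s 3 3 = 0"
    using e_zero[of 6 "2" "-3" "1"] unfolding e_expand by (simp del: One_nat_def; algebra)
  have r15: "5 * s 1 5 - 3 * s 3 3 = 0"
    using e_zero[of 6 "0" "-2" "1"] unfolding e_expand by (simp del: One_nat_def; algebra)
  have r24: "2 * s 2 4 + 3 * s 3 3 = 0"
    using e_zero[of 6 "0" "-1" "1"] unfolding e_expand by (simp del: One_nat_def; algebra)
  have r07: "5 * s 0 7 + 1 * s 3 4 = 0"
    using e_zero[of 7 "2" "-3" "1"] unfolding e_expand by (simp del: One_nat_def; algebra)
  have r16: "1 * s 1 6 - 1 * s 3 4 = 0"
    using e_zero[of 7 "0" "-2" "1"] unfolding e_expand by (simp del: One_nat_def; algebra)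
  have r25: "5 * s 2 5 + 9 * s 3 4 = 0"
    using e_zero[of 7 "0" "-1" "1"] unfolding e_expand by (simp del: One_nat_def; algebra)
  have r17: "10 * s 1 7 + 1 * s 4 4 = 0"
    using e_zero[of 8 "30" "-11" "1"] unfolding e_expand by (simp del: One_nat_def; algebra)
  have r26: "5 * s 2 6 - 3 * s 4 4 = 0"
    using e_zero[of 8 "35" "-12" "1"] unfolding e_expand by (simp del: One_nat_def; algebra)
  have r35: "2 * s 3 5 + 3 * s 4 4 = 0"
    using e_zero[of 8 "42" "-13" "1"] unfolding e_expand by (simp del: One_nat_def; algebra)
  have r27: "s 2 7 = 0"
    using e_zero[of 9 "30" "-11" "1"] unfolding e_expand by (simp del: One_nat_def)
  have r36: "s 3 6 = 0"
    using e_zero[of 9 "-5" "1" "0"] unfolding e_expand by (simp add: r27 del: One_nat_def)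
  have r45: "s 4 5 = 0"
    using e_zero[of 9 "1" "0" "0"] unfolding e_expand by (simp add: r27 r36 del: One_nat_def)
  have r37: "s 3 7 = 0"
    using e_zero[of 10 "30" "-11" "1"] unfolding e_expand by (simp del: One_nat_def)
  have r46: "s 4 6 = 0"
    using e_zero[of 10 "-5" "1" "0"] unfolding e_expand by (simp add: r37 del: One_nat_def)
  have r55: "s 5 5 = 0"
    using e_zero[of 10 "1" "0" "0"] unfolding e_expand by (simp add: r37 r46 del: One_nat_def)
  have r47: "s 4 7 = 0"
    using e_zero[of 11 "-6" "1" "0"] unfolding e_expand by (simp del: One_nat_def)
  have r56: "s 5 6 = 0"
    using e_zero[of 11 "1" "0" "0"] unfolding e_expand by (simp add: r47 del: One_nat_def)
  have r57: "s 5 7 = 0"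
    using e_zero[of 12 "-6" "1" "0"] unfolding e_expand by (simp del: One_nat_def)
  have r66: "s 6 6 = 0"
    using e_zero[of 12 "1" "0" "0"] unfolding e_expand by (simp add: r57 del: One_nat_def)
  have r67: "s 6 7 = 0"
    using e_zero[of 13 "1" "0" "0"] unfolding e_expand by (simp del: One_nat_def)
  have r77: "s 7 7 = 0"
    using e_zero[of 14 "1" "0" "0"] unfolding e_expand by (simp del: One_nat_def)
  have sum_14: "(\<Sum>w\<le>14. f w) = f 0 + f 1 + f 2 + f 3 + f 4 + f 5 + f 6 + f 7 + f 8 + f 9 + f 10 +
      f 11 + f 12 + f 13 + f (14::nat)" for f :: "nat \<Rightarrow> complex"
    by (simp add: numeral_eq_Suc)
  have "F a = e 6 a + e 7 a + e 8 a"
    unfolding F_e sum_14 e_expand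
    by (simp add: r00 r01 r02 r11 r03 r12 r04 r13 r22 r05 r14 r23
      r27 r36 r45 r37 r46 r55 r47 r56 r57 r66 r67 r77 del: One_nat_def)
  moreover have "10 * e 6 a = - s 3 3 * (a 0 * a 6 - 6 * a 1 * a 5 + 15 * a 2 * a 4 - 10 * a 3 ^ 2)"
    unfolding e_expand using r06 r15 r24 by algebra
  moreover have "5 * e 7 a = - s 3 4 * (a 0 * a 7 - 5 * a 1 * a 6 + 9 * a 2 * a 5 - 5 * a 3 * a 4)"
    unfolding e_expand using r07 r16 r25 by algebra
  moreover have "10 * e 8 a = - s 4 4 * (a 1 * a 7 - 6 * a 2 * a 6 + 15 * a 3 * a 5 - 10 * a 4 ^ 2)"
    unfolding e_expand using r17 r26 r35 by algebra
  ultimately show ?thesis using \<open>apolar a\<close> by (simp add: apolar_def)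
qed

section \<open>The osculating spaces\<close>

lemma lin_act: "lin m (\<xi> v* g) = lin (g *v m) \<xi>"
  by (simp add: lin_def vector_matrix_mult_def matrix_vector_mult_def UNIV_2 algebra_simps)

lemma lie_act_power:
  "lie_act X (\<lambda>\<xi>. lin u \<xi> ^ m) = (\<lambda>\<xi>. of_nat m * lin u \<xi> ^ (m - 1) * lin (X *v u) \<xi>)"
proof
  fix \<xi>
  have eq: "lin m (\<xi> + t *s (\<xi> v* X)) = lin m \<xi> + t * lin (X *v m) \<xi>" for m t
    by (simp add: lin_def vector_matrix_mult_def matrix_vector_mult_def UNIV_2 algebra_simps)
  have "((\<lambda>t. (lin u \<xi> + t * lin (X *v u) \<xi>) ^ m) has_field_derivative
      of_nat m * lin u \<xi> ^ (m - 1) * lin (X *v u) \<xi>) (at 0)"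
    by (auto intro!: derivative_eq_intros)
  thus "lie_act X (\<lambda>\<xi>. lin u \<xi> ^ m) \<xi> = of_nat m * lin u \<xi> ^ (m - 1) * lin (X *v u) \<xi>"
    by (simp add: lie_act_def eq DERIV_imp_deriv)
qed

lemma lie_act_power_times_lin:
  "lie_act X (\<lambda>\<xi>. c * lin u \<xi> ^ m * lin v \<xi>) =
    (\<lambda>\<xi>. c * (of_nat m * lin u \<xi> ^ (m - 1) * lin (X *v u) \<xi> * lin v \<xi> + lin u \<xi> ^ m * lin (X *v v) \<xi>))"
proof
  fix \<xi>
  have eq: "lin m (\<xi> + t *s (\<xi> v* X)) = lin m \<xi> + t * lin (X *v m) \<xi>" for m t
    by (simp add: lin_def vector_matrix_mult_def matrix_vector_mult_def UNIV_2 algebra_simps)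
  have "((\<lambda>t. c * (lin u \<xi> + t * lin (X *v u) \<xi>) ^ m * (lin v \<xi> + t * lin (X *v v) \<xi>)) has_field_derivative
      c * (of_nat m * lin u \<xi> ^ (m - 1) * lin (X *v u) \<xi> * lin v \<xi> + lin u \<xi> ^ m * lin (X *v v) \<xi>)) (at 0)"
    by (auto intro!: derivative_eq_intros simp: algebra_simps)
  thus "lie_act X (\<lambda>\<xi>. c * lin u \<xi> ^ m * lin v \<xi>) \<xi> =
    c * (of_nat m * lin u \<xi> ^ (m - 1) * lin (X *v u) \<xi> * lin v \<xi> + lin u \<xi> ^ m * lin (X *v v) \<xi>)"
    by (simp add: lie_act_def eq DERIV_imp_deriv)
qed

lemma sl2_transitive:
  fixes u v :: "complex^2"
  assumes "u \<noteq> 0" obtains X where "X \<in> sl2" "X *v u = v"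
proof (cases "u $ 1 = 0")
  case False
  define a where "a = v $ 1 / u $ 1"
  let ?X = "vector [vector [a, 0], vector [(v $ 2 + a * u $ 2) / u $ 1, - a]] :: complex^2^2"
  have "?X \<in> sl2" by (simp add: sl2_def trace_def UNIV_2)
  moreover have "?X *v u = v" using False
    by (simp add: vec_eq_iff forall_2 matrix_vector_mult_def UNIV_2 a_def)
  ultimately show ?thesis by (rule that)
next
  case True
  hence u2: "u $ 2 \<noteq> 0" using assms by (auto simp: vec_eq_iff forall_2)
  let ?X = "vector [vector [- (v $ 2 / u $ 2), v $ 1 / u $ 2], vector [0, v $ 2 / u $ 2]] :: complex^2^2"
  have "?X \<in> sl2" by (simp add: sl2_def trace_def UNIV_2)
  moreover have "?X *v u = v" using True u2
    by (simp add: vec_eq_iff forall_2 matrix_vector_mult_def UNIV_2)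
  ultimately show ?thesis by (rule that)
qed

text \<open>The right inverse \<open>h\<close> of \<open>g\<close> transports forms back to \<open>u\<close>. Both matrices are obtained by passing through
  the first basis vector.\<close>

lemma SL2_transitive:
  fixes u v :: "complex^2"
  assumes "u \<noteq> 0" "v \<noteq> 0" obtains g h where "g \<in> SL2" "g *v u = v" "g ** h = mat 1"
proof -
  have frame: "\<exists>g h. g \<in> SL2 \<and> h \<in> SL2 \<and> g *v axis 1 1 = w \<and> h *v w = axis 1 1 \<and> g ** h = mat 1 \<and> h ** g = mat 1"
    if w: "w \<noteq> 0" for w :: "complex^2"
  proof -
    obtain b d where bd: "w $ 1 * d - b * w $ 2 = 1"
    proof (cases "w $ 1 = 0")
      case True
      hence "w $ 2 \<noteq> 0" using w by (auto simp: vec_eq_iff forall_2)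
      thus ?thesis using True by (intro that[of 0 "- 1 / w $ 2"]) simp
    next
      case False
      thus ?thesis by (intro that[of "1 / w $ 1" 0]) auto
    qed
    let ?g = "vector [vector [w $ 1, b], vector [w $ 2, d]] :: complex^2^2"
    let ?h = "vector [vector [d, - b], vector [- (w $ 2), w $ 1]] :: complex^2^2"
    have "?g \<in> SL2" "?h \<in> SL2" using bd by (simp_all add: SL2_def det_2 algebra_simps)
    moreover have "?g *v axis 1 1 = w" "?h *v w = axis 1 1" using bd
      by (simp_all add: vec_eq_iff forall_2 matrix_vector_mult_def UNIV_2 axis_def algebra_simps)
    moreover have "?g ** ?h = mat 1" "?h ** ?g = mat 1" using bd
      by (simp_all add: vec_eq_iff forall_2 matrix_matrix_mult_def UNIV_2 mat_def algebra_simps)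
    ultimately show ?thesis by blast
  qed
  obtain gu hu where u: "gu \<in> SL2" "hu \<in> SL2" "gu *v axis 1 1 = u" "hu *v u = axis 1 1" "gu ** hu = mat 1" "hu ** gu = mat 1"
    using frame[OF assms(1)] by blast
  obtain gv hv where v: "gv \<in> SL2" "hv \<in> SL2" "gv *v axis 1 1 = v" "hv *v v = axis 1 1" "gv ** hv = mat 1" "hv ** gv = mat 1"
    using frame[OF assms(2)] by blast
  show ?thesis
  proof (rule that)
    show "gv ** hu \<in> SL2" using u v by (simp add: SL2_def det_mul)
    show "(gv ** hu) *v u = v" using u v by (simp flip: matrix_vector_mul_assoc)
    show "(gv ** hu) ** (gu ** hv) = mat 1"
      using u v by (metis matrix_mul_assoc matrix_mul_rid)
  qed
qed

lemma SymV_2_prod: "(\<lambda>\<xi>. lin v \<xi> * lin w \<xi>) \<in> SymV 2"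
proof -
  have "(\<lambda>\<xi>. lin v \<xi> * lin w \<xi>) = (\<lambda>\<xi>. \<Prod>i<2::nat. (if i = 0 then lin v else lin w) \<xi>)"
    by (simp add: numeral_2_eq_2)
  also have "\<dots> \<in> SymV 2"
    unfolding SymV_def sym_pow_def by (rule cfun.span_base) auto
  finally show ?thesis .
qed

lemma SymV_2_span: "SymV 2 = cfun.span {\<lambda>\<xi>. lin v \<xi> * lin w \<xi> | v w. True}"
proof
  show "SymV 2 \<subseteq> cfun.span {\<lambda>\<xi>. lin v \<xi> * lin w \<xi> | v w. True}"
    unfolding SymV_def sym_pow_def
  proof (rule cfun.span_mono, rule subsetI)
    fix f assume "f \<in> {\<lambda>x. \<Prod>i<2. \<phi> i x |\<phi>. \<forall>i<2::nat. \<phi> i \<in> range lin}"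
    then obtain \<phi> where \<phi>: "f = (\<lambda>x. \<Prod>i<2::nat. \<phi> i x)" "\<forall>i<2::nat. \<phi> i \<in> range lin" by blast
    obtain v w where "\<phi> 0 = lin v" "\<phi> 1 = lin w" 
      using \<phi>(2) by (metis imageE one_less_numeral_iff semiring_norm(76) zero_less_numeral)
    hence "f = (\<lambda>x. lin v x * lin w x)" by (simp add: \<phi>(1) numeral_2_eq_2)
    thus "f \<in> {\<lambda>\<xi>. lin v \<xi> * lin w \<xi> | v w. True}" by blast
  qed
  show "cfun.span {\<lambda>\<xi>. lin v \<xi> * lin w \<xi> | v w. True} \<subseteq> SymV 2"
    by (rule cfun.span_minimal[OF _ subspace_SymV]) (use SymV_2_prod in auto)
qed

lemma subspace_lin_power_times: "cfun.subspace {\<lambda>\<xi>. lin u \<xi> ^ n * Q \<xi> | Q. Q \<in> SymV 2}"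
proof (rule cfun.subspaceI)
  show "0 \<in> {\<lambda>\<xi>. lin u \<xi> ^ n * Q \<xi> | Q. Q \<in> SymV 2}"
    using cfun.subspace_0[OF subspace_SymV] by (auto intro!: exI[of _ 0] simp: fun_eq_iff)
next
  fix x y assume "x \<in> {\<lambda>\<xi>. lin u \<xi> ^ n * Q \<xi> | Q. Q \<in> SymV 2}" "y \<in> {\<lambda>\<xi>. lin u \<xi> ^ n * Q \<xi> | Q. Q \<in> SymV 2}"
  then obtain P Q where "x = (\<lambda>\<xi>. lin u \<xi> ^ n * P \<xi>)" "y = (\<lambda>\<xi>. lin u \<xi> ^ n * Q \<xi>)" "P \<in> SymV 2" "Q \<in> SymV 2" by blast
  thus "x + y \<in> {\<lambda>\<xi>. lin u \<xi> ^ n * Q \<xi> | Q. Q \<in> SymV 2}"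
    using cfun.subspace_add[OF subspace_SymV, of P 2 Q]
    by (auto intro!: exI[of _ "P + Q"] simp: fun_eq_iff algebra_simps)
next
  fix c x assume "x \<in> {\<lambda>\<xi>. lin u \<xi> ^ n * Q \<xi> | Q. Q \<in> SymV 2}"
  then obtain Q where "x = (\<lambda>\<xi>. lin u \<xi> ^ n * Q \<xi>)" "Q \<in> SymV 2" by blast
  thus "(\<lambda>\<xi>. c * x \<xi>) \<in> {\<lambda>\<xi>. lin u \<xi> ^ n * Q \<xi> | Q. Q \<in> SymV 2}"
    using cfun.subspace_scale[OF subspace_SymV, of Q 2 c]
    by (auto intro!: exI[of _ "\<lambda>\<xi>. c * Q \<xi>"] simp: fun_eq_iff algebra_simps)
qed

text \<open>The second-order products are \<open>X Y u\<^sup>r = r (r - 1) u\<^bsup>r-2\<^esup> (X u) (Y u) + r u\<^bsup>r-1\<^esup> (X Y u)\<close>, and by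
  \<open>sl2_transitive\<close> the vectors \<open>X u\<close> and \<open>Y u\<close> are arbitrary. The second summand is a first-order product,
  so it can be subtracted.\<close>

lemma osc_2:
  assumes "u \<noteq> 0"
  shows "osc 2 (n + 2) u = {\<lambda>\<xi>. lin u \<xi> ^ n * Q \<xi> | Q. Q \<in> SymV 2}" (is "_ = ?R")
proof
  have X: "foldr lie_act [X] (\<lambda>\<xi>. lin u \<xi> ^ (n + 2)) = (\<lambda>\<xi>. of_nat (n + 2) * lin u \<xi> ^ (n + 1) * lin (X *v u) \<xi>)" for X
    by (simp only: foldr.simps comp_def id_apply lie_act_power) (simp add: fun_eq_iff)
  have XY: "foldr lie_act [X, Y] (\<lambda>\<xi>. lin u \<xi> ^ (n + 2)) =
     (\<lambda>\<xi>. lin u \<xi> ^ n * (of_nat (n + 2) * of_nat (n + 1) * (lin (X *v u) \<xi> * lin (Y *v u) \<xi>) +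
       of_nat (n + 2) * (lin u \<xi> * lin (X *v (Y *v u)) \<xi>)))" for X Y
    by (simp only: foldr.simps comp_def id_apply lie_act_power lie_act_power_times_lin)
      (simp add: fun_eq_iff algebra_simps)
  note sub = subspace_lin_power_times[of u n]
  have in_R: "(\<lambda>\<xi>. lin u \<xi> ^ n * (lin v \<xi> * lin w \<xi>)) \<in> ?R" for v w
    by (rule CollectI, rule exI[of _ "\<lambda>\<xi>. lin v \<xi> * lin w \<xi>"]) (simp add: SymV_2_prod)
  show "osc 2 (n + 2) u \<subseteq> ?R"
    unfolding osc_def
  proof (rule cfun.span_minimal[OF _ sub], rule subsetI)
    fix f assume "f \<in> {foldr lie_act Xs (\<lambda>\<xi>. lin u \<xi> ^ (n + 2)) |Xs. set Xs \<subseteq> sl2 \<and> length Xs \<le> 2}"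
    then obtain Xs where f: "f = foldr lie_act Xs (\<lambda>\<xi>. lin u \<xi> ^ (n + 2))" and len: "length Xs \<le> 2" by blast
    consider "Xs = []" | X where "Xs = [X]" | X Y where "Xs = [X, Y]"
      using len by (cases Xs; cases "tl Xs"; cases "tl (tl Xs)") auto
    thus "f \<in> ?R"
    proof cases
      case 1
      have "f = (\<lambda>\<xi>. lin u \<xi> ^ n * (lin u \<xi> * lin u \<xi>))" by (simp add: f 1 fun_eq_iff algebra_simps)
      thus ?thesis using in_R by simp
    next
      case (2 X)
      have "f = (\<lambda>\<xi>. of_nat (n + 2) * (lin u \<xi> ^ n * (lin u \<xi> * lin (X *v u) \<xi>)))"
        unfolding f 2 X by (simp add: fun_eq_iff algebra_simps)
      thus ?thesis using cfun.subspace_scale[OF sub in_R] by simp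
    next
      case (3 X Y)
      have "f = (\<lambda>\<xi>. (of_nat (n + 2) * of_nat (n + 1)) * (lin u \<xi> ^ n * (lin (X *v u) \<xi> * lin (Y *v u) \<xi>))) +
        (\<lambda>\<xi>. of_nat (n + 2) * (lin u \<xi> ^ n * (lin u \<xi> * lin (X *v (Y *v u)) \<xi>)))"
        unfolding f 3 XY by (simp add: fun_eq_iff algebra_simps)
      also have "\<dots> \<in> ?R"
        by (intro cfun.subspace_add[OF sub] cfun.subspace_scale[OF sub] in_R)
      finally show ?thesis .
    qed
  qed
  have gen: "foldr lie_act Xs (\<lambda>\<xi>. lin u \<xi> ^ (n + 2)) \<in> osc 2 (n + 2) u" if "set Xs \<subseteq> sl2" "length Xs \<le> 2" for Xs
    unfolding osc_def by (rule cfun.span_base) (use that in blast)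
  have osub: "cfun.subspace (osc 2 (n + 2) u)" by (simp add: osc_def)
  have lin1: "(\<lambda>\<xi>. lin u \<xi> ^ n * (lin u \<xi> * lin v \<xi>)) \<in> osc 2 (n + 2) u" for v
  proof -
    obtain X where "X \<in> sl2" "X *v u = v" using sl2_transitive[OF assms] by metis
    hence "(\<lambda>\<xi>. of_nat (n + 2) * lin u \<xi> ^ (n + 1) * lin v \<xi>) \<in> osc 2 (n + 2) u"
      using gen[of "[X]"] X by simp
    from cfun.subspace_scale[OF osub this, of "1 / of_nat (n + 2)"]
    have "(\<lambda>\<xi>. 1 / of_nat (n + 2) * (of_nat (n + 2) * lin u \<xi> ^ (n + 1) * lin v \<xi>)) \<in> osc 2 (n + 2) u" .
    moreover have "1 / k * (k * p ^ (n + 1) * q) = p ^ n * (p * q)" if "k \<noteq> 0" for k p q :: complex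
      using that by simp
    moreover have "of_nat (n + 2) \<noteq> (0::complex)" by (simp only: of_nat_eq_0_iff; simp)
    ultimately show ?thesis by (simp only: not_False_eq_True)
  qed
  have lin2: "(\<lambda>\<xi>. lin u \<xi> ^ n * (lin v \<xi> * lin w \<xi>)) \<in> osc 2 (n + 2) u" for v w
  proof -
    obtain X where X: "X \<in> sl2" "X *v u = v" using sl2_transitive[OF assms] by metis
    obtain Y where Y: "Y \<in> sl2" "Y *v u = w" using sl2_transitive[OF assms] by metis
    let ?f = "foldr lie_act [X, Y] (\<lambda>\<xi>. lin u \<xi> ^ (n + 2))"
    have "?f \<in> osc 2 (n + 2) u" using X Y by (intro gen) auto
    hence *: "(\<lambda>\<xi>. 1 / (of_nat (n + 2) * of_nat (n + 1)) * (?f \<xi> - of_nat (n + 2) * (lin u \<xi> ^ n * (lin u \<xi> * lin (X *v w) \<xi>))))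
      \<in> osc 2 (n + 2) u"
      using cfun.subspace_diff[OF osub _ cfun.subspace_scale[OF osub lin1], of ?f "of_nat (n + 2)" "X *v w"]
      by (intro cfun.subspace_scale[OF osub]) (simp only: fun_diff_def)
    have "of_nat (n + 2) * of_nat (n + 1) \<noteq> (0::complex)" by (simp only: mult_eq_0_iff of_nat_eq_0_iff; simp)
    moreover have "1 / k * (p * (k * vw + m * x) - m * (p * x)) = p * vw" if "k \<noteq> 0" for k p vw m x :: complex
      using that by (simp add: field_simps)
    ultimately have "(\<lambda>\<xi>. 1 / (of_nat (n + 2) * of_nat (n + 1)) * (?f \<xi> - of_nat (n + 2) * (lin u \<xi> ^ n * (lin u \<xi> * lin (X *v w) \<xi>)))) =
        (\<lambda>\<xi>. lin u \<xi> ^ n * (lin v \<xi> * lin w \<xi>))"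
      unfolding XY X(2) Y(2) by blast
    thus ?thesis using * by simp
  qed
  show "?R \<subseteq> osc 2 (n + 2) u"
  proof
    fix f assume "f \<in> ?R"
    then obtain Q where f: "f = (\<lambda>\<xi>. lin u \<xi> ^ n * Q \<xi>)" and "Q \<in> SymV 2" by blast
    from this(2) have "(\<lambda>\<xi>. lin u \<xi> ^ n * Q \<xi>) \<in> osc 2 (n + 2) u"
      unfolding SymV_2_span
    proof (induction rule: cfun.span_induct_alt)
      case base
      show ?case using cfun.subspace_0[OF osub] by (simp add: zero_fun_def)
    next
      case (step c x y)
      then obtain v w where x: "x = (\<lambda>\<xi>. lin v \<xi> * lin w \<xi>)" by blast
      have "(\<lambda>\<xi>. c * (lin u \<xi> ^ n * (lin v \<xi> * lin w \<xi>))) + (\<lambda>\<xi>. lin u \<xi> ^ n * y \<xi>) \<in> osc 2 (n + 2) u"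
        by (intro cfun.subspace_add[OF osub] cfun.subspace_scale[OF osub] lin2 step(2))
      thus ?case by (simp add: plus_fun_def x algebra_simps)
    qed
    thus "f \<in> osc 2 (n + 2) u" by (simp add: f)
  qed
qed

definition osc_cone :: "(complex^2 \<Rightarrow> complex) set" where
  "osc_cone = {binary_form 7 (osc_coords l m p q r) | l m p q r. True}"

lemma binary_form_2: "binary_form 2 a \<xi> = a 0 * \<xi> $ 1 ^ 2 + 2 * a 1 * \<xi> $ 1 * \<xi> $ 2 + a 2 * \<xi> $ 2 ^ 2"
  by (simp add: binary_form_eq numeral_2_eq_2)

lemma osc_cone_eq: "osc_cone = {\<lambda>\<xi>. lin l \<xi> ^ 5 * Q \<xi> | l Q. Q \<in> SymV 2}"
proof (intro equalityI subsetI)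
  fix w assume "w \<in> osc_cone"
  then obtain l m p q r where w: "w = binary_form 7 (osc_coords l m p q r)" by (auto simp: osc_cone_def)
  have "w = (\<lambda>\<xi>. lin (vector [l, m]) \<xi> ^ 5 * binary_form 2 (\<lambda>i. [p, q / 2, r] ! i) \<xi>)"
    by (simp add: w fun_eq_iff binary_form_osc_coords lin_eq binary_form_2)
  thus "w \<in> {\<lambda>\<xi>. lin l \<xi> ^ 5 * Q \<xi> | l Q. Q \<in> SymV 2}"
    using binary_form_in_SymV[of 2 "\<lambda>i. [p, q / 2, r] ! i"] by (intro CollectI exI conjI)
next
  fix w assume "w \<in> {\<lambda>\<xi>. lin l \<xi> ^ 5 * Q \<xi> | l Q. Q \<in> SymV 2}"
  then obtain l a where w: "w = (\<lambda>\<xi>. lin l \<xi> ^ 5 * binary_form 2 a \<xi>)" by (auto simp: SymV_eq)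
  have "w = binary_form 7 (osc_coords (l $ 1) (l $ 2) (a 0) (2 * a 1) (a 2))"
    by (simp add: w fun_eq_iff binary_form_osc_coords lin_eq binary_form_2)
  thus "w \<in> osc_cone" unfolding osc_cone_def by blast
qed

lemma act_act: "act g (act h f) = act (g ** h) f"
  by (simp add: act_def vector_matrix_mul_assoc)

lemma act_one: "act (mat 1) f = f"
  by (simp add: act_def)

lemma act_zero: "act g 0 = 0"
  by (simp add: act_def fun_eq_iff)

lemma act_span: "act g ` cfun.span {w} = cfun.span {act g w}"
  by (auto simp: cfun.span_singleton act_def)

lemma act_SymV_2:
  assumes "Q \<in> SymV 2" shows "act g Q \<in> SymV 2"
  using assms unfolding SymV_2_span
proof (induction rule: cfun.span_induct_alt)
  case base
  show ?case unfolding act_zero by (rule cfun.span_zero)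
next
  case (step c x y)
  then obtain v w where x: "x = (\<lambda>\<xi>. lin v \<xi> * lin w \<xi>)" by blast
  have "act g x = (\<lambda>\<xi>. lin (g *v v) \<xi> * lin (g *v w) \<xi>)" by (simp add: x act_def lin_act)
  hence "act g x \<in> {\<lambda>\<xi>. lin v \<xi> * lin w \<xi> | v w. True}" by blast
  hence "(\<lambda>\<xi>. c * act g x \<xi>) + act g y \<in> cfun.span {\<lambda>\<xi>. lin v \<xi> * lin w \<xi> | v w. True}"
    by (intro cfun.span_add cfun.span_scale step(2)) (rule cfun.span_base)
  thus ?case by (simp add: act_def plus_fun_def)
qed

lemma SL2_left_inverse:
  assumes "g \<in> SL2" obtains h where "h ** g = mat 1"
proof (rule that)
  show "vector [vector [g $ 2 $ 2, - (g $ 1 $ 2)], vector [- (g $ 2 $ 1), g $ 1 $ 1]] ** g = mat 1"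
    using assms
    by (simp add: SL2_def det_2 vec_eq_iff forall_2 matrix_matrix_mult_def UNIV_2 mat_def algebra_simps)
qed

text \<open>Since \<open>SL(V)\<close> is transitive on nonzero vectors, the translates of \<open>\<langle>u\<^sup>5 Q\<rangle>\<close> are all lines \<open>\<langle>l\<^sup>5 Q\<rangle>\<close>,
  whatever the highest weight vector \<open>u\<close>.\<close>

lemma osculating_orbit:
  assumes "u \<noteq> 0"
  shows "{act g ` P | g P. g \<in> SL2 \<and> P \<in> proj (osc 2 7 u)} =
    {cfun.span {w} | w. w \<in> osc_cone \<and> w \<noteq> 0}"
proof (intro equalityI subsetI)
  have osc: "osc 2 7 u = {\<lambda>\<xi>. lin u \<xi> ^ 5 * Q \<xi> | Q. Q \<in> SymV 2}"
    using osc_2[OF assms, of 5] by simp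
  {
    fix R assume "R \<in> {act g ` P | g P. g \<in> SL2 \<and> P \<in> proj (osc 2 7 u)}"
    then obtain g w where g: "g \<in> SL2" and w: "w \<in> osc 2 7 u" "w \<noteq> 0" and R: "R = act g ` cfun.span {w}"
      by (auto simp: proj_def)
    obtain Q where Q: "w = (\<lambda>\<xi>. lin u \<xi> ^ 5 * Q \<xi>)" "Q \<in> SymV 2" using w(1) osc by blast
    have "act g w = (\<lambda>\<xi>. lin (g *v u) \<xi> ^ 5 * act g Q \<xi>)" by (simp add: Q(1) act_def lin_act)
    hence "act g w \<in> osc_cone" unfolding osc_cone_eq using act_SymV_2[OF Q(2), of g] by blast
    moreover obtain h where "h ** g = mat 1" using SL2_left_inverse[OF g] .
    hence "act g w \<noteq> 0" using w(2) act_act[of h g w] by (auto simp: act_zero act_one)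
    ultimately show "R \<in> {cfun.span {w} | w. w \<in> osc_cone \<and> w \<noteq> 0}"
      unfolding R act_span by blast
  next
    fix R assume "R \<in> {cfun.span {w} | w. w \<in> osc_cone \<and> w \<noteq> 0}"
    then obtain w where w: "w \<in> osc_cone" "w \<noteq> 0" and R: "R = cfun.span {w}" by blast
    obtain l Q where Q: "w = (\<lambda>\<xi>. lin l \<xi> ^ 5 * Q \<xi>)" "Q \<in> SymV 2" using w(1) unfolding osc_cone_eq by blast
    have "l \<noteq> 0" using w(2) by (auto simp: Q(1) lin_eq fun_eq_iff)
    then obtain g h where g: "g \<in> SL2" "g *v u = l" and gh: "g ** h = mat 1"
      using SL2_transitive[OF assms] by metis
    define v where "v = (\<lambda>\<xi>. lin u \<xi> ^ 5 * act h Q \<xi>)"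
    have "act g v = (\<lambda>\<xi>. lin l \<xi> ^ 5 * act g (act h Q) \<xi>)" by (simp add: v_def act_def lin_act g(2))
    hence vw: "act g v = w" by (simp add: Q(1) act_act gh act_one)
    have "v \<in> osc 2 7 u" unfolding osc v_def using act_SymV_2[OF Q(2), of h] by blast
    moreover have "v \<noteq> 0" using vw w(2) act_zero by auto
    ultimately have "cfun.span {v} \<in> proj (osc 2 7 u)" by (rule span_in_proj)
    moreover have "R = act g ` cfun.span {v}" by (simp add: R act_span vw)
    ultimately show "R \<in> {act g ` P | g P. g \<in> SL2 \<and> P \<in> proj (osc 2 7 u)}" using g(1) by blast
  }
qed

lemma osc_cone_subset: "osc_cone \<subseteq> SymV 7"
  by (auto simp: osc_cone_def binary_form_in_SymV)

section \<open>Irreducibility of the intersection of the three quadrics\<close>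

text \<open>The coordinates of \<open>f(x + s y, y)\<close>.\<close>

definition shear :: "complex \<Rightarrow> (nat \<Rightarrow> complex) \<Rightarrow> nat \<Rightarrow> complex" where
  "shear s a i = (\<Sum>k\<le>i. of_nat (i choose k) * s ^ k * a (i - k))"

text \<open>The coordinates of \<open>f(x, y + t x)\<close>: exchanging \<open>x\<close> and \<open>y\<close> reverses the order of the coordinates and
  turns this into the other shear.\<close>

definition shear_up :: "complex \<Rightarrow> (nat \<Rightarrow> complex) \<Rightarrow> nat \<Rightarrow> complex" where
  "shear_up t a i = shear t (\<lambda>j. a (7 - j)) (7 - i)"

lemma shear_expand:
  "shear s a 0 = a 0"
  "shear s a 1 = a 1 + s * a 0"
  "shear s a 2 = a 2 + 2 * s * a 1 + s^2 * a 0"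
  "shear s a 3 = a 3 + 3 * s * a 2 + 3 * s^2 * a 1 + s^3 * a 0"
  "shear s a 4 = a 4 + 4 * s * a 3 + 6 * s^2 * a 2 + 4 * s^3 * a 1 + s^4 * a 0"
  "shear s a 5 = a 5 + 5 * s * a 4 + 10 * s^2 * a 3 + 10 * s^3 * a 2 + 5 * s^4 * a 1 + s^5 * a 0"
  "shear s a 6 = a 6 + 6 * s * a 5 + 15 * s^2 * a 4 + 20 * s^3 * a 3 + 15 * s^4 * a 2 + 6 * s^5 * a 1 + s^6 * a 0"
  "shear s a 7 = a 7 + 7 * s * a 6 + 21 * s^2 * a 5 + 35 * s^3 * a 4 + 35 * s^4 * a 3 + 21 * s^5 * a 2 + 7 * s^6 * a 1 + s^7 * a 0"
  by (simp_all add: shear_def numeral_eq_Suc algebra_simps)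

lemma le_7_cases: "i \<le> 7 \<longleftrightarrow> i \<in> {0, 1, 2, 3, 4, 5, 6, 7::nat}"
  by auto

lemma shear_inverse:
  assumes "i \<le> 7" shows "shear s (shear (- s) a) i = a i"
proof -
  let ?b = "shear (- s) a"
  have "shear s ?b 0 = a 0" "shear s ?b 1 = a 1" "shear s ?b 2 = a 2" "shear s ?b 3 = a 3"
    "shear s ?b 4 = a 4" "shear s ?b 5 = a 5" "shear s ?b 6 = a 6" "shear s ?b 7 = a 7"
    unfolding shear_expand by (simp_all add: algebra_simps power_numeral_reduce del: One_nat_def)
  thus ?thesis using assms unfolding le_7_cases by (auto simp del: One_nat_def)
qed

text \<open>The transvectant is covariant, so a shear acts on the three quadrics by an invertible linear
  substitution among them.\<close>

lemma apolar_shear: "apolar a \<Longrightarrow> apolar (shear s a)"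
  unfolding apolar_def shear_expand by (intro conjI; algebra)

text \<open>The exchange of \<open>x\<close> and \<open>y\<close> swaps the outer two quadrics and preserves the middle one.\<close>

lemma apolar_rev: "apolar (\<lambda>j. a (7 - j)) \<longleftrightarrow> apolar a"
  by (auto simp: apolar_def algebra_simps)

lemma apolar_shear_up: "apolar a \<Longrightarrow> apolar (shear_up t a)"
proof -
  assume "apolar a"
  hence "apolar (shear t (\<lambda>j. a (7 - j)))" using apolar_shear apolar_rev by blast
  thus ?thesis unfolding shear_up_def using apolar_rev[of "shear t (\<lambda>j. a (7 - j))"] by simp
qed

lemma shear_cong: "(\<And>j. j \<le> i \<Longrightarrow> a j = b j) \<Longrightarrow> shear s a i = shear s b i"
  by (auto simp: shear_def intro!: sum.cong)

lemma shear_up_inverse: 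
  assumes "i \<le> 7" shows "shear_up t (shear_up (- t) a) i = a i"
proof -
  have "shear_up t (shear_up (- t) a) i = shear t (shear (- t) (\<lambda>j. a (7 - j))) (7 - i)"
    unfolding shear_up_def by (rule shear_cong) simp
  thus ?thesis using assms by (simp add: shear_inverse)
qed

lemma shear_zero: "shear 0 a i = a i"
proof -
  have "shear 0 a i = (\<Sum>k\<in>{0}. of_nat (i choose k) * 0 ^ k * a (i - k))"
    unfolding shear_def by (rule sum.mono_neutral_right) auto
  thus ?thesis by simp
qed

lemma shear_scale: "shear s (\<lambda>i. c * a i) i = c * shear s a i"
  by (simp add: shear_def sum_distrib_left mult_ac)

lemma shear_up_scale: "shear_up s (\<lambda>i. c * a i) i = c * shear_up s a i"
  by (simp add: shear_up_def shear_scale)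

lemma apolar_scale: "apolar a \<Longrightarrow> apolar (\<lambda>i. c * a i)"
  unfolding apolar_def by (intro conjI; algebra)

lemma polyfun_shear:
  assumes "polyfun s" "\<And>j. j \<le> i \<Longrightarrow> polyfun (\<lambda>\<tau>. a \<tau> j)"
  shows "polyfun (\<lambda>\<tau>. shear (s \<tau>) (a \<tau>) i)"
  unfolding shear_def
  by (intro polyfun_sum polyfun_mult polyfun_const polyfun_power assms) simp

lemma polyfun_shear_up:
  assumes "polyfun s" "\<And>j. j \<le> 7 \<Longrightarrow> polyfun (\<lambda>\<tau>. a \<tau> j)"
  shows "polyfun (\<lambda>\<tau>. shear_up (s \<tau>) (a \<tau>) i)"
  unfolding shear_up_def using assms by (intro polyfun_shear) auto

text \<open>The septic with \<open>a\<^sub>6 = 0\<close>, \<open>a\<^sub>7 = 1\<close> and \<open>(a\<^sub>2, a\<^sub>3, a\<^sub>4, a\<^sub>5) = (x, p, b, r)\<close> on which the last two quadrics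
  vanish, which fixes \<open>a\<^sub>0\<close> and \<open>a\<^sub>1\<close>.\<close>

definition hypersurface_point :: "complex \<Rightarrow> complex \<Rightarrow> complex \<Rightarrow> complex \<Rightarrow> nat \<Rightarrow> complex" where
  "hypersurface_point x p b r = (\<lambda>i. [5 * p * b - 9 * x * r, 10 * b^2 - 15 * p * r, x, p, b, r, 0, 1] ! i)"

text \<open>The point \<open>hypersurface_point x p b r\<close> with \<open>x\<close> solved from the remaining quadric, multiplied by \<open>b\<close> to
  remove the denominator of \<open>x\<close>; see \<open>parametrization_hypersurface_point\<close>. For \<open>b = 0\<close> the entries still make
  sense, so that parameters can be joined by straight lines.\<close>

definition parametrization :: "complex \<Rightarrow> complex \<Rightarrow> complex \<Rightarrow> nat \<Rightarrow> complex" where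
  "parametrization p b r = (let x = (10 * p^2 - 90 * p * r^2 + 60 * b^2 * r) / 15 in
     (\<lambda>i. [5 * p * b^2 - 9 * x * r, b * (10 * b^2 - 15 * p * r), x, b * p, b^2, b * r, 0, b] ! i))"

lemma apolar_parametrization: "apolar (parametrization p b r)"
  unfolding apolar_def parametrization_def Let_def by (simp add: field_simps) (intro conjI; algebra)

lemma parametrization_hypersurface_point:
  assumes "b \<noteq> 0" "15 * x * b = 10 * p^2 - 90 * p * r^2 + 60 * b^2 * r" "i \<le> 7"
  shows "parametrization p b r i = b * hypersurface_point x p b r i"
proof -
  have x: "(10 * p^2 - 90 * p * r^2 + 60 * b^2 * r) / 15 = x * b" using assms(2) by (simp add: field_simps)
  have p: "parametrization p b r = (\<lambda>i. [5 * p * b^2 - 9 * (x * b) * r, b * (10 * b^2 - 15 * p * r), x * b, b * p, b^2, b * r, 0, b] ! i)"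
    unfolding parametrization_def Let_def x ..
  show ?thesis using assms(3) unfolding le_7_cases p hypersurface_point_def
    by (elim insertE emptyE) (simp_all add: power2_eq_square algebra_simps)
qed

lemma apolar_normal_form:
  assumes "apolar a" "a 6 = 0" "a 7 = 1"
  shows "\<And>i. i \<le> 7 \<Longrightarrow> a i = hypersurface_point (a 2) (a 3) (a 4) (a 5) i"
    and "15 * a 2 * a 4 = 10 * a 3 ^ 2 - 90 * a 3 * a 5 ^ 2 + 60 * a 4 ^ 2 * a 5"
proof -
  have a1: "a 1 = 10 * a 4 ^ 2 - 15 * a 3 * a 5" and a0: "a 0 = 5 * a 3 * a 4 - 9 * a 2 * a 5"
    and q: "- 6 * a 1 * a 5 + 15 * a 2 * a 4 - 10 * a 3 ^ 2 = 0"
    using assms by (auto simp: apolar_def algebra_simps eq_neg_iff_add_eq_0)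
  show "15 * a 2 * a 4 = 10 * a 3 ^ 2 - 90 * a 3 * a 5 ^ 2 + 60 * a 4 ^ 2 * a 5"
    using q unfolding a1 by algebra
  show "a i = hypersurface_point (a 2) (a 3) (a 4) (a 5) i" if "i \<le> 7" for i
    using that unfolding le_7_cases
    by (elim insertE emptyE) (simp_all only: hypersurface_point_def, simp_all add: a0 a1[simplified] assms(2,3))
qed

lemma form_scale_zero:
  assumes "F \<in> forms (SymV r) d" "\<And>i. i \<le> r \<Longrightarrow> a i = c * b i" "F (binary_form r b) = 0"
  shows "F (binary_form r a) = 0"
proof -
  have "binary_form r a = (\<lambda>\<xi>. c * binary_form r b \<xi>)" unfolding binary_form_scale by (rule binary_form_cong[OF assms(2)])
  thus ?thesis using forms_homogeneous[OF assms(1) binary_form_in_SymV, of c b] assms(3) by simp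
qed

lemma polyfun_form_binary_form:
  assumes "F \<in> forms (SymV r) d" "\<And>i. i \<le> r \<Longrightarrow> polyfun (\<lambda>t. a t i)"
  shows "polyfun (\<lambda>t. F (binary_form r (a t)))"
proof -
  have "polynomial_curve (SymV r) (\<lambda>t. binary_form r (a t))" by (rule polynomial_curve_binary_form) (rule assms(2))
  thus ?thesis using assms(1) unfolding polynomial_curve_def by simp
qed

lemma polyfun_hypersurface_point:
  assumes "polyfun x" "polyfun p" "polyfun b" "i \<le> 7"
  shows "polyfun (\<lambda>\<tau>. hypersurface_point (x \<tau>) (p \<tau>) (b \<tau>) r i)"
  using assms(4) unfolding le_7_cases
  by (elim insertE emptyE) (simp_all only: hypersurface_point_def, auto intro!: assms)

text \<open>The parametrization only reaches the points of the hypersurface with \<open>b \<noteq> 0\<close>. Where \<open>b = 0\<close> the equation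
  reads \<open>p (p - 9 r\<^sup>2) = 0\<close>, and a point on either branch lies on a polynomial curve in the hypersurface on
  which \<open>b\<close> vanishes only at that point; a polynomial that is zero for all other parameters is zero there
  too.\<close>

lemma form_vanishes_hypersurface:
  assumes F: "F \<in> forms (SymV 7) d"
    and van: "\<And>p b r. b \<noteq> 0 \<Longrightarrow> F (binary_form 7 (shear_up t (parametrization p b r))) = 0"
    and eq: "15 * x * b = 10 * p^2 - 90 * p * r^2 + 60 * b^2 * r"
  shows "F (binary_form 7 (shear_up t (hypersurface_point x p b r))) = 0"
proof -
  have generic: "F (binary_form 7 (shear_up t (hypersurface_point x p b r))) = 0"
    if "b \<noteq> 0" "15 * x * b = 10 * p^2 - 90 * p * r^2 + 60 * b^2 * r" for x p b
  proof (rule form_scale_zero[OF F _ van[OF that(1)]])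
    fix i :: nat
    have "shear_up t (parametrization p b r) i = shear_up t (\<lambda>i. b * hypersurface_point x p b r i) i"
      unfolding shear_up_def by (rule shear_cong) (simp add: parametrization_hypersurface_point[OF that])
    thus "shear_up t (hypersurface_point x p b r) i = 1 / b * shear_up t (parametrization p b r) i"
      using that(1) by (simp add: shear_up_scale)
  qed
  have limit: "F (binary_form 7 (shear_up t (hypersurface_point (x 0) (p 0) (b 0) r))) = 0"
    if curve: "polyfun x" "polyfun p" "polyfun b" "\<And>\<tau>. \<tau> \<noteq> 0 \<Longrightarrow> b \<tau> \<noteq> 0"
      "\<And>\<tau>. 15 * x \<tau> * b \<tau> = 10 * p \<tau> ^2 - 90 * p \<tau> * r^2 + 60 * b \<tau> ^ 2 * r" for x p b
  proof (rule polyfun_zero_at[where f = "\<lambda>\<tau>. F (binary_form 7 (shear_up t (hypersurface_point (x \<tau>) (p \<tau>) (b \<tau>) r)))" and s = 0])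
    show "polyfun (\<lambda>\<tau>. F (binary_form 7 (shear_up t (hypersurface_point (x \<tau>) (p \<tau>) (b \<tau>) r))))"
      by (intro polyfun_form_binary_form[OF F] polyfun_shear_up polyfun_const polyfun_hypersurface_point curve)
    show "F (binary_form 7 (shear_up t (hypersurface_point (x \<tau>) (p \<tau>) (b \<tau>) r))) = 0" if "\<tau> \<noteq> 0" for \<tau>
      by (rule generic[OF curve(4)[OF that] curve(5)])
  qed
  show ?thesis
  proof (cases "b = 0")
    case False
    thus ?thesis using eq by (rule generic)
  next
    case b: True
    have "p * (p - 9 * r^2) = 0" using eq b by algebra
    hence "r = 0 \<and> p = 0 \<or> r \<noteq> 0 \<and> p = 0 \<or> r \<noteq> 0 \<and> p = 9 * r^2" by auto
    thus ?thesis
    proof (elim disjE conjE)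
      assume "r = 0" "p = 0"
      \<comment> \<open>With \<open>b = \<tau>\<^sup>2\<close> and \<open>p = k \<tau>\<close> the equation becomes \<open>15 x = 10 k\<^sup>2\<close>.\<close>
      define k where "k = csqrt (3 * x / 2)"
      have x: "x = 10 * k^2 / 15" by (simp add: k_def)
      have "F (binary_form 7 (shear_up t (hypersurface_point (10 * k^2 / 15) (k * 0) (0^2) r))) = 0"
        by (rule limit[of "\<lambda>_. 10 * k^2 / 15" "\<lambda>\<tau>. k * \<tau>" "\<lambda>\<tau>. \<tau>^2"])
          (auto simp: \<open>r = 0\<close> power2_eq_square)
      thus ?thesis using \<open>p = 0\<close> b by (simp add: x)
    next
      assume "r \<noteq> 0" "p = 0"
      \<comment> \<open>With \<open>b = \<tau>\<close> and \<open>p = k \<tau>\<close> the equation is divisible by \<open>\<tau>\<close> and gives \<open>x = - 6 k r\<^sup>2\<close> at \<open>\<tau> = 0\<close>.\<close>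
      define k where "k = - x / (6 * r^2)"
      have x: "x = - 6 * k * r^2" using \<open>r \<noteq> 0\<close> by (simp add: k_def)
      have "F (binary_form 7 (shear_up t (hypersurface_point (2/3 * k^2 * 0 - 6 * k * r^2 + 4 * 0 * r) (k * 0) 0 r))) = 0"
        by (rule limit[of "\<lambda>\<tau>. 2/3 * k^2 * \<tau> - 6 * k * r^2 + 4 * \<tau> * r" "\<lambda>\<tau>. k * \<tau>" "\<lambda>\<tau>. \<tau>"])
          (auto simp: algebra_simps power2_eq_square)
      thus ?thesis using \<open>p = 0\<close> b by (simp add: x)
    next
      assume "r \<noteq> 0" "p = 9 * r^2"
      \<comment> \<open>The same on the other branch, with \<open>p = 9 r\<^sup>2 + k \<tau>\<close>.\<close>
      define k where "k = x / (6 * r^2)"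
      have x: "x = 6 * k * r^2" using \<open>r \<noteq> 0\<close> by (simp add: k_def)
      have "F (binary_form 7 (shear_up t (hypersurface_point (2/3 * (9 * r^2 + k * 0) * k + 4 * 0 * r) (9 * r^2 + k * 0) 0 r))) = 0"
        by (rule limit[of "\<lambda>\<tau>. 2/3 * (9 * r^2 + k * \<tau>) * k + 4 * \<tau> * r" "\<lambda>\<tau>. 9 * r^2 + k * \<tau>" "\<lambda>\<tau>. \<tau>"])
          (auto simp: algebra_simps power2_eq_square)
      thus ?thesis using \<open>p = 9 * r^2\<close> b by (simp add: x mult_ac)
    qed
  qed
qed

lemma polyfun_zero_generic:
  assumes "polyfun f" "polyfun g" "g s0 \<noteq> 0" "\<And>t. g t \<noteq> 0 \<Longrightarrow> f t = 0" shows "f s = 0"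
proof (rule ccontr)
  assume "f s \<noteq> 0"
  hence "finite ({t. f t = 0} \<union> {t. g t = 0})"
    using polyfun_finite_zeros assms(1-3) by blast
  thus False using finite_cofinite_ex assms(4) by blast
qed

definition apolar_cone :: "(complex^2 \<Rightarrow> complex) set" where
  "apolar_cone = {binary_form 7 a | a. apolar a}"

definition apolar_locus :: "(complex^2 \<Rightarrow> complex) set set" where
  "apolar_locus = {cfun.span {w} | w. w \<in> apolar_cone \<and> w \<noteq> 0}"

text \<open>The last coordinate of the sheared form is the value of the form at \<open>(s, 1)\<close>, a polynomial in \<open>s\<close> with the
  same coefficients up to binomial factors.\<close>

lemma binary_form_nonzero_shear:
  assumes "binary_form 7 a \<noteq> 0" shows "\<exists>s. shear s a 7 \<noteq> 0"
proof (rule ccontr)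
  assume "\<not> ?thesis"
  hence "\<forall>s. (\<Sum>k\<le>7. (of_nat (7 choose k) * a (7 - k)) * s ^ k) = 0"
    by (simp add: shear_def mult_ac)
  hence "\<forall>k\<le>7. of_nat (7 choose k) * a (7 - k) = 0" by (simp only: polyfun_eq_0)
  hence a: "a (7 - k) = 0" if "k \<le> 7" for k using that by auto
  have "a i = 0" if "i \<le> 7" for i using a[of "7 - i"] that by simp
  hence "binary_form 7 a = binary_form 7 (\<lambda>_. 0)" by (intro binary_form_cong)
  thus False using assms by (simp add: binary_form_zero)
qed

text \<open>Density of the parametrized points. If \<open>a\<^sub>7 \<noteq> 0\<close>, the shear with parameter \<open>a\<^sub>6 / a\<^sub>7\<close> leads to the
  normal form treated in \<open>form_vanishes_hypersurface\<close>. In general \<open>a\<^sub>7\<close> becomes nonzero after almost every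
  shear of the other kind, by \<open>binary_form_nonzero_shear\<close>, and the vanishing extends to the shear with
  parameter zero.\<close>

lemma form_vanishes_on_apolar_cone:
  assumes F: "F \<in> forms (SymV 7) d"
    and van: "\<And>t p b r. b \<noteq> 0 \<Longrightarrow> F (binary_form 7 (shear_up t (parametrization p b r))) = 0"
    and w: "w \<in> apolar_cone" "w \<noteq> 0"
  shows "F w = 0"
proof -
  have affine: "F (binary_form 7 a) = 0" if a: "apolar a" "a 7 \<noteq> 0" for a
  proof -
    define t where "t = a 6 / a 7"
    define h where "h = (\<lambda>i. 1 / a 7 * shear_up (- t) a i)"
    have h: "apolar h" unfolding h_def by (intro apolar_scale apolar_shear_up a)
    have h67: "h 6 = 0" "h 7 = 1"
      using a(2) by (simp_all add: h_def shear_up_def shear_expand(1) shear_expand(2)[simplified] t_def)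
    have "binary_form 7 (shear_up t h) = binary_form 7 (shear_up t (hypersurface_point (h 2) (h 3) (h 4) (h 5)))"
      unfolding shear_up_def
      by (intro binary_form_cong shear_cong apolar_normal_form(1)[OF h h67]) simp
    hence "F (binary_form 7 (shear_up t h)) = 0"
      using form_vanishes_hypersurface[OF F van apolar_normal_form(2)[OF h h67]] by simp
    thus ?thesis
    proof (rule form_scale_zero[OF F, rotated])
      fix i :: nat assume i: "i \<le> 7"
      have "shear_up t h i = 1 / a 7 * a i"
        unfolding h_def shear_up_scale shear_up_inverse[OF i] ..
      thus "a i = a 7 * shear_up t h i" using a(2) by simp
    qed
  qed
  obtain a where wa: "w = binary_form 7 a" and a: "apolar a" using w(1) by (auto simp: apolar_cone_def)
  obtain s where s: "shear s a 7 \<noteq> 0" using binary_form_nonzero_shear w(2) wa by blast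
  have poly: "polyfun (\<lambda>s. shear s a i)" for i by (rule polyfun_shear[OF polyfun_ident polyfun_const])
  have "F (binary_form 7 (shear 0 a)) = 0"
    by (rule polyfun_zero_generic[where f = "\<lambda>s. F (binary_form 7 (shear s a))" and g = "\<lambda>s. shear s a 7"])
      (use poly s in \<open>auto intro: polyfun_form_binary_form[OF F] affine apolar_shear a\<close>)
  moreover have "binary_form 7 (shear 0 a) = w"
    unfolding wa by (rule binary_form_cong) (rule shear_zero)
  ultimately show ?thesis by simp
qed

lemma polyfun_line: "polyfun (\<lambda>\<tau>. x + \<tau> * (y - x))"
  by (intro polyfun_add polyfun_mult polyfun_const polyfun_ident)

lemma polyfun_parametrization:
  assumes "polyfun p" "polyfun b" "polyfun r" "i \<le> 7"
  shows "polyfun (\<lambda>\<tau>. parametrization (p \<tau>) (b \<tau>) (r \<tau>) i)"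
  using assms(4) unfolding le_7_cases
  by (elim insertE emptyE) (simp_all only: parametrization_def Let_def, auto intro!: assms)

lemma polyfun_osc_coords:
  assumes "polyfun l" "polyfun m" "polyfun p" "polyfun q" "polyfun r" "i \<le> 7"
  shows "polyfun (\<lambda>\<tau>. osc_coords (l \<tau>) (m \<tau>) (p \<tau>) (q \<tau>) (r \<tau>) i)"
  using assms(6) unfolding le_7_cases
  by (elim insertE emptyE) (simp_all only: osc_coords_def, auto intro!: assms)

lemma apolar_cone_subset: "apolar_cone \<subseteq> SymV 7"
  by (auto simp: apolar_cone_def binary_form_in_SymV)

lemma apolar_locus_subset: "apolar_locus \<subseteq> proj (SymV 7)"
  using apolar_cone_subset by (auto simp: apolar_locus_def proj_def)

lemma apolar_cone_scale:
  assumes "w \<in> apolar_cone" shows "(\<lambda>\<xi>. c * w \<xi>) \<in> apolar_cone"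
  using assms apolar_scale by (auto simp: apolar_cone_def binary_form_scale)

lemma Union_apolar_locus: "\<Union>apolar_locus \<subseteq> apolar_cone"
  by (auto simp: apolar_locus_def cfun.span_singleton apolar_cone_scale)

lemma osc_cone_subset_apolar_cone: "osc_cone \<subseteq> apolar_cone"
  by (auto simp: osc_cone_def apolar_cone_def intro: apolar_osc_coords)

text \<open>The last coordinate of \<open>(l x + y)\<^sup>5 y\<^sup>2\<close> is one.\<close>

lemma osc_cone_nonzero: "binary_form 7 (osc_coords l 1 0 0 1) \<noteq> 0"
proof
  assume "binary_form 7 (osc_coords l 1 0 0 1) = 0"
  hence "binary_form 7 (osc_coords l 1 0 0 1) = binary_form 7 (\<lambda>_. 0)" by (simp add: binary_form_zero)
  from binary_form_coeff_unique[OF this, of 7] show False by (simp add: osc_coords_def)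
qed

lemma form_vanishes_at_zero:
  assumes "F \<in> forms (SymV r) d" "d > 0" shows "F 0 = 0"
proof -
  have "F (\<lambda>\<xi>. 0 * (0 :: complex^2 \<Rightarrow> complex) \<xi>) = 0 ^ d * F 0"
    by (rule forms_homogeneous[OF assms(1) cfun.subspace_0[OF subspace_SymV]])
  thus ?thesis using assms(2) by (simp add: zero_fun_def power_0_left)
qed

lemma vanishes_on_lines:
  assumes "F \<in> forms W d" "S \<subseteq> W" "\<And>w. w \<in> S \<Longrightarrow> w \<noteq> 0 \<Longrightarrow> F w = 0"
  shows "vanishes_on {cfun.span {w} | w. w \<in> S \<and> w \<noteq> 0} F"
  unfolding vanishes_on_def
proof
  fix v assume "v \<in> \<Union>{cfun.span {w} | w. w \<in> S \<and> w \<noteq> 0}"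
  then obtain w c where "w \<in> S" "w \<noteq> 0" "v = (\<lambda>x. c * w x)" by (auto simp: cfun.span_singleton)
  thus "F v = 0" using forms_homogeneous[OF assms(1), of w c] assms(2,3) by auto
qed

lemma irreducible_apolar_locus:
  "irreducible_space (subtopology (zariski (SymV 7)) apolar_locus)"
proof (rule irreducible_by_curves[OF subspace_SymV apolar_locus_subset])
  let ?S = "{binary_form 7 (shear_up t (parametrization p b r)) | t p b r. True}"
  have S: "?S \<subseteq> apolar_cone"
    by (auto simp: apolar_cone_def intro: apolar_shear_up apolar_parametrization)
  have "binary_form 7 (osc_coords 0 1 0 0 1) \<in> apolar_cone"
    unfolding apolar_cone_def using apolar_osc_coords by blast
  thus "apolar_locus \<noteq> {}"
    unfolding apolar_locus_def using osc_cone_nonzero[of 0] by blast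
  show "?S \<subseteq> SymV 7" using S apolar_cone_subset by blast
  show "cfun.span {w} \<in> apolar_locus" if "w \<in> ?S" "w \<noteq> 0" for w
    unfolding apolar_locus_def using that S by blast
  show "vanishes_on apolar_locus F"
    if F: "F \<in> forms (SymV 7) d" and van: "\<And>w. w \<in> ?S \<Longrightarrow> w \<noteq> 0 \<Longrightarrow> F w = 0" for d F
    unfolding apolar_locus_def
  proof (rule vanishes_on_lines[OF F apolar_cone_subset], rule form_vanishes_on_apolar_cone[OF F])
    fix t p b r :: complex assume "b \<noteq> 0"
    have "binary_form 7 (shear_up t (parametrization p b r)) \<noteq> 0"
    proof
      assume "binary_form 7 (shear_up t (parametrization p b r)) = 0"
      hence "binary_form 7 (shear_up t (parametrization p b r)) = binary_form 7 (\<lambda>_. 0)" by (simp add: binary_form_zero)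
      from binary_form_coeff_unique[OF this, of 7] show False
        using \<open>b \<noteq> 0\<close> by (simp add: shear_up_def shear_expand(1) parametrization_def Let_def)
    qed
    thus "F (binary_form 7 (shear_up t (parametrization p b r))) = 0" by (intro van) blast+
  qed
  fix v w assume "v \<in> ?S" "w \<in> ?S"
  then obtain t p b r t' p' b' r' where v: "v = binary_form 7 (shear_up t (parametrization p b r))"
    and w: "w = binary_form 7 (shear_up t' (parametrization p' b' r'))" by blast
  define \<gamma> where "\<gamma> \<tau> = binary_form 7 (shear_up (t + \<tau> * (t' - t))
    (parametrization (p + \<tau> * (p' - p)) (b + \<tau> * (b' - b)) (r + \<tau> * (r' - r))))" for \<tau>
  have "polynomial_curve (SymV 7) \<gamma>"
    unfolding \<gamma>_def
    by (intro polynomial_curve_binary_form polyfun_shear_up polyfun_parametrization polyfun_line)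
  moreover have "range \<gamma> \<subseteq> ?S" unfolding \<gamma>_def by blast
  moreover have "\<gamma> 0 = v" "\<gamma> 1 = w" by (simp_all add: \<gamma>_def v w)
  ultimately show "\<exists>\<gamma>. polynomial_curve (SymV 7) \<gamma> \<and> range \<gamma> \<subseteq> ?S \<and> v \<in> range \<gamma> \<and> w \<in> range \<gamma>"
    by (intro exI[of _ \<gamma>] conjI) (auto intro: rangeI[of \<gamma> 0] rangeI[of \<gamma> 1])
qed

section \<open>The quadratic hull\<close>

definition transvectant :: "((complex^2 \<Rightarrow> complex) \<Rightarrow> complex) set" where
  "transvectant = (let a = coord 7 in
    {\<lambda>w. a 0 w * a 6 w - 6 * (a 1 w * a 5 w) + 15 * (a 2 w * a 4 w) - 10 * (a 3 w * a 3 w),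
     \<lambda>w. a 0 w * a 7 w - 5 * (a 1 w * a 6 w) + 9 * (a 2 w * a 5 w) - 5 * (a 3 w * a 4 w),
     \<lambda>w. a 1 w * a 7 w - 6 * (a 2 w * a 6 w) + 15 * (a 3 w * a 5 w) - 10 * (a 4 w * a 4 w)})"

lemma coord_product_form:
  "i \<le> r \<Longrightarrow> j \<le> r \<Longrightarrow> (\<lambda>w. coord r i w * coord r j w) \<in> forms (SymV r) 2"
  using forms_mult[OF forms_dual[OF coord_dual] forms_dual[OF coord_dual], of i r j]
  by (simp add: numeral_2_eq_2)

lemma transvectant_forms: "transvectant \<subseteq> forms (SymV 7) 2"
  unfolding transvectant_def Let_def insert_subset
  by (intro conjI empty_subsetI forms_add forms_diff forms_scale coord_product_form) simp_all

lemma transvectant_binary_form: "(\<forall>F\<in>transvectant. F (binary_form 7 a) = 0) \<longleftrightarrow> apolar a"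
  by (simp add: transvectant_def Let_def apolar_def coord_binary_form power2_eq_square mult.assoc)

lemma apolar_locus_eq: "apolar_locus = zero_locus (SymV 7) transvectant"
proof (intro equalityI subsetI)
  fix P assume "P \<in> apolar_locus"
  moreover from this have "F w = 0" if "F \<in> transvectant" "w \<in> P" for F w
  proof -
    have "w \<in> apolar_cone" using \<open>P \<in> apolar_locus\<close> that(2) Union_apolar_locus by blast
    then obtain a where "w = binary_form 7 a" "apolar a" unfolding apolar_cone_def by blast
    thus ?thesis using transvectant_binary_form that(1) by blast
  qed
  ultimately show "P \<in> zero_locus (SymV 7) transvectant"
    using apolar_locus_subset by (auto simp: zero_locus_def)
next
  fix P assume P: "P \<in> zero_locus (SymV 7) transvectant"
  then obtain w where w: "w \<in> SymV 7" "w \<noteq> 0" "P = cfun.span {w}" by (auto simp: zero_locus_def proj_def)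
  have "w \<in> P" unfolding w(3) by (rule cfun.span_base) simp
  obtain a where a: "w = binary_form 7 a" using w(1) by (auto simp: SymV_eq)
  have "\<forall>F\<in>transvectant. F (binary_form 7 a) = 0" using P \<open>w \<in> P\<close> a by (simp add: zero_locus_def)
  hence "w \<in> apolar_cone" unfolding transvectant_binary_form apolar_cone_def a by blast
  thus "P \<in> apolar_locus" unfolding apolar_locus_def using w(2,3) by blast
qed

lemma closedin_apolar_locus: "closedin (zariski (SymV 7)) apolar_locus"
  unfolding apolar_locus_eq closedin_zariski using transvectant_forms by blast

lemma vanishes_on_closure:
  assumes "F \<in> forms W d" "Y \<subseteq> proj W" "vanishes_on Y F"
  shows "vanishes_on (zariski W closure_of Y) F"
proof -
  have "Y \<subseteq> zero_locus W {F}" using assms(2,3) by (auto simp: zero_locus_def vanishes_on_def)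
  hence "zariski W closure_of Y \<subseteq> zero_locus W {F}"
    by (rule closure_of_minimal[OF _ closedin_form[OF assms(1)]])
  thus ?thesis by (auto simp: zero_locus_def vanishes_on_def)
qed

definition osc_locus :: "(complex^2 \<Rightarrow> complex) set set" where
  "osc_locus = {cfun.span {w} | w. w \<in> osc_cone \<and> w \<noteq> 0}"

lemma osc_locus_subset: "osc_locus \<subseteq> apolar_locus"
  unfolding osc_locus_def apolar_locus_def using osc_cone_subset_apolar_cone by blast

lemma osculating_variety_eq:
  "u \<noteq> 0 \<Longrightarrow> osculating_variety 2 7 u = zariski (SymV 7) closure_of osc_locus"
  unfolding osculating_variety_def osculating_orbit osc_locus_def ..

lemma osc_locus_subset_closure: "osc_locus \<subseteq> zariski (SymV 7) closure_of osc_locus"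
  using osc_locus_subset apolar_locus_subset by (intro closure_of_subset) (auto simp: topspace_zariski)

lemma closure_osc_locus_subset: "zariski (SymV 7) closure_of osc_locus \<subseteq> apolar_locus"
  by (rule closure_of_minimal[OF osc_locus_subset closedin_apolar_locus])

text \<open>The forms defining the hull are the quadrics vanishing on the closure. They vanish on the forms
  \<open>l\<^sup>5 Q\<close>, hence on the common zeros of the transvectant; conversely the coefficients of the
  transvectant are such quadrics.\<close>

lemma M_variety_eq:
  assumes "u \<noteq> 0" shows "M_variety 2 7 u = apolar_locus"
proof -
  let ?T = "zariski (SymV 7) closure_of osc_locus"
  have quads: "vanishes_on apolar_locus F" if F: "F \<in> vanishing_forms (SymV 7) 2 ?T" for F
    unfolding apolar_locus_def
  proof (rule vanishes_on_lines)
    show F2: "F \<in> forms (SymV 7) 2" using F by (simp add: vanishing_forms_def)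
    show "apolar_cone \<subseteq> SymV 7" by (rule apolar_cone_subset)
    fix w assume "w \<in> apolar_cone"
    then obtain a where a: "w = binary_form 7 a" "apolar a" unfolding apolar_cone_def by blast
    obtain c where c: "\<forall>a. F (binary_form 7 a) = (\<Sum>i\<le>7. \<Sum>j\<le>7. c i j * a i * a j)"
      using quadratic_form_coords[OF F2] by blast
    have "F (binary_form 7 (osc_coords l m p q r)) = 0" for l m p q r
    proof (cases "binary_form 7 (osc_coords l m p q r) = 0")
      case True
      thus ?thesis using form_vanishes_at_zero[OF F2] by simp
    next
      case False
      hence "cfun.span {binary_form 7 (osc_coords l m p q r)} \<in> osc_locus"
        unfolding osc_locus_def osc_cone_def by blast
      hence "cfun.span {binary_form 7 (osc_coords l m p q r)} \<in> ?T" using osc_locus_subset_closure by blast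
      moreover have "binary_form 7 (osc_coords l m p q r) \<in> cfun.span {binary_form 7 (osc_coords l m p q r)}"
        by (rule cfun.span_base) simp
      ultimately show ?thesis using F unfolding vanishing_forms_def by simp
    qed
    from quadric_vanishing_on_osc_coords[where F = "\<lambda>a. F (binary_form 7 a)" and c = c, OF _ this a(2)] c
    show "F w = 0" by (simp add: a(1))
  qed
  have "transvectant \<subseteq> vanishing_forms (SymV 7) 2 ?T"
  proof
    fix F assume F: "F \<in> transvectant"
    have "\<forall>P\<in>?T. \<forall>w\<in>P. F w = 0"
      using closure_osc_locus_subset F unfolding apolar_locus_eq zero_locus_def by auto
    thus "F \<in> vanishing_forms (SymV 7) 2 ?T"
      using F transvectant_forms by (auto simp: vanishing_forms_def)
  qed
  hence "quadratic_hull (SymV 7) ?T \<subseteq> apolar_locus"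
    unfolding quadratic_hull_def apolar_locus_eq by (auto simp: zero_locus_def)
  moreover have "apolar_locus \<subseteq> quadratic_hull (SymV 7) ?T"
    using quads apolar_locus_subset unfolding quadratic_hull_def zero_locus_def vanishes_on_def by auto
  ultimately show ?thesis unfolding M_variety_def osculating_variety_eq[OF assms] by blast
qed

lemma irreducible_closure_osc_locus:
  "irreducible_space (subtopology (zariski (SymV 7)) (zariski (SymV 7) closure_of osc_locus))"
    (is "irreducible_space (subtopology _ ?T)")
proof (rule irreducible_by_curves[OF subspace_SymV])
  have sub: "osc_locus \<subseteq> proj (SymV 7)" using osc_locus_subset apolar_locus_subset by blast
  show "?T \<subseteq> proj (SymV 7)" using closure_osc_locus_subset apolar_locus_subset by blast
  have "binary_form 7 (osc_coords 0 1 0 0 1) \<in> osc_cone" unfolding osc_cone_def by blast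
  hence "osc_locus \<noteq> {}" unfolding osc_locus_def using osc_cone_nonzero[of 0] by blast
  thus "?T \<noteq> {}" using osc_locus_subset_closure by blast
  show "osc_cone \<subseteq> SymV 7" by (rule osc_cone_subset)
  show "cfun.span {w} \<in> ?T" if "w \<in> osc_cone" "w \<noteq> 0" for w
  proof -
    have "cfun.span {w} \<in> osc_locus" unfolding osc_locus_def using that by blast
    thus ?thesis using osc_locus_subset_closure by blast
  qed
  show "vanishes_on ?T F" if F: "F \<in> forms (SymV 7) d" and van: "\<And>w. w \<in> osc_cone \<Longrightarrow> w \<noteq> 0 \<Longrightarrow> F w = 0" for d F
  proof (rule vanishes_on_closure[OF F sub])
    show "vanishes_on osc_locus F"
      unfolding osc_locus_def by (rule vanishes_on_lines[OF F osc_cone_subset]) (rule van)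
  qed
  fix v w assume "v \<in> osc_cone" "w \<in> osc_cone"
  then obtain l m p q r l' m' p' q' r' where v: "v = binary_form 7 (osc_coords l m p q r)"
    and w: "w = binary_form 7 (osc_coords l' m' p' q' r')" unfolding osc_cone_def by blast
  define \<gamma> where "\<gamma> \<tau> = binary_form 7 (osc_coords (l + \<tau> * (l' - l)) (m + \<tau> * (m' - m))
    (p + \<tau> * (p' - p)) (q + \<tau> * (q' - q)) (r + \<tau> * (r' - r)))" for \<tau>
  have "polynomial_curve (SymV 7) \<gamma>"
    unfolding \<gamma>_def by (intro polynomial_curve_binary_form polyfun_osc_coords polyfun_line)
  moreover have "range \<gamma> \<subseteq> osc_cone" unfolding \<gamma>_def osc_cone_def by blast
  moreover have "\<gamma> 0 = v" "\<gamma> 1 = w" by (simp_all add: \<gamma>_def v w)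
  ultimately show "\<exists>\<gamma>. polynomial_curve (SymV 7) \<gamma> \<and> range \<gamma> \<subseteq> osc_cone \<and> v \<in> range \<gamma> \<and> w \<in> range \<gamma>"
    by (intro exI[of _ \<gamma>] conjI) (auto intro: rangeI[of \<gamma> 0] rangeI[of \<gamma> 1])
qed

section \<open>A quartic separating the osculating variety from its hull\<close>

definition minor2 :: "(nat \<Rightarrow> complex) \<Rightarrow> nat \<Rightarrow> nat \<Rightarrow> nat \<Rightarrow> nat \<Rightarrow> complex" where
  "minor2 a p q i j = a (p + i) * a (q + j) - a (p + j) * a (q + i)"

text \<open>The determinant of the matrix with rows \<open>(a\<^sub>i, a\<^bsub>i+1\<^esub>, a\<^bsub>i+2\<^esub>, a\<^bsub>i+3\<^esub>)\<close> for \<open>i = 0, 2, 3, 4\<close>, in its Laplace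
  expansion along the first two rows, which exhibits it as a form of degree four. Row 1 is left out
  because it is zero at the point used in \<open>closure_osc_locus_neq\<close>.\<close>

definition hankel :: "(nat \<Rightarrow> complex) \<Rightarrow> complex" where
  "hankel a = minor2 a 0 2 0 1 * minor2 a 3 4 2 3 - minor2 a 0 2 0 2 * minor2 a 3 4 1 3 +
     minor2 a 0 2 0 3 * minor2 a 3 4 1 2 + minor2 a 0 2 1 2 * minor2 a 3 4 0 3 -
     minor2 a 0 2 1 3 * minor2 a 3 4 0 2 + minor2 a 0 2 2 3 * minor2 a 3 4 0 1"

text \<open>The recurrence makes the last column of the matrix a combination of the other three.\<close>

lemma hankel_recurrence:
  assumes "\<And>k. k \<le> 4 \<Longrightarrow> a (k + 3) = x * a (k + 2) + y * a (k + 1) + z * a k"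
  shows "hankel a = 0"
proof -
  have "a 3 = x * a 2 + y * a 1 + z * a 0" "a 5 = x * a 4 + y * a 3 + z * a 2"
    "a 6 = x * a 5 + y * a 4 + z * a 3" "a 7 = x * a 6 + y * a 5 + z * a 4"
    using assms[of 0] assms[of 2] assms[of 3] assms[of 4] by (simp_all add: numeral_eq_Suc)
  moreover have "minor2 a 0 2 0 1 = a 0 * a 3 - a 1 * a 2" "minor2 a 0 2 0 2 = a 0 * a 4 - a 2 * a 2"
    "minor2 a 0 2 0 3 = a 0 * a 5 - a 3 * a 2" "minor2 a 0 2 1 2 = a 1 * a 4 - a 2 * a 3"
    "minor2 a 0 2 1 3 = a 1 * a 5 - a 3 * a 3" "minor2 a 0 2 2 3 = a 2 * a 5 - a 3 * a 4"
    "minor2 a 3 4 0 1 = a 3 * a 5 - a 4 * a 4" "minor2 a 3 4 0 2 = a 3 * a 6 - a 5 * a 4"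
    "minor2 a 3 4 0 3 = a 3 * a 7 - a 6 * a 4" "minor2 a 3 4 1 2 = a 4 * a 6 - a 5 * a 5"
    "minor2 a 3 4 1 3 = a 4 * a 7 - a 6 * a 5" "minor2 a 3 4 2 3 = a 5 * a 7 - a 6 * a 6"
    by (simp_all add: minor2_def numeral_eq_Suc)
  ultimately show ?thesis unfolding hankel_def by algebra
qed

text \<open>The sequences \<open>t\<^sup>i P(i)\<close> with \<open>P\<close> of degree at most two are annihilated by the third power of
  \<open>shift - t\<close>; here \<open>t = m / l\<close>, cleared of denominators.\<close>

lemma osc_coords_recurrence:
  assumes "k \<le> 4"
  shows "l^3 * osc_coords l m p q r (k + 3) =
    3 * l^2 * m * osc_coords l m p q r (k + 2) - 3 * l * m^2 * osc_coords l m p q r (k + 1) + m^3 * osc_coords l m p q r k"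
proof -
  have "k \<in> {0, 1, 2, 3, 4}" using assms by auto
  thus ?thesis
    by (elim insertE emptyE) (simp_all add: osc_coords_def field_simps eval_nat_numeral)
qed

text \<open>For \<open>l = 0\<close> the recurrence degenerates, but then \<open>a\<^sub>0, \<dots>, a\<^sub>4\<close> are zero, and with them a row
  of the matrix.\<close>

lemma hankel_osc_coords: "hankel (osc_coords l m p q r) = 0"
proof (cases "l = 0")
  case True
  thus ?thesis by (simp add: hankel_def minor2_def osc_coords_def)
next
  case False
  have solve: "A = b / L * B + (- c / L) * C + e / L * E"
    if "L * A = b * B - c * C + e * E" "L \<noteq> 0" for A B C E L b c e :: complex
    using that by (simp add: field_simps)
  show ?thesis
    by (rule hankel_recurrence, rule solve[OF osc_coords_recurrence]) (use False in simp_all)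
qed

lemma hankel_form: "(\<lambda>w. hankel (\<lambda>i. coord 7 i w)) \<in> forms (SymV 7) 4"
proof -
  have m: "(\<lambda>w. minor2 (\<lambda>i. coord 7 i w) p q i j) \<in> forms (SymV 7) 2"
    if "p + i \<le> 7" "q + j \<le> 7" "p + j \<le> 7" "q + i \<le> 7" for p q i j
    unfolding minor2_def by (intro forms_diff coord_product_form that)
  have mm: "(\<lambda>w. minor2 (\<lambda>i. coord 7 i w) 0 2 i j * minor2 (\<lambda>i. coord 7 i w) 3 4 k l) \<in> forms (SymV 7) 4"
    if "i \<le> 3" "j \<le> 3" "k \<le> 3" "l \<le> 3" for i j k l
    using forms_mult[OF m[of 0 i 2 j] m[of 3 k 4 l]] that by simp
  show ?thesis
    unfolding hankel_def by (intro forms_add forms_diff mm) simp_all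
qed

text \<open>The transvectant vanishes at \<open>x\<^sup>7 + 21 x\<^sup>2 y\<^sup>5\<close> because no term of it involves only \<open>a\<^sub>0\<close> and \<open>a\<^sub>5\<close>, while
  the Hankel determinant is \<open>- a\<^sub>0 a\<^sub>5\<^sup>3\<close> there.\<close>

lemma closure_osc_locus_neq: "zariski (SymV 7) closure_of osc_locus \<noteq> apolar_locus"
proof
  let ?a = "\<lambda>i::nat. of_bool (i = 0 \<or> i = 5) :: complex"
  assume eq: "zariski (SymV 7) closure_of osc_locus = apolar_locus"
  have "binary_form 7 ?a \<noteq> 0"
  proof
    assume "binary_form 7 ?a = 0"
    hence "binary_form 7 ?a = binary_form 7 (\<lambda>_. 0)" by (simp add: binary_form_zero)
    from binary_form_coeff_unique[OF this, of 0] show False by simp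
  qed
  moreover have "binary_form 7 ?a \<in> apolar_cone"
    unfolding apolar_cone_def by (rule CollectI, rule exI[of _ ?a]) (simp add: apolar_def)
  ultimately have P: "cfun.span {binary_form 7 ?a} \<in> apolar_locus" unfolding apolar_locus_def by blast
  have mem: "binary_form 7 ?a \<in> cfun.span {binary_form 7 ?a}" by (rule cfun.span_base) simp
  have cong: "hankel (\<lambda>i. coord 7 i (binary_form 7 a)) = hankel a" for a
    by (simp add: hankel_def minor2_def coord_binary_form)
  have "vanishes_on osc_locus (\<lambda>w. hankel (\<lambda>i. coord 7 i w))"
    unfolding osc_locus_def
  proof (rule vanishes_on_lines[OF hankel_form osc_cone_subset])
    fix w assume "w \<in> osc_cone"
    then obtain l m p q r where "w = binary_form 7 (osc_coords l m p q r)" unfolding osc_cone_def by blast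
    thus "hankel (\<lambda>i. coord 7 i w) = 0" by (simp add: cong hankel_osc_coords)
  qed
  hence "vanishes_on apolar_locus (\<lambda>w. hankel (\<lambda>i. coord 7 i w))"
    using vanishes_on_closure[OF hankel_form] osc_locus_subset apolar_locus_subset
    unfolding eq[symmetric] by blast
  hence "hankel (\<lambda>i. coord 7 i (binary_form 7 ?a)) = 0"
    using P mem unfolding vanishes_on_def by blast
  thus False unfolding cong by (simp add: hankel_def minor2_def)
qed

section \<open>Growth of the space of forms on the hull\<close>

text \<open>The monomials that are not divisible by the leading monomials \<open>a\<^sub>3\<^sup>2\<close>, \<open>a\<^sub>4\<^sup>2\<close> and \<open>a\<^sub>0 a\<^sub>7\<close> of the three
  quadrics.\<close>

definition reduced :: "nat \<Rightarrow> nat multiset set" where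
  "reduced d = {N. size N = d \<and> set_mset N \<subseteq> {..7} \<and>
     \<not> {#3, 3#} \<subseteq># N \<and> \<not> {#4, 4#} \<subseteq># N \<and> \<not> {#0, 7#} \<subseteq># N}"

text \<open>The weights are chosen such that in each of the three quadrics the leading monomial outweighs the other
  three. As the leading monomials are pairwise coprime, few monomials remain after the reduction.\<close>

definition weight :: "nat \<Rightarrow> nat" where
  "weight i = (if i = 0 \<or> i = 7 then 4 else if i = 3 \<or> i = 4 then 3 else 0)"

lemma monomial_add: "monomial r (M + N) w = monomial r M w * monomial r N w"
  by (simp add: monomial_def)

lemma apolar_cone_relation:
  assumes "(x, y) \<in> {(3, 3), (4, 4), (0, 7)}"
  obtains c1 x1 y1 c2 x2 y2 c3 x3 y3 where
    "{x1, y1, x2, y2, x3, y3} \<subseteq> {..7}"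
    "weight x1 + weight y1 < weight x + weight y" "weight x2 + weight y2 < weight x + weight y"
    "weight x3 + weight y3 < weight x + weight y"
    "\<And>w. w \<in> apolar_cone \<Longrightarrow> monomial 7 {#x, y#} w =
       c1 * monomial 7 {#x1, y1#} w + c2 * monomial 7 {#x2, y2#} w + c3 * monomial 7 {#x3, y3#} w"
proof -
  have a: "apolar (\<lambda>i. coord 7 i w)" if w: "w \<in> apolar_cone" for w
  proof -
    obtain a where "w = binary_form 7 a" "apolar a" using w unfolding apolar_cone_def by blast
    thus ?thesis by (simp add: apolar_def coord_binary_form)
  qed
  consider "x = 3" "y = 3" | "x = 4" "y = 4" | "x = 0" "y = 7"
    using assms by auto
  thus ?thesis
  proof cases
    case 1
    show ?thesis
    proof (rule that[of 0 6 1 5 2 4 "1 / 10" "- 6 / 10" "15 / 10"])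
      fix w assume "w \<in> apolar_cone"
      from a[OF this] show "monomial 7 {#x, y#} w = 1 / 10 * monomial 7 {#0, 6#} w +
          (- 6 / 10) * monomial 7 {#1, 5#} w + 15 / 10 * monomial 7 {#2, 4#} w"
        unfolding 1 by (simp add: apolar_def monomial_def field_simps power2_eq_square)
    qed (simp_all add: 1 weight_def)
  next
    case 2
    show ?thesis
    proof (rule that[of 1 7 2 6 3 5 "1 / 10" "- 6 / 10" "15 / 10"])
      fix w assume "w \<in> apolar_cone"
      from a[OF this] show "monomial 7 {#x, y#} w = 1 / 10 * monomial 7 {#1, 7#} w +
          (- 6 / 10) * monomial 7 {#2, 6#} w + 15 / 10 * monomial 7 {#3, 5#} w"
        unfolding 2 by (simp add: apolar_def monomial_def field_simps power2_eq_square)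
    qed (simp_all add: 2 weight_def)
  next
    case 3
    show ?thesis
    proof (rule that[of 1 6 2 5 3 4 5 "- 9" 5])
      fix w assume "w \<in> apolar_cone"
      from a[OF this] show "monomial 7 {#x, y#} w = 5 * monomial 7 {#1, 6#} w +
          (- 9) * monomial 7 {#2, 5#} w + 5 * monomial 7 {#3, 4#} w"
        unfolding 3 by (simp add: apolar_def monomial_def algebra_simps)
    qed (simp_all add: 3 weight_def)
  qed
qed

lemma monomial_reduction:
  assumes "size N = d" "set_mset N \<subseteq> {..7}"
  shows "\<exists>h\<in>cfun.span (monomial 7 ` reduced d). \<forall>w\<in>apolar_cone. monomial 7 N w = h w"
  using assms
proof (induction "\<Sum>i\<in>#N. weight i" arbitrary: N rule: less_induct)
  case less
  show ?case
  proof (cases "N \<in> reduced d")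
    case True
    hence "monomial 7 N \<in> cfun.span (monomial 7 ` reduced d)" by (intro cfun.span_base imageI)
    thus ?thesis by blast
  next
    case False
    then obtain x y where xy: "{#x, y#} \<subseteq># N" and lead: "(x, y) \<in> {(3, 3), (4, 4), (0, 7)}"
      using less.prems unfolding reduced_def by blast
    obtain M where N: "N = {#x, y#} + M" using xy by (metis mset_subset_eq_exists_conv)
    obtain c1 x1 y1 c2 x2 y2 c3 x3 y3 where rel: "{x1, y1, x2, y2, x3, y3} \<subseteq> {..7}"
      "weight x1 + weight y1 < weight x + weight y" "weight x2 + weight y2 < weight x + weight y"
      "weight x3 + weight y3 < weight x + weight y"
      "\<And>w. w \<in> apolar_cone \<Longrightarrow> monomial 7 {#x, y#} w =
         c1 * monomial 7 {#x1, y1#} w + c2 * monomial 7 {#x2, y2#} w + c3 * monomial 7 {#x3, y3#} w"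
      using apolar_cone_relation[OF lead] by metis
    have IH: "\<exists>h\<in>cfun.span (monomial 7 ` reduced d). \<forall>w\<in>apolar_cone. monomial 7 ({#x', y'#} + M) w = h w"
      if "weight x' + weight y' < weight x + weight y" "x' \<le> 7" "y' \<le> 7" for x' y'
      using that less.prems by (intro less.hyps) (auto simp: N)
    obtain h1 where h1: "h1 \<in> cfun.span (monomial 7 ` reduced d)" "\<forall>w\<in>apolar_cone. monomial 7 ({#x1, y1#} + M) w = h1 w"
      using IH[OF rel(2)] rel(1) by auto
    obtain h2 where h2: "h2 \<in> cfun.span (monomial 7 ` reduced d)" "\<forall>w\<in>apolar_cone. monomial 7 ({#x2, y2#} + M) w = h2 w"
      using IH[OF rel(3)] rel(1) by auto
    obtain h3 where h3: "h3 \<in> cfun.span (monomial 7 ` reduced d)" "\<forall>w\<in>apolar_cone. monomial 7 ({#x3, y3#} + M) w = h3 w"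
      using IH[OF rel(4)] rel(1) by auto
    show ?thesis
    proof (rule bexI[of _ "(\<lambda>w. c1 * h1 w) + ((\<lambda>w. c2 * h2 w) + (\<lambda>w. c3 * h3 w))"])
      show "(\<lambda>w. c1 * h1 w) + ((\<lambda>w. c2 * h2 w) + (\<lambda>w. c3 * h3 w)) \<in> cfun.span (monomial 7 ` reduced d)"
        by (intro cfun.span_add cfun.span_scale h1(1) h2(1) h3(1))
      show "\<forall>w\<in>apolar_cone. monomial 7 N w = ((\<lambda>w. c1 * h1 w) + ((\<lambda>w. c2 * h2 w) + (\<lambda>w. c3 * h3 w))) w"
      proof
        fix w assume w: "w \<in> apolar_cone"
        show "monomial 7 N w = ((\<lambda>w. c1 * h1 w) + ((\<lambda>w. c2 * h2 w) + (\<lambda>w. c3 * h3 w))) w"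
          unfolding N monomial_add rel(5)[OF w] plus_fun_def
            h1(2)[rule_format, OF w, symmetric] h2(2)[rule_format, OF w, symmetric] h3(2)[rule_format, OF w, symmetric]
          by (simp add: algebra_simps)
      qed
    qed
  qed
qed

text \<open>In a reduced monomial \<open>a\<^sub>3\<close> and \<open>a\<^sub>4\<close> have exponent at most one, only one of \<open>a\<^sub>0\<close> and \<open>a\<^sub>7\<close> occurs, and the
  exponent of \<open>a\<^sub>6\<close> is determined by the degree. So there are two choices for each of the first two
  exponents, two for the one of \<open>a\<^sub>0\<close>, \<open>a\<^sub>7\<close> that occurs, and at most \<open>d + 1\<close> for each of the four
  remaining exponents.\<close>

lemma card_reduced: "finite (reduced d)" "card (reduced d) \<le> 8 * (d + 1) ^ 4"
proof -
  define \<phi> where "\<phi> N = ((count N 3, count N 4, count N 0 = 0), (count N 0 + count N 7, count N 1, count N 2, count N 5))"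
    for N :: "nat multiset"
  define B where "B = (({..1::nat} \<times> {..1::nat} \<times> (UNIV::bool set)) \<times> ({..d} \<times> {..d} \<times> {..d} \<times> {..d}))"
  have B: "finite B" "card B = 8 * (d + 1) ^ 4"
    by (simp_all add: B_def card_cartesian_product eval_nat_numeral)
  have size: "size N = (\<Sum>i\<le>7. count N i)" if "set_mset N \<subseteq> {..7}" for N :: "nat multiset"
    unfolding size_multiset_overloaded_eq using that
    by (intro sum.mono_neutral_left) (auto simp: not_in_iff)
  have expand: "(\<Sum>i\<le>7. f i) = f 0 + f 1 + f 2 + f 3 + f 4 + f 5 + f 6 + f (7::nat)" for f :: "nat \<Rightarrow> nat"
    by (simp add: numeral_eq_Suc)
  have sub: "\<phi> ` reduced d \<subseteq> B"
  proof (intro image_subsetI)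
    fix N assume N: "N \<in> reduced d"
    have "size N = d" "set_mset N \<subseteq> {..7}" using N by (auto simp: reduced_def)
    hence s: "count N 0 + count N 1 + count N 2 + count N 3 + count N 4 + count N 5 + count N 6 + count N 7 = d"
      using size[of N] unfolding expand by simp
    have "count N 3 \<le> 1" "count N 4 \<le> 1"
      using N by (auto simp: reduced_def subseteq_mset_def not_le split: if_splits)
    thus "\<phi> N \<in> B" using s unfolding \<phi>_def B_def mem_Times_iff by simp
  qed
  have inj: "inj_on \<phi> (reduced d)"
  proof (rule inj_onI)
    fix N M assume NM: "N \<in> reduced d" "M \<in> reduced d" "\<phi> N = \<phi> M"
    have s: "count L 0 + count L 1 + count L 2 + count L 3 + count L 4 + count L 5 + count L 6 + count L 7 = d"
        "count L 0 = 0 \<or> count L 7 = 0" "\<And>i. \<not> i \<le> 7 \<Longrightarrow> count L i = 0"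
      if "L \<in> reduced d" for L
    proof -
      have L: "size L = d" "set_mset L \<subseteq> {..7}" "\<not> {#0, 7#} \<subseteq># L" using that by (auto simp: reduced_def)
      thus "count L 0 + count L 1 + count L 2 + count L 3 + count L 4 + count L 5 + count L 6 + count L 7 = d"
        using size[of L] unfolding expand by simp
      show "count L 0 = 0 \<or> count L 7 = 0"
        using L(3) by (auto simp: subseteq_mset_def not_le split: if_splits)
      show "count L i = 0" if "\<not> i \<le> 7" for i using L(2) that by (auto simp: count_eq_zero_iff)
    qed
    have eqs: "count N 3 = count M 3" "count N 4 = count M 4" "count N 0 = 0 \<longleftrightarrow> count M 0 = 0"
      "count N 0 + count N 7 = count M 0 + count M 7" "count N 1 = count M 1" "count N 2 = count M 2" "count N 5 = count M 5"
      using NM(3) by (auto simp: \<phi>_def)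
    have e0: "count N 0 = count M 0" "count N 7 = count M 7"
      using eqs(3,4) s(2)[OF NM(1)] s(2)[OF NM(2)] by auto
    have e6: "count N 6 = count M 6" using eqs e0 s(1)[OF NM(1)] s(1)[OF NM(2)] by linarith
    have "count N i = count M i" for i
    proof (cases "i \<le> 7")
      case True
      thus ?thesis unfolding le_7_cases using eqs e0 e6 by (auto simp del: One_nat_def)
    next
      case False
      thus ?thesis using s(3)[OF NM(1)] s(3)[OF NM(2)] by simp
    qed
    thus "N = M" by (rule multiset_eqI)
  qed
  show "finite (reduced d)" using inj sub B(1) by (rule inj_on_finite)
  show "card (reduced d) \<le> 8 * (d + 1) ^ 4" using card_inj_on_le[OF inj sub B(1)] B(2) by simp
qed

lemma apolar_locus_growth:
  "\<exists>T. finite T \<and> card T \<le> 8 * (d + 1) ^ 4 \<and>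
    (\<forall>F\<in>forms (SymV 7) d. \<exists>h\<in>cfun.span T. \<forall>w\<in>\<Union>apolar_locus. F w = h w)"
proof (intro exI[of _ "monomial 7 ` reduced d"] conjI ballI)
  show "finite (monomial 7 ` reduced d)" using card_reduced(1) by simp
  show "card (monomial 7 ` reduced d) \<le> 8 * (d + 1) ^ 4"
    using card_image_le[OF card_reduced(1)] card_reduced(2) by (rule le_trans)
  fix F assume "F \<in> forms (SymV 7) d"
  hence "F \<in> cfun.span (monomial 7 ` {N. size N = d \<and> set_mset N \<subseteq> {..7}})" using forms_span_monomials by blast
  hence "\<exists>h\<in>cfun.span (monomial 7 ` reduced d). \<forall>w\<in>apolar_cone. F w = h w"
  proof (induction rule: cfun.span_induct_alt)
    case base
    show ?case using cfun.span_zero by (intro bexI[of _ 0]) auto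
  next
    case (step c x y)
    then obtain N where N: "x = monomial 7 N" "size N = d" "set_mset N \<subseteq> {..7}" by auto
    obtain h where h: "h \<in> cfun.span (monomial 7 ` reduced d)" "\<forall>w\<in>apolar_cone. x w = h w"
      using monomial_reduction[OF N(2,3)] unfolding N(1) by auto
    obtain k where k: "k \<in> cfun.span (monomial 7 ` reduced d)" "\<forall>w\<in>apolar_cone. y w = k w"
      using step(2) by auto
    have "(\<lambda>w. c * h w) + k \<in> cfun.span (monomial 7 ` reduced d)"
      by (intro cfun.span_add cfun.span_scale h(1) k(1))
    thus ?case by (rule bexI[rotated]) (simp add: h(2) k(2))
  qed
  thus "\<exists>h\<in>cfun.span (monomial 7 ` reduced d). \<forall>w\<in>\<Union>apolar_locus. F w = h w"
    using Union_apolar_locus by (meson subsetD)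
qed

section \<open>A chain of irreducible closed subsets\<close>

definition coord_cone :: "nat \<Rightarrow> (complex^2 \<Rightarrow> complex) set" where
  "coord_cone k = {binary_form 7 a | a. \<forall>i\<le>7. k < i \<longrightarrow> a i = 0}"

text \<open>The linear subspace spanned by \<open>x\<^sup>7, x\<^sup>6 y, \<dots>, x\<^bsup>7-k\<^esup> y\<^sup>k\<close>.\<close>

definition coord_locus :: "nat \<Rightarrow> (complex^2 \<Rightarrow> complex) set set" where
  "coord_locus k = {cfun.span {w} | w. w \<in> coord_cone k \<and> w \<noteq> 0}"

lemma coord_cone_subset: "coord_cone k \<subseteq> SymV 7"
  by (auto simp: coord_cone_def binary_form_in_SymV)

lemma coord_cone_iff: "w \<in> SymV 7 \<Longrightarrow> w \<in> coord_cone k \<longleftrightarrow> (\<forall>i\<le>7. k < i \<longrightarrow> coord 7 i w = 0)"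
proof
  assume "w \<in> coord_cone k"
  then obtain a where "w = binary_form 7 a" "\<forall>i\<le>7. k < i \<longrightarrow> a i = 0" unfolding coord_cone_def by blast
  thus "\<forall>i\<le>7. k < i \<longrightarrow> coord 7 i w = 0" by (simp add: coord_binary_form)
next
  assume "w \<in> SymV 7" "\<forall>i\<le>7. k < i \<longrightarrow> coord 7 i w = 0"
  thus "w \<in> coord_cone k"
    unfolding coord_cone_def by (intro CollectI exI[of _ "\<lambda>i. coord 7 i w"]) (simp add: binary_form_coord)
qed

lemma coord_locus_eq: "coord_locus k = zero_locus (SymV 7) {coord 7 i | i. k < i \<and> i \<le> 7}"
proof (intro equalityI subsetI)
  fix P assume "P \<in> coord_locus k"
  then obtain w where w: "w \<in> coord_cone k" "w \<noteq> 0" "P = cfun.span {w}" unfolding coord_locus_def by blast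
  have wW: "w \<in> SymV 7" using w(1) coord_cone_subset by blast
  have "coord 7 i v = 0" if "k < i" "i \<le> 7" "v \<in> P" for i v
  proof (rule form_vanishes_on_line[OF forms_dual[OF coord_dual] _ subspace_SymV])
    show "P \<in> proj (SymV 7)" unfolding w(3) by (rule span_in_proj[OF wW w(2)])
    show "w \<in> P" unfolding w(3) by (rule cfun.span_base) simp
    show "coord 7 i w = 0" using w(1) coord_cone_iff[OF wW] that by blast
  qed (use that w in auto)
  thus "P \<in> zero_locus (SymV 7) {coord 7 i | i. k < i \<and> i \<le> 7}"
    using span_in_proj[OF wW w(2)] w(3) by (auto simp: zero_locus_def)
next
  fix P assume P: "P \<in> zero_locus (SymV 7) {coord 7 i | i. k < i \<and> i \<le> 7}"
  then obtain w where w: "w \<in> SymV 7" "w \<noteq> 0" "P = cfun.span {w}" by (auto simp: zero_locus_def proj_def)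
  have "w \<in> P" unfolding w(3) by (rule cfun.span_base) simp
  hence "w \<in> coord_cone k" using P by (auto simp: coord_cone_iff[OF w(1)] zero_locus_def)
  thus "P \<in> coord_locus k" unfolding coord_locus_def using w(2,3) by blast
qed

lemma closedin_coord_locus: "closedin (zariski (SymV 7)) (coord_locus k)"
proof -
  have "{coord 7 i | i. k < i \<and> i \<le> 7} \<subseteq> (\<Union>d. forms (SymV 7) d)"
    using forms_dual[OF coord_dual] by auto
  thus ?thesis unfolding coord_locus_eq closedin_zariski by blast
qed

lemma coord_locus_mono: "j \<le> k \<Longrightarrow> coord_locus j \<subseteq> coord_locus k"
proof -
  assume "j \<le> k"
  hence "coord_cone j \<subseteq> coord_cone k" by (fastforce simp: coord_cone_def)
  thus ?thesis unfolding coord_locus_def by blast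
qed

lemma unit_binary_form_nonzero: "i \<le> 7 \<Longrightarrow> binary_form 7 (\<lambda>j. of_bool (j = i)) \<noteq> 0"
  using binary_form_coeff_unique[of 7 "\<lambda>j. of_bool (j = i)" "\<lambda>_. 0" i] by (auto simp: binary_form_zero)

lemma unit_in_coord_locus:
  assumes "i \<le> 7"
  shows "cfun.span {binary_form 7 (\<lambda>j. of_bool (j = i))} \<in> coord_locus k \<longleftrightarrow> i \<le> k"
proof
  let ?w = "binary_form 7 (\<lambda>j. of_bool (j = i)) :: complex^2 \<Rightarrow> complex"
  assume "i \<le> k"
  hence "?w \<in> coord_cone k" unfolding coord_cone_def by auto
  thus "cfun.span {?w} \<in> coord_locus k" unfolding coord_locus_def using unit_binary_form_nonzero[OF assms] by blast
next
  let ?w = "binary_form 7 (\<lambda>j. of_bool (j = i)) :: complex^2 \<Rightarrow> complex"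
  assume P: "cfun.span {?w} \<in> coord_locus k"
  have "?w \<in> cfun.span {?w}" by (rule cfun.span_base) simp
  hence "k < j \<Longrightarrow> j \<le> 7 \<Longrightarrow> coord 7 j ?w = 0" for j
    using P unfolding coord_locus_eq zero_locus_def by blast
  from this[of i] show "i \<le> k" using assms by (auto simp: coord_binary_form not_less[symmetric])
qed

lemma irreducible_coord_locus: "irreducible_space (subtopology (zariski (SymV 7)) (coord_locus k))"
proof (rule irreducible_by_curves[OF subspace_SymV])
  show "coord_locus k \<subseteq> proj (SymV 7)" unfolding coord_locus_eq zero_locus_def by blast
  show "coord_locus k \<noteq> {}" using unit_in_coord_locus[of 0 k] by auto
  show "coord_cone k \<subseteq> SymV 7" by (rule coord_cone_subset)
  show "cfun.span {w} \<in> coord_locus k" if "w \<in> coord_cone k" "w \<noteq> 0" for w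
    unfolding coord_locus_def using that by blast
  show "vanishes_on (coord_locus k) F"
    if F: "F \<in> forms (SymV 7) d" and van: "\<And>w. w \<in> coord_cone k \<Longrightarrow> w \<noteq> 0 \<Longrightarrow> F w = 0" for d F
    unfolding coord_locus_def by (rule vanishes_on_lines[OF F coord_cone_subset]) (rule van)
  fix v w assume "v \<in> coord_cone k" "w \<in> coord_cone k"
  then obtain a b where v: "v = binary_form 7 a" "\<forall>i\<le>7. k < i \<longrightarrow> a i = 0"
    and w: "w = binary_form 7 b" "\<forall>i\<le>7. k < i \<longrightarrow> b i = 0" unfolding coord_cone_def by blast
  define \<gamma> where "\<gamma> \<tau> = binary_form 7 (\<lambda>i. a i + \<tau> * (b i - a i))" for \<tau>
  have "polynomial_curve (SymV 7) \<gamma>"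
    unfolding \<gamma>_def by (intro polynomial_curve_binary_form polyfun_line)
  moreover have "\<gamma> \<tau> \<in> coord_cone k" for \<tau>
    unfolding \<gamma>_def coord_cone_def
    by (rule CollectI, rule exI[of _ "\<lambda>i. a i + \<tau> * (b i - a i)"]) (simp add: v(2) w(2))
  moreover have "\<gamma> 0 = v" "\<gamma> 1 = w" by (simp_all add: \<gamma>_def v w)
  ultimately show "\<exists>\<gamma>. polynomial_curve (SymV 7) \<gamma> \<and> range \<gamma> \<subseteq> coord_cone k \<and> v \<in> range \<gamma> \<and> w \<in> range \<gamma>"
    by (intro exI[of _ \<gamma>] conjI) (auto intro: rangeI[of \<gamma> 0] rangeI[of \<gamma> 1])
qed

text \<open>The forms with \<open>a\<^sub>i = 0\<close> for \<open>i > 2\<close> are those divisible by \<open>x\<^sup>5\<close>, and \<open>y\<^sup>7 = y\<^sup>5 y\<^sup>2\<close> belongs to the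
  osculating variety but not to them.\<close>

lemma coord_locus_2_subset: "coord_locus 2 \<subset> zariski (SymV 7) closure_of osc_locus"
proof -
  have "coord_cone 2 \<subseteq> osc_cone"
  proof
    fix w assume "w \<in> coord_cone 2"
    then obtain a where a: "w = binary_form 7 a" "\<forall>i\<le>7. 2 < i \<longrightarrow> a i = 0" unfolding coord_cone_def by blast
    have "binary_form 7 a = binary_form 7 (osc_coords 1 0 (a 0) (7 * a 1) (21 * a 2))"
      by (rule binary_form_cong) (use a(2) in \<open>unfold le_7_cases, auto simp: osc_coords_def\<close>)
    thus "w \<in> osc_cone" unfolding osc_cone_def a(1) by blast
  qed
  hence "coord_locus 2 \<subseteq> osc_locus" unfolding coord_locus_def osc_locus_def by blast
  moreover have "cfun.span {binary_form 7 (\<lambda>j. of_bool (j = 7))} \<in> osc_locus"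
  proof -
    have "binary_form 7 (\<lambda>j. of_bool (j = 7)) = binary_form 7 (osc_coords 0 1 0 0 1)"
      by (rule binary_form_cong) (unfold le_7_cases, auto simp: osc_coords_def)
    hence "binary_form 7 (\<lambda>j. of_bool (j = 7)) \<in> osc_cone" unfolding osc_cone_def by blast
    thus ?thesis unfolding osc_locus_def using unit_binary_form_nonzero[of 7] by blast
  qed
  moreover have "cfun.span {binary_form 7 (\<lambda>j. of_bool (j = 7))} \<notin> coord_locus 2"
    by (simp add: unit_in_coord_locus)
  ultimately show ?thesis using osc_locus_subset_closure by blast
qed

lemma krull_dim_apolar_locus:
  "krull_dim (subtopology (zariski (SymV 7)) apolar_locus) = 4"
proof (rule antisym)
  have "krull_dim (subtopology (zariski (SymV 7)) apolar_locus) \<le> enat 4"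
    by (rule krull_dim_le[OF subspace_SymV closedin_apolar_locus apolar_locus_growth])
  thus "krull_dim (subtopology (zariski (SymV 7)) apolar_locus) \<le> 4" by (simp add: numeral_eq_enat)
next
  let ?T = "zariski (SymV 7) closure_of osc_locus" and ?X = "subtopology (zariski (SymV 7)) apolar_locus"
  define C where "C i = (if i \<le> 2 then coord_locus i else if i = 3 then ?T else apolar_locus)" for i :: nat
  have T: "?T \<subset> apolar_locus" using closure_osc_locus_subset closure_osc_locus_neq by blast
  have strict: "C i \<subset> C (Suc i)" if i: "i < 4" for i
  proof -
    consider "i < 2" | "i = 2" | "i = 3" using i by linarith
    thus ?thesis
    proof cases
      case 1
      have "cfun.span {binary_form 7 (\<lambda>j. of_bool (j = Suc i))} \<in> coord_locus (Suc i)"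
        "cfun.span {binary_form 7 (\<lambda>j. of_bool (j = Suc i))} \<notin> coord_locus i"
        using 1 by (simp_all add: unit_in_coord_locus)
      thus ?thesis using coord_locus_mono[of i "Suc i"] 1 by (auto simp: C_def)
    next
      case 2
      thus ?thesis using coord_locus_2_subset by (simp add: C_def)
    next
      case 3
      thus ?thesis using T by (simp add: C_def)
    qed
  qed
  have sub: "C i \<subseteq> apolar_locus" for i
    using coord_locus_mono[of i 2] coord_locus_2_subset T by (auto simp: C_def)
  have "closedin (zariski (SymV 7)) (C i)" "irreducible_space (subtopology (zariski (SymV 7)) (C i))" for i
    by (auto simp: C_def closedin_coord_locus closedin_apolar_locus irreducible_coord_locus
        irreducible_apolar_locus irreducible_closure_osc_locus)
  hence "closedin ?X (C i) \<and> irreducible_space (subtopology ?X (C i))" for i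
    using sub[of i] by (simp add: closedin_subset_topspace closedin_closed_subtopology closedin_apolar_locus
        subtopology_subtopology Int_absorb1)
  hence "enat 4 \<in> {enat n | n. \<exists>C :: nat \<Rightarrow> (complex^2 \<Rightarrow> complex) set set.
     (\<forall>i\<le>n. closedin ?X (C i) \<and> irreducible_space (subtopology ?X (C i))) \<and>
     (\<forall>i<n. C i \<subset> C (Suc i))}"
    using strict by blast
  hence "enat 4 \<le> krull_dim ?X" unfolding krull_dim_def by (rule Sup_upper)
  thus "4 \<le> krull_dim ?X" by (simp add: numeral_eq_enat)
qed

theorem proposition4p1:
  fixes u :: "complex^2"
  assumes "u \<noteq> 0"
  shows "M_variety 2 7 u = quadratic_hull (SymV 7) (osculating_variety 2 7 u) \<and>
    irreducible_space (subtopology (zariski (SymV 7)) (M_variety 2 7 u)) \<and>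
    krull_dim (subtopology (zariski (SymV 7)) (M_variety 2 7 u)) = 4 \<and>
    osculating_variety 2 7 u \<subset> M_variety 2 7 u"
proof (intro conjI)
  show "M_variety 2 7 u = quadratic_hull (SymV 7) (osculating_variety 2 7 u)"
    by (rule M_variety_def)
  show "irreducible_space (subtopology (zariski (SymV 7)) (M_variety 2 7 u))"
    unfolding M_variety_eq[OF assms] by (rule irreducible_apolar_locus)
  show "krull_dim (subtopology (zariski (SymV 7)) (M_variety 2 7 u)) = 4"
    unfolding M_variety_eq[OF assms] by (rule krull_dim_apolar_locus)
  show "osculating_variety 2 7 u \<subset> M_variety 2 7 u"
    unfolding M_variety_eq[OF assms] osculating_variety_eq[OF assms]
    using closure_osc_locus_subset closure_osc_locus_neq by blast
qed

end
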